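(* For formal variables $T$, $q$ and $u$, $$\sum_{\lambda\in\mathcal{DD}'} (-u)^{-d_\lambda}T^{|\lambda|/2}\prod_{s\in\lambda}\frac{1-u^{-2\varepsilon_s}q^{h_s}}{1-q^{h_s}}\prod_{s\in\Delta}\frac{1+uq^{h_s/2}}{1+u^{-1}q^{h_s/2}}=\prod_{m\ge 1}\left(1+u^{-1}T^{m}\right)\prod_{r\ge 1}\frac{1+u^{-1}q^rT^{m}}{1+u q^{r}T^{m}}\cdot\frac{ \left(1-q^{r+1}u^{2}T^m\right)^{\lceil r/2 \rceil}\left(1-q^{r}u^{-2}T^m\right)^{\lceil r/2 \rceil}}{\left(1-q^{r}T^m\right)^{\lceil r/2 \rceil}\left(1-q^{r+1}T^m\right)^{\lceil r/2 \rceil}},$$ where on the right-hand side the product over $r$ is taken inside the product over $m$.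
   Context: The identity is one of formal power series in $T$. For a partition $\lambda$, $h_s$ is the hook length of a box $s$, $\Delta$ is the set of boxes on the main diagonal of the Ferrers diagram (English convention), $d_\lambda=\max\{s:\lambda_s\ge s\}$ is the Durfee square size ($0$ for the empty partition), and $\varepsilon_s=-1$ if $s$ is strictly below the main diagonal, $\varepsilon_s=1$ otherwise. $\mathcal{DD}$ is the set of partitions with $\lambda_i=\lambda'_i+1$ for $1\le i\le d_\lambda$ ($\lambda'$ the conjugate; the empty partition included), and $\mathcal{DD}'=\{\lambda'\mid\lambda\in\mathcal{DD}\}$. For $\lambda\in\mathcal{DD}'$ the hook lengths of diagonal boxes are even. This is the $q$-Nekrasov–Okounkov formula attached to the affine type $A^{(2)}_{2t-1}$.
   Formalization: The prefactor (-u)^{-d_λ} is corrected to u^{-d_λ}: as printed the identity fails at T^1 q^0, where the only partition (1,1) gives -1/u on the left while the product gives +1/u. *)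

theory Defs
  imports Complex_Main "HOL-Computational_Algebra.Computational_Algebra"
begin

(* Partitions are weakly decreasing lists of positive parts; rows and columns are
   numbered from 1, and part xs i = 0 beyond the last part. *)

definition partitions :: "nat list set" where
  "partitions = {xs. sorted_wrt (\<ge>) xs \<and> 0 \<notin> set xs}"

definition part :: "nat list \<Rightarrow> nat \<Rightarrow> nat" where
  "part xs i = (if 1 \<le> i \<and> i \<le> length xs then xs ! (i - 1) else 0)"

definition conjugate :: "nat list \<Rightarrow> nat list" where
  "conjugate xs = map (\<lambda>j. card {i. j \<le> part xs i}) [1..<Suc (part xs 1)]"

definition boxes :: "nat list \<Rightarrow> (nat \<times> nat) set" where
  "boxes xs = {(i, j). 1 \<le> i \<and> 1 \<le> j \<and> j \<le> part xs i}"

definition diagonal :: "nat list \<Rightarrow> (nat \<times> nat) set" where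
  "diagonal xs = {(i, j) \<in> boxes xs. i = j}"

(* Arm plus leg plus one; no subtraction truncates when the box lies in the diagram. *)
definition hook :: "nat list \<Rightarrow> nat \<times> nat \<Rightarrow> nat" where
  "hook xs s = (case s of (i, j) \<Rightarrow> (part xs i - j) + (part (conjugate xs) j - i) + 1)"

definition eps :: "nat \<times> nat \<Rightarrow> int" where
  "eps s = (case s of (i, j) \<Rightarrow> if i > j then - 1 else 1)"

definition durfee :: "nat list \<Rightarrow> nat" where
  "durfee xs = Max (insert 0 {s. 1 \<le> s \<and> s \<le> part xs s})"

definition DD :: "nat list set" where
  "DD = {xs \<in> partitions. \<forall>i\<in>{1..durfee xs}. part xs i = part (conjugate xs) i + 1}"

definition DD' :: "nat list set" where
  "DD' = conjugate ` DD"

(* The ring is Q(u)[[q]][[T]]: the outer power series variable is T, the inner one is q. *)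

type_synonym ratfun = "rat poly fract"

definition u :: ratfun where
  "u = to_fract [:0, 1:]"

definition q :: "ratfun fps" where
  "q = fps_X"

definition T :: "ratfun fps fps" where
  "T = fps_X"

(* The sign prefactor is u^(-d), not (-u)^(-d). With (-u)^(-d) the identity fails already at
   T^1 q^0: the only partition of 2 in DD' is [1, 1], with d = 1, so the sum would give -1/u
   there, whereas the product gives 1/u. *)
definition weight :: "nat list \<Rightarrow> ratfun fps" where
  "weight xs =
     fps_const (u powi (- int (durfee xs)))
     * (\<Prod>s\<in>boxes xs. (1 - fps_const (u powi (- 2 * eps s)) * q ^ hook xs s) / (1 - q ^ hook xs s))
     * (\<Prod>s\<in>diagonal xs. (1 + fps_const u * q ^ (hook xs s div 2))
                          / (1 + fps_const (inverse u) * q ^ (hook xs s div 2)))"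

(* Every partition in DD' has even size, so this is the sum over DD' of T^(size/2) * weight. *)
definition DD'_series :: "ratfun fps fps" where
  "DD'_series = Abs_fps (\<lambda>n. \<Sum>xs | xs \<in> DD' \<and> sum_list xs = 2 * n. weight xs)"

lemma finite_partitions_of_size: "finite {xs \<in> partitions. sum_list xs = n}"
proof -
  have "length xs \<le> sum_list xs" if "0 \<notin> set xs" for xs :: "nat list"
    using that by (induction xs) auto
  then have "{xs \<in> partitions. sum_list xs = n} \<subseteq> {xs. set xs \<subseteq> {..n} \<and> length xs \<le> n}"
    by (auto simp: partitions_def dest: member_le_sum_list)
  then show ?thesis
    using finite_lists_length_le[of "{..n}" n] finite_subset by blast
qed

(* Infinite products over k = 1, 2, ... in K[[q]][[T]]. Convergence is coefficientwise in T and
   q-adic in each coefficient; the metric of the library on the outer power series type is only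
   T-adic, in which the products over r below diverge. *)

definition fprod_converges :: "(nat \<Rightarrow> 'a::field fps fps) \<Rightarrow> bool" where
  "fprod_converges f \<longleftrightarrow> (\<forall>n. convergent (\<lambda>N. fps_nth (\<Prod>k=1..N. f k) n))"

definition fprod :: "(nat \<Rightarrow> 'a::field fps fps) \<Rightarrow> 'a fps fps" where
  "fprod f = Abs_fps (\<lambda>n. lim (\<lambda>N. fps_nth (\<Prod>k=1..N. f k) n))"

abbreviation cu :: "ratfun \<Rightarrow> ratfun fps fps" where
  "cu c \<equiv> fps_const (fps_const c)"

abbreviation Q :: "ratfun fps fps" where
  "Q \<equiv> fps_const q"

definition inner_factor :: "nat \<Rightarrow> nat \<Rightarrow> ratfun fps fps" where
  "inner_factor m r =
     (1 + cu (inverse u) * Q ^ r * T ^ m) / (1 + cu u * Q ^ r * T ^ m)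
     * (((1 - Q ^ (r + 1) * cu (u ^ 2) * T ^ m) ^ nat \<lceil>real r / 2\<rceil>
         * (1 - Q ^ r * cu (u powi (- 2)) * T ^ m) ^ nat \<lceil>real r / 2\<rceil>)
        / ((1 - Q ^ r * T ^ m) ^ nat \<lceil>real r / 2\<rceil>
         * (1 - Q ^ (r + 1) * T ^ m) ^ nat \<lceil>real r / 2\<rceil>))"

definition outer_factor :: "nat \<Rightarrow> ratfun fps fps" where
  "outer_factor m = (1 + cu (inverse u) * T ^ m) * fprod (inner_factor m)"

end

theory Submission
  imports Defs
begin

text \<open>
  A partition in DD' is determined by the finite set A of half diagonal hook lengths: its beads
  (the numbers part i - i + 1) are the elements of A, the number 0 and the numbers -j with j > 0,
  j not in A. So it is encoded by a choice of signs, which turns the sequence 0, -1, -2, ... into the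
  sequence with i-th entry i for i in A and -i otherwise. The weight extends to an alternating function of
  all integer sequences, a Vandermonde-like product in x + 1 / (u^2 x) with x = q^p. Let U and D
  be the operators that sum over all ways to move one bead up, respectively down, by k.

  Three facts determine the generating function f. By a residue calculation the weight is an
  eigenvector of U + D. For an alternating function w, the sum over the sign choices, weighted by powers
  of T, of D w + T^k U w is a multiple of that of w, since flipping the signs of the moved bead and of the
  bead it meets makes the other terms cancel in pairs. Finally, the sum over k of U D, with the downward move kept above the bottom of the
  sequence, acts as multiplication by the size of the partition. Eliminating the moves gives
  T f' = E f with an explicit series E. The infinite product has the same logarithmic derivative.
\<close>

section \<open>Alternating functions of integer sequences\<close>

text \<open>There are infinitely many beads, but the weight is computed on N + 1 of them, truncated
  at -N, and the truncation shapes the proof. \<open>sea\<close> and the power of u q^(-N) in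
  \<open>bead\<close> stand for the beads that are cut off, so that ratios of weights of sign
  choices do not depend on N. The eigenvector relation for moves by k is available only while the k
  lowest positions are occupied, and a bead pushed below -N and brought back has to be counted by
  hand. Hence series are compared modulo T^(n+1), with N = 3 n.

  The size is quadratic in the moves, while the relations at hand are linear in them: U w = eig w -
  D w, and the reflection, which ties the sums of U w and D w to that of w. Writing the double move
  through D w and D (D w), and using the reflection for w and again for D w, closes the system; the
  square of the eigenvalue in \<open>log_coeff\<close> is the trace of this.

  The eigenvalue is a sum of residues: with x = q^p, a move up is a summand at x and a move down the
  same summand at the mirror point 1 / (u^2 x).\<close>

definition pair_prod :: "(int \<Rightarrow> int \<Rightarrow> 'a::comm_ring_1) \<Rightarrow> nat set \<Rightarrow> (nat \<Rightarrow> int) \<Rightarrow> 'a" where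
  "pair_prod \<kappa> I p = (\<Prod>j\<in>I. \<Prod>i\<in>{i\<in>I. i < j}. \<kappa> (p i) (p j))"

lemma pair_prod_cong:
  assumes "\<And>i. i \<in> I \<Longrightarrow> p i = p' i"
  shows "pair_prod \<kappa> I p = pair_prod \<kappa> I p'"
  unfolding pair_prod_def using assms by (auto intro!: prod.cong)

text \<open>Pulling out k turns around every factor that has k as its second index. There is one for
  each index below k, which gives the sign; after that the factors of k no longer depend on the
  order of the indices.\<close>

lemma pair_prod_isolate:
  assumes I: "finite I" "k \<in> I" and anti: "\<And>a b. \<kappa> a b = - \<kappa> b a"
  shows "pair_prod \<kappa> I p = (-1) ^ card {i\<in>I. i < k} * (\<Prod>j\<in>I-{k}. \<kappa> (p k) (p j)) * pair_prod \<kappa> (I-{k}) p"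
proof -
  have fin: "finite (I - {k})" using I by auto
  have row: "(\<Prod>i\<in>{i\<in>I. i < j}. \<kappa> (p i) (p j)) =
      (if k < j then \<kappa> (p k) (p j) else 1) * (\<Prod>i\<in>{i\<in>I-{k}. i < j}. \<kappa> (p i) (p j))" if "j \<in> I - {k}" for j
  proof (cases "k < j")
    case True
    then have "{i\<in>I. i < j} = insert k {i\<in>I-{k}. i < j}" using I by auto
    then show ?thesis using True I by (simp add: prod.insert)
  next
    case False
    then have "{i\<in>I. i < j} = {i\<in>I-{k}. i < j}" using that by auto
    then show ?thesis using False by simp
  qed
  have low: "{i\<in>I. i < k} = {i\<in>I-{k}. i < k}" by auto
  have "(\<Prod>i\<in>{i\<in>I. i < k}. \<kappa> (p i) (p k)) = (\<Prod>i\<in>{i\<in>I. i < k}. (-1) * \<kappa> (p k) (p i))"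
  proof (rule prod.cong[OF refl])
    fix i show "\<kappa> (p i) (p k) = (-1) * \<kappa> (p k) (p i)"
      using anti[of "p i" "p k"] by simp
  qed
  also have "\<dots> = (-1) ^ card {i\<in>I. i < k} * (\<Prod>i\<in>{i\<in>I. i < k}. \<kappa> (p k) (p i))"
    unfolding prod.distrib by simp
  also have "(\<Prod>i\<in>{i\<in>I. i < k}. \<kappa> (p k) (p i)) = (\<Prod>i\<in>I-{k}. if i < k then \<kappa> (p k) (p i) else 1)"
    unfolding low by (rule prod.inter_filter[OF fin])
  finally have col: "(\<Prod>i\<in>{i\<in>I. i < k}. \<kappa> (p i) (p k)) =
    (-1) ^ card {i\<in>I. i < k} * (\<Prod>i\<in>I-{k}. if i < k then \<kappa> (p k) (p i) else 1)" .
  have "pair_prod \<kappa> I p = (\<Prod>i\<in>{i\<in>I. i < k}. \<kappa> (p i) (p k)) *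
      (\<Prod>j\<in>I-{k}. \<Prod>i\<in>{i\<in>I. i < j}. \<kappa> (p i) (p j))"
    unfolding pair_prod_def using I by (simp add: prod.remove)
  also have "(\<Prod>j\<in>I-{k}. \<Prod>i\<in>{i\<in>I. i < j}. \<kappa> (p i) (p j)) =
     (\<Prod>j\<in>I-{k}. (if k < j then \<kappa> (p k) (p j) else 1)) * pair_prod \<kappa> (I-{k}) p"
    unfolding pair_prod_def by (simp add: row flip: prod.distrib)
  also have "(\<Prod>i\<in>{i\<in>I. i < k}. \<kappa> (p i) (p k)) * \<dots> = (-1) ^ card {i\<in>I. i < k} *
     (\<Prod>j\<in>I-{k}. (if j < k then \<kappa> (p k) (p j) else 1) * (if k < j then \<kappa> (p k) (p j) else 1)) * pair_prod \<kappa> (I-{k}) p"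
    unfolding col by (simp add: prod.distrib mult_ac)
  also have "(\<Prod>j\<in>I-{k}. (if j < k then \<kappa> (p k) (p j) else 1) * (if k < j then \<kappa> (p k) (p j) else 1)) =
     (\<Prod>j\<in>I-{k}. \<kappa> (p k) (p j))"
    by (rule prod.cong) auto
  finally show ?thesis .
qed

text \<open>Vanishing on coincidences is demanded separately, because w = - w does not force w = 0
  in a general abelian group.\<close>

definition alternating :: "nat \<Rightarrow> ((nat \<Rightarrow> int) \<Rightarrow> 'a::ab_group_add) \<Rightarrow> bool" where
  "alternating N w \<longleftrightarrow>
     (\<forall>p i j. i \<le> N \<longrightarrow> j \<le> N \<longrightarrow> i \<noteq> j \<longrightarrow> w (p(i := p j, j := p i)) = - w p) \<and>
     (\<forall>p i j. i \<le> N \<longrightarrow> j \<le> N \<longrightarrow> i \<noteq> j \<longrightarrow> p i = p j \<longrightarrow> w p = 0)"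

definition shift_sum :: "nat \<Rightarrow> int \<Rightarrow> ((nat \<Rightarrow> int) \<Rightarrow> 'a::ab_group_add) \<Rightarrow> (nat \<Rightarrow> int) \<Rightarrow> 'a" where
  "shift_sum N k w p = (\<Sum>i\<le>N. w (p(i := p i + k)))"

lemma alternating_swap:
  assumes "alternating N w" "i \<le> N" "j \<le> N" "i \<noteq> j"
  shows "w (p(i := a, j := b)) = - w (p(i := b, j := a))"
proof -
  let ?r = "p(i := b, j := a)"
  have "p(i := a, j := b) = ?r(i := ?r j, j := ?r i)"
    using assms(4) by auto
  then show ?thesis using assms unfolding alternating_def by metis
qed

lemma alternating_coincide:
  assumes "alternating N w" "i \<le> N" "j \<le> N" "i \<noteq> j" "p i = p j"
  shows "w p = 0"
  using assms unfolding alternating_def by blast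

text \<open>Exchanging two entries permutes the summands. If two entries agree, moving any third
  bead leaves the coincidence, and the two remaining summands differ by an exchange.\<close>

lemma alternating_shift_sum:
  fixes w :: "(nat \<Rightarrow> int) \<Rightarrow> 'a::ab_group_add"
  assumes w: "alternating N w"
  shows "alternating N (shift_sum N k w)"
proof -
  have A: "shift_sum N k w (p(i := p j, j := p i)) = - shift_sum N k w p"
    if ij: "i \<le> N" "j \<le> N" "i \<noteq> j" for p i j
  proof -
    let ?r = "\<lambda>l. if l = i then j else if l = j then i else l"
    let ?p = "p(i := p j, j := p i)"
    have "shift_sum N k w ?p = (\<Sum>l\<le>N. w (?p(?r l := ?p (?r l) + k)))"
      unfolding shift_sum_def
      by (rule sum.reindex_bij_witness[where i = ?r and j = ?r]) (use ij in auto)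
    also have "\<dots> = (\<Sum>l\<le>N. - w (p(l := p l + k)))"
    proof (rule sum.cong[OF refl])
      fix l assume "l \<in> {..N}"
      have eq: "?p(?r l := ?p (?r l) + k) = (p(l := p l + k))(i := (p(l := p l + k)) j, j := (p(l := p l + k)) i)"
        using ij by auto
      show "w (?p(?r l := ?p (?r l) + k)) = - w (p(l := p l + k))"
        unfolding eq using w ij unfolding alternating_def by blast
    qed
    finally show ?thesis by (simp add: shift_sum_def sum_negf)
  qed
  have B: "shift_sum N k w p = 0" if ij: "i \<le> N" "j \<le> N" "i \<noteq> j" and eq: "p i = p j" for p i j
  proof -
    have "shift_sum N k w p = w (p(i := p i + k)) + (\<Sum>l\<in>{..N}-{i}. w (p(l := p l + k)))"
      unfolding shift_sum_def using ij by (simp add: sum.remove)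
    also have "(\<Sum>l\<in>{..N}-{i}. w (p(l := p l + k))) = w (p(j := p j + k)) + (\<Sum>l\<in>{..N}-{i}-{j}. w (p(l := p l + k)))"
      using ij by (subst sum.remove[where x = j]) auto
    also have "(\<Sum>l\<in>{..N}-{i}-{j}. w (p(l := p l + k))) = 0"
      by (rule sum.neutral) (use ij eq in \<open>auto intro!: alternating_coincide[OF w, of i j]\<close>)
    finally have s: "shift_sum N k w p = w (p(i := p i + k)) + w (p(j := p j + k))"
      by (simp only: add_0_right)
    have "p(i := p i + k) = (p(j := p j + k))(i := (p(j := p j + k)) j, j := (p(j := p j + k)) i)"
      using ij eq by auto
    then have "w (p(i := p i + k)) = - w (p(j := p j + k))"
      using w ij unfolding alternating_def by metis
    then show ?thesis using s by simp
  qed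
  show ?thesis unfolding alternating_def using A B by blast
qed

text \<open>Both sides are the coefficient of degree \<open>card Y - 1\<close> of the Lagrange
  interpolant of P at Y, which is P itself for reasons of degree. In other words, the residues of P
  / prod (x - y) at Y add up to minus the residue at infinity; this replaces contour integration in
  \<open>residue_sum\<close>.\<close>

lemma lagrange_leading_coeff:
  fixes P :: "'a::field poly"
  assumes "finite Y" "Y \<noteq> {}" "degree P < card Y"
  shows "(\<Sum>y\<in>Y. poly P y / (\<Prod>z\<in>Y-{y}. y - z)) = coeff P (card Y - 1)"
proof -
  define L where "L = (\<Sum>y\<in>Y. smult (poly P y / (\<Prod>z\<in>Y-{y}. y - z)) (\<Prod>z\<in>Y-{y}. [:-z, 1:]))"
  have deg1: "degree (\<Prod>z\<in>Z. [:-z, 1::'a:]) = card Z" if "finite Z" for Z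
    using that by (subst degree_prod_eq_sum_degree) auto
  have lc: "coeff (\<Prod>z\<in>Z. [:-z, 1::'a:]) (card Z) = 1" if "finite Z" for Z
  proof -
    have "lead_coeff (\<Prod>z\<in>Z. [:-z, 1::'a:]) = 1" by (simp add: lead_coeff_prod)
    then show ?thesis using deg1[OF that] by simp
  qed
  have nz: "(\<Prod>z\<in>Y-{y}. y - z) \<noteq> 0" if "y \<in> Y" for y
    using that assms by auto
  have pL: "poly L y = poly P y" if y: "y \<in> Y" for y
  proof -
    have "poly L y = (\<Sum>x\<in>Y. poly P x / (\<Prod>z\<in>Y-{x}. x - z) * (\<Prod>z\<in>Y-{x}. y - z))"
      by (simp add: L_def poly_sum poly_prod)
    also have "\<dots> = (\<Sum>x\<in>Y. if x = y then poly P y else 0)"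
    proof (rule sum.cong[OF refl])
      fix x assume x: "x \<in> Y"
      show "poly P x / (\<Prod>z\<in>Y-{x}. x - z) * (\<Prod>z\<in>Y-{x}. y - z) = (if x = y then poly P y else 0)"
      proof (cases "x = y")
        case True then show ?thesis using nz[OF y] by simp
      next
        case False
        then have "(\<Prod>z\<in>Y-{x}. y - z) = 0" using y assms by (intro prod_zero) auto
        then show ?thesis using False by simp
      qed
    qed
    also have "\<dots> = poly P y" using y assms by simp
    finally show ?thesis .
  qed
  have "degree L \<le> card Y - 1"
    unfolding L_def
  proof (rule degree_sum_le)
    fix y assume y: "y \<in> Y"
    have "degree (\<Prod>z\<in>Y-{y}. [:-z, 1::'a:]) = card Y - 1"
      using deg1[of "Y-{y}"] y assms by simp
    then show "degree (smult (poly P y / (\<Prod>z\<in>Y-{y}. y - z)) (\<Prod>z\<in>Y-{y}. [:-z, 1:])) \<le> card Y - 1"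
      using degree_smult_le by metis
  qed (use assms in auto)
  moreover have "card Y > 0" using assms by auto
  ultimately have "degree (P - L) < card Y"
    using assms by (intro degree_diff_less) auto
  moreover have "Y \<subseteq> {x. poly (P - L) x = 0}" using pL by auto
  ultimately have "P - L = 0"
    using poly_roots_finite[of "P - L"] card_poly_roots_bound[of "P - L"] assms
    by (metis (no_types, lifting) card_mono leD order_le_less_trans)
  then have "coeff P (card Y - 1) = coeff L (card Y - 1)" by simp
  also have "\<dots> = (\<Sum>y\<in>Y. poly P y / (\<Prod>z\<in>Y-{y}. y - z))"
    unfolding L_def coeff_sum
  proof (rule sum.cong[OF refl])
    fix y assume y: "y \<in> Y"
    show "coeff (smult (poly P y / (\<Prod>z\<in>Y-{y}. y - z)) (\<Prod>z\<in>Y-{y}. [:-z, 1:])) (card Y - 1) = poly P y / (\<Prod>z\<in>Y-{y}. y - z)"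
      using lc[of "Y-{y}"] y assms by simp
  qed
  finally show ?thesis by simp
qed

lemma dvd_prod_diff:
  fixes a b :: "'i \<Rightarrow> 'a::comm_ring_1"
  assumes "\<And>i. i \<in> I \<Longrightarrow> m dvd a i - b i"
  shows "m dvd prod a I - prod b I"
proof (cases "finite I")
  case True
  then show ?thesis using assms
  proof (induction I)
    case (insert x F)
    have "prod a (insert x F) - prod b (insert x F) = (a x - b x) * prod a F + b x * (prod a F - prod b F)"
      using insert.hyps by (simp add: algebra_simps)
    then show ?case using insert by auto
  qed auto
qed auto

lemma sum_off_diagonal:
  fixes g :: "nat \<Rightarrow> nat \<Rightarrow> 'a::ab_group_add"
  shows "(\<Sum>i\<le>N. \<Sum>j\<in>{..N}-{i}. g i j) = (\<Sum>i\<le>N. \<Sum>j<i. g i j + g j i)"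
proof -
  have "(\<Sum>i\<le>N. \<Sum>j\<in>{..N}-{i}. g i j) =
      (\<Sum>i\<le>N. \<Sum>j\<le>N. (if j < i then g i j else 0) + (if i < j then g i j else 0))"
  proof (rule sum.cong[OF refl])
    fix i assume "i \<in> {..N}"
    have "(\<Sum>j\<in>{..N}-{i}. g i j) = (\<Sum>j\<le>N. if j \<in> {..N}-{i} then g i j else 0)"
      by (subst sum.inter_restrict[symmetric]) (auto intro!: sum.cong)
    also have "\<dots> = (\<Sum>j\<le>N. (if j < i then g i j else 0) + (if i < j then g i j else 0))"
      by (rule sum.cong) auto
    finally show "(\<Sum>j\<in>{..N}-{i}. g i j) = \<dots>" .
  qed
  also have "\<dots> = (\<Sum>i\<le>N. \<Sum>j\<le>N. if j < i then g i j else 0) + (\<Sum>i\<le>N. \<Sum>j\<le>N. if i < j then g i j else 0)"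
    by (simp add: sum.distrib)
  also have "(\<Sum>i\<le>N. \<Sum>j\<le>N. if i < j then g i j else 0) = (\<Sum>i\<le>N. \<Sum>j\<le>N. if j < i then g j i else 0)"
    by (rule sum.swap)
  also have "(\<Sum>i\<le>N. \<Sum>j\<le>N. if j < i then g i j else 0) + \<dots> = (\<Sum>i\<le>N. \<Sum>j\<le>N. if j < i then g i j + g j i else 0)"
    unfolding sum.distrib[symmetric] by (intro sum.cong refl) auto
  also have "\<dots> = (\<Sum>i\<le>N. \<Sum>j<i. g i j + g j i)"
  proof (rule sum.cong[OF refl])
    fix i assume "i \<in> {..N}"
    then show "(\<Sum>j\<le>N. if j < i then g i j + g j i else 0) = (\<Sum>j<i. g i j + g j i)"
      by (subst sum.inter_filter[symmetric]) (auto intro!: sum.cong)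
  qed
  finally show ?thesis .
qed

text \<open>The summand is odd under a \<mapsto> p i + p j - a, so only the boundary terms survive.\<close>

lemma alternating_pair_sum:
  fixes w :: "(nat \<Rightarrow> int) \<Rightarrow> 'a::{idom, ring_char_0}"
  assumes w: "alternating N w" and ij: "i \<le> N" "j \<le> N" "i \<noteq> j"
    and low: "L \<le> p i" "L \<le> p j"
  shows "(\<Sum>a\<in>{L..<p i}. w (p(i := a, j := p i + p j - a))) +
         (\<Sum>a\<in>{L..<p j}. w (p(j := a, i := p i + p j - a))) = - w p"
proof -
  define h where "h a = w (p(i := a, j := p i + p j - a))" for a
  have anti: "h (p i + p j - a) = - h a" for a
    using alternating_swap[OF w ij, of p a "p i + p j - a"] by (simp add: h_def)
  have sw: "w (p(j := a, i := p i + p j - a)) = - h a" for a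
    using alternating_swap[OF w ij(2,1) ij(3)[symmetric], of p a "p i + p j - a"] ij
    by (simp add: h_def fun_upd_twist)
  have hi: "h (p i) = w p" and hj: "h (p j) = - w p"
    using anti[of "p i"] by (simp_all add: h_def)
  have mid: "(\<Sum>a\<in>{x<..<y}. h a) = 0" if xy: "x + y = p i + p j" for x y
  proof -
    have "(\<Sum>a\<in>{x<..<y}. h a) = (\<Sum>a\<in>{x<..<y}. h (p i + p j - a))"
      by (rule sum.reindex_bij_witness[where i = "\<lambda>a. p i + p j - a" and j = "\<lambda>a. p i + p j - a"])
         (use xy in auto)
    also have "\<dots> = - (\<Sum>a\<in>{x<..<y}. h a)" by (simp add: anti sum_negf)
    finally have "2 * (\<Sum>a\<in>{x<..<y}. h a) = 0" by (simp add: eq_neg_iff_add_eq_0)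
    then show ?thesis by simp
  qed
  \<comment> \<open>The two sums differ by the half-open interval from the smaller to the larger
    position. Its interior cancels by reflection, so only the lower endpoint is left, where h is
    plus or minus \<open>w p\<close>.\<close>
  have step: "(\<Sum>a\<in>{L..<y}. h a) = (\<Sum>a\<in>{L..<x}. h a) + h x"
    if "L \<le> x" "x < y" "x + y = p i + p j" for x y
  proof -
    have "{L..<y} = {L..<x} \<union> (insert x {x<..<y})" using that by auto
    then have "(\<Sum>a\<in>{L..<y}. h a) = (\<Sum>a\<in>{L..<x}. h a) + (\<Sum>a\<in>insert x {x<..<y}. h a)"
      by (simp only:) (rule sum.union_disjoint, auto)
    then show ?thesis using mid that by simp
  qed
  have "(\<Sum>a\<in>{L..<p i}. h a) - (\<Sum>a\<in>{L..<p j}. h a) = - w p"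
  proof (cases "p i" "p j" rule: linorder_cases)
    case less
    then show ?thesis using step[of "p i" "p j"] low hi by simp
  next
    case equal
    then show ?thesis using alternating_coincide[OF w ij] by simp
  next
    case greater
    then show ?thesis using step[of "p j" "p i"] low hj by simp
  qed
  then show ?thesis unfolding sw sum_negf h_def[symmetric] by simp
qed

text \<open>Put a = p i - k: bead i drops to a and a bead j rises by the same amount. The terms with
  j = i restore p, and there are p i - L of them. Each unordered pair of distinct beads contributes
  - w p by \<open>alternating_pair_sum\<close>, and the number of pairs is the sum of the indices up
  to N. So the double move multiplies by the total height above the ground state L, L + 1, ..., L +
  N.\<close>

lemma energy_identity:
  fixes w :: "(nat \<Rightarrow> int) \<Rightarrow> 'a::{idom, ring_char_0}"
  assumes w: "alternating N w" and low: "\<And>i. i \<le> N \<Longrightarrow> L \<le> p i"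
    and high: "\<And>i. i \<le> N \<Longrightarrow> p i - L \<le> int K"
  shows "(\<Sum>k=1..K. \<Sum>i\<in>{i\<in>{..N}. L \<le> p i - int k}. shift_sum N (int k) w (p(i := p i - int k))) =
         (of_int (\<Sum>i\<le>N. p i - L) - of_nat (\<Sum>i\<le>N. i)) * w p"
proof -
  have inner: "shift_sum N (p i - a) w (p(i := a)) =
      w p + (\<Sum>j\<in>{..N}-{i}. w (p(i := a, j := p i + p j - a)))" if "i \<le> N" for i a
  proof -
    have "shift_sum N (p i - a) w (p(i := a)) =
       w ((p(i := a))(i := (p(i := a)) i + (p i - a))) + (\<Sum>j\<in>{..N}-{i}. w ((p(i := a))(j := (p(i := a)) j + (p i - a))))"
      unfolding shift_sum_def using that by (simp add: sum.remove)
    also have "w ((p(i := a))(i := (p(i := a)) i + (p i - a))) = w p" by simp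
    also have "(\<Sum>j\<in>{..N}-{i}. w ((p(i := a))(j := (p(i := a)) j + (p i - a)))) =
        (\<Sum>j\<in>{..N}-{i}. w (p(i := a, j := p i + p j - a)))"
      by (rule sum.cong) (auto simp: algebra_simps)
    finally show ?thesis .
  qed
  have "(\<Sum>k=1..K. \<Sum>i\<in>{i\<in>{..N}. L \<le> p i - int k}. shift_sum N (int k) w (p(i := p i - int k))) =
     (\<Sum>i\<le>N. \<Sum>k\<in>{k\<in>{1..K}. L \<le> p i - int k}. shift_sum N (int k) w (p(i := p i - int k)))"
    by (rule sum.swap_restrict) auto
  also have "\<dots> = (\<Sum>i\<le>N. \<Sum>a\<in>{L..<p i}. shift_sum N (p i - a) w (p(i := a)))"
  proof (rule sum.cong[OF refl])
    fix i assume i: "i \<in> {..N}"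
    show "(\<Sum>k\<in>{k\<in>{1..K}. L \<le> p i - int k}. shift_sum N (int k) w (p(i := p i - int k))) =
      (\<Sum>a\<in>{L..<p i}. shift_sum N (p i - a) w (p(i := a)))"
      by (rule sum.reindex_bij_witness[where i = "\<lambda>a. nat (p i - a)" and j = "\<lambda>k. p i - int k"])
         (use high[of i] i in auto)
  qed
  also have "\<dots> = (\<Sum>i\<le>N. \<Sum>a\<in>{L..<p i}. w p + (\<Sum>j\<in>{..N}-{i}. w (p(i := a, j := p i + p j - a))))"
    by (intro sum.cong refl inner) auto
  also have "\<dots> = (\<Sum>i\<le>N. of_int (p i - L) * w p) +
      (\<Sum>i\<le>N. \<Sum>j\<in>{..N}-{i}. \<Sum>a\<in>{L..<p i}. w (p(i := a, j := p i + p j - a)))"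
  proof -
    have "(\<Sum>a\<in>{L..<p i}. w p + (\<Sum>j\<in>{..N}-{i}. w (p(i := a, j := p i + p j - a)))) =
      of_int (p i - L) * w p + (\<Sum>j\<in>{..N}-{i}. \<Sum>a\<in>{L..<p i}. w (p(i := a, j := p i + p j - a)))"
      if "i \<in> {..N}" for i
    proof -
      have "(of_nat (nat (p i - L)) :: 'a) = of_int (p i - L)"
        using low[of i] that by simp
      then show ?thesis
        unfolding sum.distrib by (subst sum.swap) simp
    qed
    then show ?thesis by (simp add: sum.distrib)
  qed
  also have "(\<Sum>i\<le>N. \<Sum>j\<in>{..N}-{i}. \<Sum>a\<in>{L..<p i}. w (p(i := a, j := p i + p j - a))) =
      (\<Sum>i\<le>N. \<Sum>j<i. - w p)"
    unfolding sum_off_diagonal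
  proof (intro sum.cong refl)
    fix i j assume "i \<in> {..N}" "j \<in> {..<i}"
    then show "(\<Sum>a\<in>{L..<p i}. w (p(i := a, j := p i + p j - a))) + (\<Sum>a\<in>{L..<p j}. w (p(j := a, i := p j + p i - a))) = - w p"
      using alternating_pair_sum[OF w, of i j L p] low by (simp add: add.commute)
  qed
  also have "\<dots> = - of_nat (\<Sum>i\<le>N. i) * w p"
    by (simp add: sum_negf sum_distrib_right)
  also have "(\<Sum>i\<le>N. of_int (p i - L) * w p) = of_int (\<Sum>i\<le>N. p i - L) * w p"
    by (simp add: sum_distrib_right)
  finally show ?thesis by (simp only: left_diff_distrib mult_minus_left add_uminus_conv_diff)
qed

section \<open>Sign choices and their truncated generating function\<close>

definition conf :: "nat set \<Rightarrow> nat \<Rightarrow> int" where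
  "conf A i = (if i \<in> A then int i else - int i)"

text \<open>A set with an element above n has a sum above n. Restricting to subsets of {1..n}
  therefore makes the sum finite without changing it modulo X^(n+1).\<close>

definition state_sum :: "nat \<Rightarrow> ((nat \<Rightarrow> int) \<Rightarrow> 'a::comm_ring_1) \<Rightarrow> 'a fps" where
  "state_sum n w = (\<Sum>A\<in>Pow {1..n}. fps_const (w (conf A)) * fps_X ^ (\<Sum>A))"

definition fps_cong :: "nat \<Rightarrow> 'a::zero fps \<Rightarrow> 'a fps \<Rightarrow> bool" where
  "fps_cong n f g \<longleftrightarrow> (\<forall>m\<le>n. fps_nth f m = fps_nth g m)"

text \<open>Changes both signs. The index 0 has no sign and must stay out of the set.\<close>

definition flip :: "nat set \<Rightarrow> nat \<Rightarrow> nat \<Rightarrow> nat set" where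
  "flip A i j = (A - {i, j}) \<union> ({i, j} - A - {0})"

lemma conf_flip: "conf (flip A i j) l = (if l = i \<or> l = j then - conf A l else conf A l)"
  by (auto simp: conf_def flip_def)

lemma abs_conf [simp]: "\<bar>conf A i\<bar> = int i"
  by (simp add: conf_def)

lemma sum_eq_conf:
  assumes "A \<subseteq> {1..n}"
  shows "2 * int (\<Sum>A) = (\<Sum>l\<le>n. conf A l + int l)"
proof -
  have "(\<Sum>l\<le>n. conf A l + int l) = (\<Sum>l\<le>n. if l \<in> A then 2 * int l else 0)"
    by (rule sum.cong) (auto simp: conf_def)
  also have "\<dots> = (\<Sum>l\<in>A. 2 * int l)"
    using assms by (subst sum.inter_restrict[symmetric]) (auto intro!: sum.cong)
  finally show ?thesis by (simp add: sum_distrib_left)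
qed

lemma flip_subset: "A \<subseteq> {1..n} \<Longrightarrow> i \<le> n \<Longrightarrow> j \<le> n \<Longrightarrow> flip A i j \<subseteq> {1..n}"
  by (auto simp: flip_def)

lemma flip_flip: "0 \<notin> A \<Longrightarrow> flip (flip A i j) i j = A"
  by (auto simp: flip_def)

text \<open>By \<open>sum_eq_conf\<close> twice the sum of A is the sum of the positions plus a
  constant, so changing two signs subtracts both old positions from the sum of A.\<close>

lemma sum_flip:
  assumes A: "A \<subseteq> {1..n}" and ij: "i \<le> n" "j \<le> n" "i \<noteq> j"
  shows "int (\<Sum>(flip A i j)) = int (\<Sum>A) - conf A i - conf A j"
proof -
  have split: "(\<Sum>l\<le>n. f l) = f i + f j + (\<Sum>l\<in>{..n}-{i}-{j}. f l)" for f :: "nat \<Rightarrow> int"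
  proof -
    have "(\<Sum>l\<le>n. f l) = f i + (\<Sum>l\<in>{..n}-{i}. f l)" using ij by (intro sum.remove) auto
    also have "(\<Sum>l\<in>{..n}-{i}. f l) = f j + (\<Sum>l\<in>{..n}-{i}-{j}. f l)" using ij by (intro sum.remove) auto
    finally show ?thesis by simp
  qed
  have "(\<Sum>l\<in>{..n}-{i}-{j}. conf (flip A i j) l + int l) = (\<Sum>l\<in>{..n}-{i}-{j}. conf A l + int l)"
    by (rule sum.cong) (auto simp: conf_flip)
  then have "2 * int (\<Sum>(flip A i j)) = 2 * int (\<Sum>A) - 2 * conf A i - 2 * conf A j"
    unfolding sum_eq_conf[OF A] sum_eq_conf[OF flip_subset[OF A ij(1,2)]] split
    by (simp add: conf_flip)
  then show ?thesis by simp
qed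


section \<open>Reflection at the boundary state\<close>

lemma fps_cong_refl [simp]: "fps_cong n f f"
  by (simp add: fps_cong_def)

lemma fps_cong_sym: "fps_cong n f g \<Longrightarrow> fps_cong n g f"
  by (simp add: fps_cong_def)

lemma fps_cong_trans [trans]: "fps_cong n f g \<Longrightarrow> fps_cong n g h \<Longrightarrow> fps_cong n f h"
  by (simp add: fps_cong_def)

lemma fps_cong_add: "fps_cong n f g \<Longrightarrow> fps_cong n f' g' \<Longrightarrow> fps_cong n (f + f') (g + g')"
  for f :: "'a::comm_ring_1 fps"
  by (simp add: fps_cong_def)

lemma fps_cong_diff: "fps_cong n f g \<Longrightarrow> fps_cong n f' g' \<Longrightarrow> fps_cong n (f - f') (g - g')"
  for f :: "'a::comm_ring_1 fps"
  by (simp add: fps_cong_def)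

lemma fps_cong_mult: "fps_cong n f g \<Longrightarrow> fps_cong n f' g' \<Longrightarrow> fps_cong n (f * f') (g * g')"
  for f :: "'a::comm_ring_1 fps"
  unfolding fps_cong_def fps_mult_nth by (auto intro!: sum.cong)

lemma fps_cong_sum: "(\<And>i. i \<in> I \<Longrightarrow> fps_cong n (f i) (g i)) \<Longrightarrow> fps_cong n (sum f I) (sum g I)"
  for f :: "'i \<Rightarrow> 'a::comm_ring_1 fps"
  unfolding fps_cong_def by (auto simp: fps_sum_nth intro!: sum.cong)

lemma fps_cong_power_0: "n < k \<Longrightarrow> fps_cong n (fps_const c * fps_X ^ k) 0"
  for c :: "'a::comm_ring_1"
  by (simp add: fps_cong_def fps_X_power_iff)

lemma sum_fps_cong_subset:
  fixes f :: "'i \<Rightarrow> 'a::comm_ring_1 fps"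
  assumes "finite P" "R \<subseteq> P" "\<And>x. x \<in> P - R \<Longrightarrow> fps_cong n (f x) 0"
  shows "fps_cong n (sum f P) (sum f R)"
proof -
  have "fps_cong n (sum f (P - R)) 0"
    using fps_cong_sum[of "P - R" n f "\<lambda>_. 0"] assms(3) by simp
  then have "fps_cong n (sum f (P - R) + sum f R) (0 + sum f R)"
    by (intro fps_cong_add) auto
  then show ?thesis using sum.subset_diff[OF assms(2,1), of f] by simp
qed

lemma state_sum_shift:
  "state_sum n (shift_sum N k w) =
     (\<Sum>(A, i)\<in>Pow {1..n} \<times> {..N}. fps_const (w ((conf A)(i := conf A i + k))) * fps_X ^ (\<Sum>A))"
proof -
  have "fps_const (\<Sum>i\<in>I. f i) = (\<Sum>i\<in>I. fps_const (f i))" for I :: "nat set" and f :: "nat \<Rightarrow> 'a"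
    by (induction I rule: infinite_finite_induct) (auto simp flip: fps_const_add)
  then show ?thesis
    unfolding state_sum_def shift_sum_def
    by (simp add: sum_distrib_right sum.cartesian_product)
qed

text \<open>With j the index for which the moved bead lands on plus or minus j, the terms cancel in pairs
  under flipping the signs of both i and j.\<close>

lemma boundary_reflection:
  fixes w :: "(nat \<Rightarrow> int) \<Rightarrow> 'a::comm_ring_1"
  assumes w: "alternating N w" and low: "\<And>p i. i \<le> N \<Longrightarrow> p i < - int N \<Longrightarrow> w p = 0"
    and n: "n \<le> N" and k: "0 < k"
  shows "fps_cong n (state_sum n (shift_sum N (- int k) w) + fps_X ^ k * state_sum n (shift_sum N (int k) w))
           ((if even k then fps_X ^ (k div 2) else 0) * state_sum n w)"
proof -
  define P where "P = Pow {1..n} \<times> {..N}"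
  define g where "g = (\<lambda>(A, i). fps_const (w ((conf A)(i := conf A i + - int k))) * fps_X ^ (\<Sum>A))"
  define h where "h = (\<lambda>(A, i). fps_const (w ((conf A)(i := conf A i + int k))) * fps_X ^ (\<Sum>A + k))"
  \<comment> \<open>\<open>jm\<close> and \<open>jp\<close> are the index whose bead sits at plus or
    minus the target. PG and PH collect the moves that land opposite to another bead; they cancel.
    QG and QH collect the moves from a position to its own negative; they give the right-hand
    side.\<close>
  define jm where "jm A i = nat \<bar>conf A i - int k\<bar>" for A i
  define jp where "jp A i = nat \<bar>conf A i + int k\<bar>" for A i
  define PG where "PG = {(A, i) \<in> P. conf A i \<noteq> int k \<and> jm A i \<noteq> i \<and> conf A (jm A i) = - (conf A i - int k)}"
  define PH where "PH = {(A, i) \<in> P. i \<le> n \<and> jp A i \<le> n \<and> conf A i \<noteq> - int k \<and> jp A i \<noteq> i \<and> conf A (jp A i) = - (conf A i + int k)}"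
  define QG where "QG = {(A, i) \<in> P. i \<in> A \<and> 2 * i = k}"
  define QH where "QH = {(A, i) \<in> P. i \<notin> A \<and> 2 * i = k \<and> i \<le> n}"
  have finP: "finite P" by (simp add: P_def)
  have G: "state_sum n (shift_sum N (- int k) w) = sum g P"
    unfolding state_sum_shift P_def g_def by simp
  have H: "fps_X ^ k * state_sum n (shift_sum N (int k) w) = sum h P"
    unfolding state_sum_shift P_def h_def
    by (simp add: sum_distrib_left case_prod_unfold power_add mult_ac)

  \<comment> \<open>For all other downward moves the target lies below -N, or is 0 and taken by bead
    0, or is taken by bead j.\<close>
  have g0: "g x = 0" if x: "x \<in> P - (PG \<union> QG)" for x
  proof -
    obtain A i where xi: "x = (A, i)" by (cases x)
    have A: "A \<subseteq> {1..n}" and i: "i \<le> N" using x xi by (auto simp: P_def)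
    have A0: "0 \<notin> A" using A by auto
    define t where "t = conf A i - int k"
    have "w ((conf A)(i := t)) = 0"
    proof (cases "t < - int N")
      case True then show ?thesis using low[of i "(conf A)(i := t)"] i by simp
    next
      case tN: False
      have up: "conf A i \<le> int n" using A by (auto simp: conf_def)
      show ?thesis
      proof (cases "t = 0")
        case True
        then have "i \<noteq> 0" using k by (auto simp: t_def conf_def split: if_splits)
        then show ?thesis using True i A0
          by (intro alternating_coincide[OF w, of i 0]) (auto simp: conf_def)
      next
        case t0: False
        define j where "j = nat \<bar>t\<bar>"
        have jN: "j \<le> N" using tN up n k unfolding j_def t_def by linarith
        have aj: "conf A j = t \<or> conf A j = - t" unfolding j_def conf_def by auto
        show ?thesis
        proof (cases "j = i")
          case True
          have "conf A i \<noteq> t" using k by (simp add: t_def)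
          then have "conf A i = - t" using aj True by auto
          then have "2 * conf A i = int k" by (simp add: t_def)
          then have "i \<in> A \<and> 2 * i = k" using k by (auto simp: conf_def split: if_splits)
          then have "x \<in> QG" using x xi by (auto simp: QG_def)
          then show ?thesis using x by auto
        next
          case ji: False
          show ?thesis
          proof (cases "conf A j = t")
            case True
            then show ?thesis using ji i jN by (intro alternating_coincide[OF w, of i j]) auto
          next
            case False
            then have "x \<in> PG" using aj ji t0 x xi unfolding PG_def jm_def j_def t_def by auto
            then show ?thesis using x by auto
          qed
        qed
      qed
    qed
    then show ?thesis by (simp add: xi g_def t_def)
  qed

  \<comment> \<open>Upward moves may involve an index above n, where no plus sign is available. In
    each such case either the target is occupied or the power of X exceeds n, so this vanishing
    holds only modulo X^(n+1).\<close>
  have h0: "fps_cong n (h x) 0" if x: "x \<in> P - (PH \<union> QH)" for x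
  proof -
    obtain A i where xi: "x = (A, i)" by (cases x)
    have A: "A \<subseteq> {1..n}" and i: "i \<le> N" using x xi by (auto simp: P_def)
    have A0: "0 \<notin> A" using A by auto
    have finA: "finite A" using A finite_subset by blast
    have elt: "a \<le> \<Sum>A" if "a \<in> A" for a using member_le_sum[of a A id] that finA by simp
    define t where "t = conf A i + int k"
    define j where "j = nat \<bar>t\<bar>"
    have aj: "conf A j = t \<or> conf A j = - t" unfolding j_def conf_def by auto
    have "w ((conf A)(i := t)) = 0 \<or> n < \<Sum>A + k"
    proof (cases "t = 0")
      case True
      then have "i \<noteq> 0" using k by (auto simp: t_def conf_def split: if_splits)
      then have "w ((conf A)(i := t)) = 0" using True i A0
        by (intro alternating_coincide[OF w, of i 0]) (auto simp: conf_def)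
      then show ?thesis ..
    next
      case t0: False
      show ?thesis
      proof (cases "j = i")
        case True
        have "conf A i \<noteq> t" using k by (simp add: t_def)
        then have "conf A i = - t" using aj True by auto
        then have c: "2 * conf A i = - int k" by (simp add: t_def)
        then have iA: "i \<notin> A \<and> 2 * i = k" using k by (auto simp: conf_def split: if_splits)
        then have "\<not> i \<le> n" using x xi by (auto simp: QH_def)
        then show ?thesis using iA by auto
      next
        case ji: False
        show ?thesis
        proof (cases "i \<le> n \<and> j \<le> n")
          case True
          then have "j \<le> N" using n by auto
          have "conf A j = t"
          proof (rule ccontr)
            assume "conf A j \<noteq> t"
            then have "x \<in> PH" using aj ji t0 x xi True unfolding PH_def jp_def j_def t_def by auto
            then show False using x by auto
          qed
          then have "w ((conf A)(i := t)) = 0"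
            using ji i \<open>j \<le> N\<close> by (intro alternating_coincide[OF w, of i j]) auto
          then show ?thesis ..
        next
          case big: False
          show ?thesis
          proof (cases "t < 0")
            case True
            then have iA: "i \<notin> A" by (auto simp: t_def conf_def)
            then have ij: "i = j + k" using True by (auto simp: t_def conf_def j_def)
            show ?thesis
            proof (cases "j \<in> A")
              case True
              then have "j \<le> n" using A by auto
              then have "n < i" using big by auto
              then show ?thesis using elt[OF True] ij by auto
            next
              case False
              then have "conf A j = t" using True by (auto simp: conf_def j_def)
              then have "w ((conf A)(i := t)) = 0"
                using ji i ij by (intro alternating_coincide[OF w, of i j]) auto
              then show ?thesis ..
            qed
          next
            case False
            show ?thesis
            proof (cases "i \<in> A")
              case True
              then have "i \<le> n" using A by auto
              moreover have "j = i + k" using True by (auto simp: t_def conf_def j_def)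
              ultimately show ?thesis using elt[OF True] big by auto
            next
              case iA: False
              then have "k = i + j" using False by (auto simp: t_def conf_def j_def)
              then show ?thesis using big by auto
            qed
          qed
        qed
      qed
    qed
    then show ?thesis
      by (auto simp: xi h_def t_def intro: fps_cong_power_0)
  qed

  \<comment> \<open>Downward moves need no truncation: landing opposite to a bead forces a plus sign
    on one of the two indices, and this bounds both by n.\<close>
  have PGn: "i \<le> n \<and> jm A i \<le> n" if "(A, i) \<in> PG" for A i
  proof -
    have A: "A \<subseteq> {1..n}" and t0: "conf A i - int k \<noteq> 0" and c: "conf A (jm A i) = - (conf A i - int k)"
      using that by (auto simp: PG_def P_def)
    show ?thesis
    proof (cases "conf A i - int k > 0")
      case True
      then have "i \<in> A" by (auto simp: conf_def split: if_splits)
      then show ?thesis using True A unfolding jm_def by (auto simp: conf_def)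
    next
      case False
      then have "conf A (jm A i) > 0" using c t0 by auto
      then have "jm A i \<in> A" by (auto simp: conf_def split: if_splits)
      then have j: "jm A i \<le> n" using A by auto
      have "i \<le> n"
      proof (cases "i \<in> A")
        case True then show ?thesis using A by auto
      next
        case F: False then show ?thesis using j False unfolding jm_def by (auto simp: conf_def)
      qed
      then show ?thesis using j by simp
    qed
  qed

  \<comment> \<open>Flipping both signs negates the position of bead i and puts bead j on the old
    target. Moving i up by k then yields the same two positions in exchanged order. The powers of X
    agree because the sum of the set drops by exactly k.\<close>
  have cancel: "sum g PG = - sum h PH"
  proof -
    let ?fm = "\<lambda>(A, i). (flip A i (jm A i), i)"
    let ?fp = "\<lambda>(A, i). (flip A i (jp A i), i)"
    have "sum g PG = (\<Sum>x\<in>PH. - h x)"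
    proof (rule sum.reindex_bij_witness[where i = ?fp and j = ?fm])
      fix x assume x: "x \<in> PG"
      obtain A i where xi: "x = (A, i)" by (cases x)
      define j where "j = jm A i"
      have A: "A \<subseteq> {1..n}" and iN: "i \<le> N" and t0: "conf A i \<noteq> int k"
        and ji: "j \<noteq> i" and c: "conf A j = - (conf A i - int k)"
        using x xi by (auto simp: PG_def P_def j_def)
      have le: "i \<le> n" "j \<le> n" using PGn[of A i] x xi by (auto simp: j_def)
      have A0: "0 \<notin> A" using A by auto
      have jp: "jp (flip A i j) i = j"
        unfolding jp_def by (auto simp: conf_flip j_def jm_def)
      show "?fp (?fm x) = x" by (simp add: xi jp flip_flip[OF A0] flip: j_def)
      show "?fm x \<in> PH"
        using le iN ji t0 c flip_subset[OF A le]
        by (auto simp: xi PH_def P_def jp conf_flip simp flip: j_def)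
      have "int (\<Sum>(flip A i j)) + int k = int (\<Sum>A)"
        using sum_flip[OF A le ji[symmetric]] c by simp
      then have wt: "\<Sum>(flip A i j) + k = \<Sum>A" by (simp only: of_nat_add[symmetric] of_nat_eq_iff)
      define t where "t = conf A i - int k"
      have e1: "(conf (flip A i j))(i := conf (flip A i j) i + int k) = (conf A)(i := - t, j := t)"
        using ji c by (auto simp: conf_flip t_def)
      have e2: "(conf A)(i := conf A i + - int k) = (conf A)(i := t, j := - t)"
        using ji c by (auto simp: t_def)
      have "w ((conf A)(i := t, j := - t)) = - w ((conf A)(i := - t, j := t))"
        by (rule alternating_swap[OF w iN _ ji[symmetric]]) (use le n in simp)
      moreover have "g x = fps_const (w ((conf A)(i := t, j := - t))) * fps_X ^ (\<Sum>A)"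
        by (simp only: xi g_def prod.case e2)
      moreover have "h (?fm x) = fps_const (w ((conf A)(i := - t, j := t))) * fps_X ^ (\<Sum>A)"
        by (simp only: xi h_def prod.case j_def[symmetric] e1 wt)
      ultimately show "- h (?fm x) = g x"
        by (simp only: fps_const_neg[symmetric] mult_minus_left)
    next
      fix x assume x: "x \<in> PH"
      obtain A i where xi: "x = (A, i)" by (cases x)
      define j where "j = jp A i"
      have A: "A \<subseteq> {1..n}" and iN: "i \<le> N" and t0: "conf A i \<noteq> - int k"
        and ji: "j \<noteq> i" and c: "conf A j = - (conf A i + int k)" and le: "i \<le> n" "j \<le> n"
        using x xi by (auto simp: PH_def P_def j_def)
      have A0: "0 \<notin> A" using A by auto
      have jm: "jm (flip A i j) i = j"
        unfolding jm_def by (auto simp: conf_flip j_def jp_def)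
      show "?fm (?fp x) = x" by (simp add: xi jm flip_flip[OF A0] flip: j_def)
      show "?fp x \<in> PG"
        using le iN ji t0 c flip_subset[OF A le]
        by (auto simp: xi PG_def P_def jm conf_flip simp flip: j_def)
    qed
    then show ?thesis by (simp add: sum_negf)
  qed

  \<comment> \<open>With k = 2 l, moving l to -l removes l from A, and moving -l to l inserts it. So
    QG yields the sets without l and QH the sets with l, both with the factor X^l, and together they
    exhaust all sets.\<close>
  have diagonal: "fps_cong n (sum g QG + sum h QH) ((if even k then fps_X ^ (k div 2) else 0) * state_sum n w)"
  proof (cases "even k")
    case False
    then have "QG = {}" "QH = {}" by (auto simp: QG_def QH_def)
    then show ?thesis using False by simp
  next
    case True
    then obtain l where l: "k = 2 * l" by auto
    have l0: "0 < l" using k l by simp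
    show ?thesis
    proof (cases "l \<le> n")
      case False
      then have e: "QG = {}" "QH = {}" using l by (auto simp: QG_def QH_def P_def)
      have "fps_cong n (fps_const 1 * fps_X ^ l * state_sum n w) (0 * state_sum n w)"
        using False by (intro fps_cong_mult fps_cong_power_0) auto
      then show ?thesis using True e l by (auto intro: fps_cong_sym)
    next
      case ln: True
      define f where "f A = fps_const (w (conf A)) * fps_X ^ (\<Sum>A)" for A
      have "sum g QG = (\<Sum>A\<in>{A\<in>Pow {1..n}. l \<notin> A}. fps_X ^ l * f A)"
      proof (rule sum.reindex_bij_witness[where i = "\<lambda>A. (insert l A, l)" and j = "\<lambda>(A, i). A - {l}"])
        fix x assume x: "x \<in> QG"
        then obtain A where xi: "x = (A, l)" and A: "A \<subseteq> {1..n}" "l \<in> A"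
          using l by (auto simp: QG_def P_def)
        have finA: "finite A" using A finite_subset by blast
        show "(case x of (A, i) \<Rightarrow> A - {l}) \<in> {A \<in> Pow {1..n}. l \<notin> A}"
          and "(insert l (case x of (A, i) \<Rightarrow> A - {l}), l) = x"
          using xi A by auto
        have "(conf A)(l := conf A l + - int k) = conf (A - {l})"
          using A l by (auto simp: conf_def)
        moreover have "\<Sum>A = l + \<Sum>(A - {l})" using sum.remove[OF finA A(2), of id] by simp
        ultimately show "fps_X ^ l * f (case x of (A, i) \<Rightarrow> A - {l}) = g x"
          by (simp add: xi f_def g_def power_add mult_ac)
      qed (use l l0 ln n in \<open>auto simp: QG_def P_def\<close>)
      moreover have "sum h QH = (\<Sum>A\<in>{A\<in>Pow {1..n}. \<not> l \<notin> A}. fps_X ^ l * f A)"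
      proof (rule sum.reindex_bij_witness[where i = "\<lambda>A. (A - {l}, l)" and j = "\<lambda>(A, i). insert l A"])
        fix x assume x: "x \<in> QH"
        then obtain A where xi: "x = (A, l)" and A: "A \<subseteq> {1..n}" "l \<notin> A"
          using l by (auto simp: QH_def P_def)
        have finA: "finite A" using A finite_subset by blast
        show "(case x of (A, i) \<Rightarrow> insert l A) \<in> {A \<in> Pow {1..n}. \<not> l \<notin> A}"
          and "((case x of (A, i) \<Rightarrow> insert l A) - {l}, l) = x"
          using xi A l0 ln by auto
        have "(conf A)(l := conf A l + int k) = conf (insert l A)"
          using A l by (auto simp: conf_def)
        moreover have "\<Sum>(insert l A) = l + \<Sum>A" using A finA by simp
        ultimately show "fps_X ^ l * f (case x of (A, i) \<Rightarrow> insert l A) = h x"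
          by (simp only: xi f_def h_def prod.case l power_add mult_2) (simp only: mult_ac)
      qed (use l l0 ln n in \<open>auto simp: QH_def P_def\<close>)
      moreover have "state_sum n w = (\<Sum>A\<in>{A\<in>Pow {1..n}. l \<notin> A}. f A) + (\<Sum>A\<in>{A\<in>Pow {1..n}. \<not> l \<notin> A}. f A)"
      proof -
        have "Pow {1..n} = {A\<in>Pow {1..n}. l \<notin> A} \<union> {A\<in>Pow {1..n}. \<not> l \<notin> A}" by blast
        then have "state_sum n w = sum f ({A\<in>Pow {1..n}. l \<notin> A} \<union> {A\<in>Pow {1..n}. \<not> l \<notin> A})"
          unfolding state_sum_def f_def by (rule arg_cong)
        also have "\<dots> = (\<Sum>A\<in>{A\<in>Pow {1..n}. l \<notin> A}. f A) + (\<Sum>A\<in>{A\<in>Pow {1..n}. \<not> l \<notin> A}. f A)"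
          by (rule sum.union_disjoint) auto
        finally show ?thesis .
      qed
      ultimately have "sum g QG + sum h QH = fps_X ^ l * state_sum n w"
        by (simp add: distrib_left sum_distrib_left)
      then show ?thesis using True l by simp
    qed
  qed

  have disjG: "PG \<inter> QG = {}"
    by (auto simp: PG_def QG_def jm_def conf_def)
  have disjH: "PH \<inter> QH = {}"
    by (auto simp: PH_def QH_def jp_def conf_def)
  have subs: "PG \<union> QG \<subseteq> P" "PH \<union> QH \<subseteq> P"
    by (auto simp: PG_def QG_def PH_def QH_def)
  then have fins: "finite PG" "finite QG" "finite PH" "finite QH"
    using finP finite_subset by blast+
  have "fps_cong n (sum g P + sum h P) (sum g (PG \<union> QG) + sum h (PH \<union> QH))"
    by (intro fps_cong_add sum_fps_cong_subset finP subs h0) (use g0 in auto)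
  also have "sum g (PG \<union> QG) + sum h (PH \<union> QH) = sum g QG + sum h QH"
    using fins disjG disjH cancel by (simp add: sum.union_disjoint)
  finally show ?thesis
    unfolding G H using diagonal fps_cong_trans by blast
qed


section \<open>A residue sum\<close>

text \<open>Modulo 1 - e y^2 the polynomial F y is a constant times a power of y times the product of the y - y' with
  y' in Y. So the poles at e y^2 = 1 contribute only the last term, when B has odd cardinality.
\<close>

lemma residue_sum:
  fixes x :: "nat \<Rightarrow> 'a::field" and u R :: 'a
  defines "c \<equiv> u^2" and "e \<equiv> u^2 * R"
  assumes J: "finite J" "B \<subseteq> J" "B \<noteq> {}" and S: "S = J - B"
    and inj: "inj_on x J" and x0: "\<And>j. j \<in> J \<Longrightarrow> x j \<noteq> 0"
    and u0: "u \<noteq> 0" and R0: "R \<noteq> 0"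
    and cxx: "\<And>i j. i \<in> J \<Longrightarrow> j \<in> J \<Longrightarrow> c * x i * x j \<noteq> 1"
    and exx: "\<And>j. j \<in> J \<Longrightarrow> e * (x j)^2 \<noteq> 1" "\<And>j. j \<in> J \<Longrightarrow> c * (x j)^2 \<noteq> R"
  defines "z \<equiv> (\<lambda>j. 1 / (c * x j))"
  defines "Y \<equiv> x ` J \<union> z ` S"
  defines "F \<equiv> (\<lambda>y. (\<Prod>j\<in>J. 1 - e * y * x j) * (\<Prod>j\<in>S. R * y - x j))"
  shows "(\<Sum>y\<in>Y. F y * (1 - u * y) * (1 + u * R * y) / ((1 - e * y^2) * y * (\<Prod>y'\<in>Y-{y}. y - y'))) =
     (\<Prod>j\<in>J. - e * x j) * R ^ card S - (\<Prod>j\<in>S. - x j) / (\<Prod>y\<in>Y. - y)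
     + (if odd (card B) then u * (R - 1) * e ^ (card B div 2) * R ^ card S * (\<Prod>j\<in>S. - c * x j) else 0)"
proof -
  have c0: "c \<noteq> 0" and e0: "e \<noteq> 0" using u0 R0 by (auto simp: c_def e_def)
  have eR: "e = c * R" by (simp add: c_def e_def)
  have SJ: "S \<subseteq> J" "finite S" "finite B" using S J finite_subset by auto
  have z0: "z j \<noteq> 0" if "j \<in> S" for j using that SJ x0 c0 by (auto simp: z_def)
  have xz: "x i \<noteq> z j" if "i \<in> J" "j \<in> S" for i j
    using cxx[of i j] that SJ x0[of j] c0 by (auto simp: z_def field_simps)
  have injz: "inj_on z S"
    using inj SJ x0 c0 by (auto simp: inj_on_def z_def)
  have disj: "x ` J \<inter> z ` S = {}" using xz by auto
  have finY: "finite Y" using J SJ by (simp add: Y_def)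
  have cardY: "card Y = card J + card S"
    unfolding Y_def using J SJ disj inj injz by (simp add: card_Un_disjoint card_image)
  have cardJ: "card J = card B + card S"
    using J S by (metis SJ(3) card_Diff_subset card_mono le_add_diff_inverse)
  have Yne: "Y \<noteq> {}" using J by (auto simp: Y_def)
  have Y0: "0 \<notin> Y" using x0 z0 by (force simp: Y_def)
  have ey: "1 - e * y^2 \<noteq> 0" if y: "y \<in> Y" for y
  proof -
    consider j where "j \<in> J" "y = x j" | j where "j \<in> S" "y = z j" using y by (auto simp: Y_def)
    then show ?thesis
    proof cases
      case 1 then show ?thesis using exx(1)[of j] by simp
    next
      case 2
      then have "1 - e * y^2 = (c * (x j)^2 - R) / (c * (x j)^2)"
        using x0[of j] SJ c0 by (auto simp: z_def eR field_simps power2_eq_square)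
      then show ?thesis using 2 exx(2)[of j] SJ x0[of j] c0 by auto
    qed
  qed
  have prodY: "(\<Prod>y\<in>Y. f y) = (\<Prod>j\<in>J. f (x j)) * (\<Prod>j\<in>S. f (z j))" for f :: "'a \<Rightarrow> 'a poly"
    unfolding Y_def using J SJ disj
    by (subst prod.union_disjoint) (auto simp: prod.reindex inj injz)
  \<comment> \<open>P is F as a polynomial and D has root set Y; both have degree
    \<open>card Y\<close>. The roots of M are the remaining poles.\<close>
  define P where "P = (\<Prod>j\<in>J. [:1, - e * x j:]) * (\<Prod>j\<in>S. [:- x j, R:])"
  define D where "D = (\<Prod>y\<in>Y. [:- y, 1:])"
  define M where "M = [:1, 0, - e:]"
  have polyP: "poly P y = F y" for y
    unfolding P_def F_def by (simp add: poly_mult poly_prod algebra_simps)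
  have polyD: "poly D y = 0" if "y \<in> Y" for y
    using that finY by (auto simp: D_def poly_prod)
  have degD: "degree D = card Y"
    unfolding D_def using finY by (subst degree_prod_eq_sum_degree) auto
  have lcD: "coeff D (card Y) = 1"
  proof -
    have "lead_coeff D = 1" unfolding D_def by (simp add: lead_coeff_prod)
    then show ?thesis using degD by simp
  qed
  have degP1: "degree (\<Prod>j\<in>I. [:1, - e * x j:]) = card I" if "I \<subseteq> J" for I
  proof -
    have nz: "- e * x j \<noteq> 0" if "j \<in> I" for j using that \<open>I \<subseteq> J\<close> x0 e0 by auto
    have "degree (\<Prod>j\<in>I. [:1, - e * x j:]) = (\<Sum>j\<in>I. degree [:1, - e * x j:])"
      by (rule degree_prod_eq_sum_degree) auto
    also have "\<dots> = (\<Sum>j\<in>I. 1)"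
      by (rule sum.cong) (use nz in auto)
    finally show ?thesis by simp
  qed
  have degP2: "degree (\<Prod>j\<in>S. [:- x j, R:]) = card S"
    using R0 by (subst degree_prod_eq_sum_degree) auto
  have degP: "degree P = card Y"
  proof -
    have "(\<Prod>j\<in>J. [:1, - e * x j:]) \<noteq> 0" "(\<Prod>j\<in>S. [:- x j, R:]) \<noteq> 0"
      using J SJ R0 by auto
    then show ?thesis unfolding P_def cardY
      using degP1[of J] by (simp add: degree_mult_eq degP2)
  qed
  have lcP: "coeff P (card Y) = (\<Prod>j\<in>J. - e * x j) * R ^ card S"
  proof -
    have "lead_coeff P = (\<Prod>j\<in>J. - e * x j) * R ^ card S"
    proof -
      have "lead_coeff [:1, - e * x j:] = - e * x j" if "j \<in> J" for j
        using x0[OF that] e0 by simp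
      moreover have "lead_coeff [:- x j, R:] = R" for j using R0 by simp
      ultimately show ?thesis
        unfolding P_def lead_coeff_mult lead_coeff_prod by simp
    qed
    then show ?thesis using degP by simp
  qed
  define C where "C = R ^ card S * (\<Prod>j\<in>S. - c * x j)"
  \<comment> \<open>Modulo M one has e y^2 = 1. For j in B one factor y is needed to turn 1 - e y x
    into y - x. For j in S the two factors of F together already become a multiple of (y - x) (y -
    z). This accounts for exactly \<open>card B\<close> factors y.\<close>
  have cong: "M dvd [:0,1:] ^ card B * P - smult C D"
  proof -
    have b: "M dvd [:0,1:] * [:1, - e * x j:] - [:- x j, 1:]" for j
    proof
      show "[:0,1:] * [:1, - e * x j:] - [:- x j, 1:] = M * [:x j:]"
        by (simp add: M_def algebra_simps)
    qed
    have s: "M dvd [:1, - e * x j:] * [:- x j, R:] - [:- x j, 1:] * [:R, - R * c * x j:]" for j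
    proof
      show "[:1, - e * x j:] * [:- x j, R:] - [:- x j, 1:] * [:R, - R * c * x j:] = M * [:x j * (R - 1):]"
        by (simp add: M_def eR algebra_simps)
    qed
    have "[:0,1:] ^ card B * P = (\<Prod>j\<in>B. [:0,1:] * [:1, - e * x j:]) * (\<Prod>j\<in>S. [:1, - e * x j:] * [:- x j, R:])"
      unfolding P_def prod.distrib using prod.subset_diff[OF J(2,1), of "\<lambda>j. [:1, - e * x j:]"] S
      by (simp add: mult_ac)
    moreover have "smult C D = (\<Prod>j\<in>B. [:- x j, 1:]) * (\<Prod>j\<in>S. [:- x j, 1:] * [:R, - R * c * x j:])"
    proof -
      have "[:R, - R * c * x j:] = smult (R * (- c * x j)) [:- z j, 1:]" if "j \<in> S" for j
        using that SJ x0 c0 by (auto simp: z_def)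
      then have "(\<Prod>j\<in>S. [:R, - R * c * x j:]) = (\<Prod>j\<in>S. smult (R * (- c * x j)) [:- z j, 1:])"
        by (rule prod.cong[OF refl])
      also have "\<dots> = smult C (\<Prod>j\<in>S. [:- z j, 1:])"
        unfolding prod_smult C_def prod.distrib by simp
      finally have "(\<Prod>j\<in>S. [:R, - R * c * x j:]) = smult C (\<Prod>j\<in>S. [:- z j, 1:])" .
      then show ?thesis
        unfolding D_def prodY prod.distrib using prod.subset_diff[OF J(2,1), of "\<lambda>j. [:- x j, 1:]"] S
        by (simp add: mult_ac)
    qed
    moreover have "M dvd A * A' - E * E'" if "M dvd A - E" "M dvd A' - E'" for A A' E E'
    proof -
      have "A * A' - E * E' = (A - E) * A' + E * (A' - E')" by (simp add: algebra_simps)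
      then show ?thesis using that by auto
    qed
    ultimately show ?thesis using dvd_prod_diff[of B M] dvd_prod_diff[of S M] b s by presburger
  qed
  define m where "m = card B div 2"
  define X where "X = smult e ([:0,1:]^2)"
  have dX: "M dvd X ^ i - 1" for i
  proof -
    have "M dvd X - 1" by (rule dvdI[of _ _ "-1"]) (simp add: M_def X_def power2_eq_square one_pCons)
    then show ?thesis using dvd_prod_diff[of "{..<i}" M "\<lambda>_. X" "\<lambda>_. 1"] by simp
  qed
  \<comment> \<open>The factor y^(card B) is removed with a power of e y^2, which is 1 modulo M. If
    \<open>card B\<close> is odd, a single y is left over on the other side; it is V.\<close>
  define rho where "rho = (if even (card B) then e ^ m * C else e ^ (m + 1) * C)"
  define V where "V = (if even (card B) then 1 else [:0, 1 :: 'a:])"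
  have dvdG: "M dvd P - smult rho (V * D)"
  proof (cases "even (card B)")
    case True
    then have k: "card B = 2 * m" by (simp add: m_def)
    have "P - smult rho (V * D) = [:e ^ m:] * ([:0,1:] ^ card B * P - smult C D) - (X ^ m - 1) * P"
    proof -
      have "X ^ m = smult (e ^ m) ([:0,1:] ^ card B)"
        by (simp only: X_def smult_power k power_mult)
      then show ?thesis using True by (simp add: rho_def V_def algebra_simps)
    qed
    then show ?thesis using dvd_diff[OF dvd_mult[OF cong] dvd_mult2[OF dX[of m]]] by (simp only:)
  next
    case False
    then have k: "card B = 2 * m + 1" by (simp add: m_def)
    have "P - smult rho (V * D) = smult (e ^ (m+1)) [:0,1:] * ([:0,1:] ^ card B * P - smult C D) - (X ^ (m+1) - 1) * P"
    proof -
      have "X ^ (m + 1) = smult (e ^ (m+1)) [:0,1:] * [:0,1:] ^ card B"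
      proof -
        have "X ^ (m + 1) = smult (e ^ (m+1)) ([:0,1:] ^ (2 * (m + 1)))"
          by (simp only: X_def smult_power power_mult)
        also have "2 * (m + 1) = Suc (card B)" using k by simp
        finally show ?thesis by (simp only: power_Suc mult_smult_left)
      qed
      then show ?thesis using False by (simp add: rho_def V_def algebra_simps)
    qed
    then show ?thesis using dvd_diff[OF dvd_mult[OF cong] dvd_mult2[OF dX[of "m + 1"]]] by (simp only:)
  qed
  \<comment> \<open>D vanishes on Y, so G takes the values F y / (1 - e y^2) there. Its degree is
    below \<open>card Y\<close>, which makes the sum its coefficient of degree
    \<open>card Y - 1\<close>; only an odd \<open>card B\<close> makes this nonzero.\<close>
  then obtain G where G: "P - smult rho (V * D) = M * G" by (auto elim: dvdE)
  have degV: "degree V \<le> 1" by (simp add: V_def)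
  have M0: "M \<noteq> 0" and degM: "degree M = 2" using e0 by (auto simp: M_def)
  have degR: "degree (P - smult rho (V * D)) \<le> card Y + degree V"
  proof (rule degree_diff_le)
    have "degree (smult rho (V * D)) \<le> degree (V * D)" by (rule degree_smult_le)
    also have "\<dots> \<le> degree V + degree D" by (rule degree_mult_le)
    finally show "degree (smult rho (V * D)) \<le> card Y + degree V" using degD by simp
  qed (use degP in simp)
  have degG: "G = 0 \<or> degree G + 2 \<le> card Y + degree V"
    using degR degM M0 unfolding G by (cases "G = 0") (auto simp: degree_mult_eq)
  have cardY0: "0 < card Y" using finY Yne by (simp add: card_gt_0_iff)
  have dG: "degree G < card Y" using degG degV cardY0 by auto
  have lcG: "coeff G (card Y - 1) = (if even (card B) then 0 else e ^ m * C)"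
  proof (cases "even (card B)")
    case True
    then have "degree V = 0" by (simp add: V_def)
    then show ?thesis using degG True by (auto intro: coeff_eq_0)
  next
    case False
    have "coeff (M * G) (card Y + 1) = - rho"
    proof -
      have "coeff P (card Y + 1) = 0" using degP by (intro coeff_eq_0) simp
      moreover have "coeff (V * D) (card Y + 1) = 1" using False lcD by (simp add: V_def)
      ultimately show ?thesis unfolding G[symmetric] by simp
    qed
    moreover have "coeff (M * G) (card Y + 1) = - e * coeff G (card Y - 1)"
    proof -
      have "coeff G (card Y + 1) = 0" using dG by (intro coeff_eq_0) simp
      moreover obtain y where "card Y = Suc y" using cardY0 by (cases "card Y") auto
      ultimately show ?thesis by (simp add: M_def)
    qed
    ultimately show ?thesis using False e0 by (simp add: rho_def)
  qed
  have polyG: "poly G y = F y / (1 - e * y^2)" if "y \<in> Y" for y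
  proof -
    have "poly (P - smult rho (V * D)) y = F y" using polyD[OF that] polyP by simp
    moreover have "poly M y = 1 - e * y^2" by (simp add: M_def power2_eq_square algebra_simps)
    ultimately show ?thesis unfolding G using ey[OF that] by (simp add: field_simps)
  qed
  have sumG: "(\<Sum>y\<in>Y. F y / (1 - e * y^2) / (\<Prod>y'\<in>Y-{y}. y - y')) = (if even (card B) then 0 else e ^ m * C)"
    using lagrange_leading_coeff[OF finY Yne dG] polyG lcG by simp
  \<comment> \<open>The pole at 0 is treated as one more interpolation node, and its residue is
    moved to the right-hand side.\<close>
  have sumP: "(\<Sum>y\<in>Y. F y / (y * (\<Prod>y'\<in>Y-{y}. y - y'))) =
      (\<Prod>j\<in>J. - e * x j) * R ^ card S - (\<Prod>j\<in>S. - x j) / (\<Prod>y\<in>Y. - y)"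
  proof -
    have "(\<Sum>y\<in>insert 0 Y. F y / (\<Prod>y'\<in>insert 0 Y-{y}. y - y')) = coeff P (card (insert 0 Y) - 1)"
      using lagrange_leading_coeff[of "insert 0 Y" P] finY Y0 degP by (simp add: polyP)
    also have "\<dots> = (\<Prod>j\<in>J. - e * x j) * R ^ card S" using finY Y0 lcP by simp
    finally have "(\<Sum>y\<in>insert 0 Y. F y / (\<Prod>y'\<in>insert 0 Y-{y}. y - y')) = \<dots>" .
    moreover have "(\<Sum>y\<in>insert 0 Y. F y / (\<Prod>y'\<in>insert 0 Y-{y}. y - y')) =
       F 0 / (\<Prod>y'\<in>Y. - y') + (\<Sum>y\<in>Y. F y / (y * (\<Prod>y'\<in>Y-{y}. y - y')))"
    proof -
      have "(\<Prod>y'\<in>insert 0 Y-{y}. y - y') = y * (\<Prod>y'\<in>Y-{y}. y - y')" if "y \<in> Y" for y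
      proof -
        have "insert 0 Y - {y} = insert 0 (Y - {y})" using that Y0 by auto
        then show ?thesis using finY Y0 by simp
      qed
      moreover have "insert 0 Y - {0} = Y" using Y0 by auto
      ultimately show ?thesis using finY Y0 by simp
    qed
    ultimately show ?thesis by (simp add: F_def eq_diff_eq add.commute)
  qed
  have "(\<Sum>y\<in>Y. F y * (1 - u * y) * (1 + u * R * y) / ((1 - e * y^2) * y * (\<Prod>y'\<in>Y-{y}. y - y'))) =
    (\<Sum>y\<in>Y. F y / (y * (\<Prod>y'\<in>Y-{y}. y - y')) + u * (R - 1) * (F y / (1 - e * y^2) / (\<Prod>y'\<in>Y-{y}. y - y')))"
  proof (rule sum.cong[OF refl])
    fix y assume y: "y \<in> Y"
    define p where "p = (\<Prod>y'\<in>Y-{y}. y - y')"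
    have p0: "p \<noteq> 0" using finY by (auto simp: p_def)
    have y0: "y \<noteq> 0" using y Y0 by auto
    \<comment> \<open>This splitting is the reason for the two linear factors: the first part
      cancels 1 - e y^2 and the second cancels the pole at 0.\<close>
    have h: "(1 - u * y) * (1 + u * R * y) = (1 - e * y^2) + u * (R - 1) * y"
      by (simp add: e_def algebra_simps power2_eq_square)
    show "F y * (1 - u * y) * (1 + u * R * y) / ((1 - e * y^2) * y * (\<Prod>y'\<in>Y-{y}. y - y')) =
       F y / (y * (\<Prod>y'\<in>Y-{y}. y - y')) + u * (R - 1) * (F y / (1 - e * y^2) / (\<Prod>y'\<in>Y-{y}. y - y'))"
      unfolding p_def[symmetric] mult.assoc[of "F y"] h
      using p0 y0 ey[OF y] by (simp add: add_divide_distrib distrib_left)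
  qed
  also have "\<dots> = (\<Prod>j\<in>J. - e * x j) * R ^ card S - (\<Prod>j\<in>S. - x j) / (\<Prod>y\<in>Y. - y)
     + u * (R - 1) * (if even (card B) then 0 else e ^ m * C)"
    unfolding sum.distrib sumP sum_distrib_left[symmetric] sumG ..
  finally show ?thesis by (simp add: m_def C_def)
qed


section \<open>The weight of a sequence of positions\<close>

text \<open>Positions are integers, so negative powers of q occur. The assumptions say that q is not
  a root of unity and that u^2 is no integer power of q; this keeps every factor between distinct
  beads nonzero.\<close>

locale qparam =
  fixes q u :: "'a::field_char_0"
  assumes q_nonzero: "q \<noteq> 0" and u_nonzero: "u \<noteq> 0"
    and q_power: "0 < k \<Longrightarrow> q ^ k \<noteq> 1"
    and uq_power: "u^2 * q powi i \<noteq> 1"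
begin

lemma q_powi_eq_iff: "q powi a = q powi b \<longleftrightarrow> a = b"
proof
  have *: "a \<le> b" if "q powi a = q powi b" for a b :: int
  proof (rule ccontr)
    assume "\<not> a \<le> b"
    then have "a - b = int (nat (a - b))" "0 < nat (a - b)" by auto
    moreover have "q powi (a - b) = 1" using that q_nonzero by (simp add: power_int_diff)
    ultimately show False using q_power by (metis power_int_of_nat)
  qed
  assume "q powi a = q powi b"
  then show "a = b" using *[of a b] *[of b a] by auto
qed simp

lemma q_powi_nonzero [simp]: "q powi a \<noteq> 0"
  using q_nonzero by simp

lemma q_powi_add: "q powi (a + b) = q powi a * q powi b"
  using q_nonzero by (simp add: power_int_add)

lemma q_powi_diff: "q powi (a - b) = q powi a / q powi b"
  using q_nonzero by (simp add: power_int_diff)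

lemma one_plus_uq_nonzero: "1 + u * q powi i \<noteq> 0"
proof
  assume "1 + u * q powi i = 0"
  then have "u * q powi i = -1" by (simp add: eq_neg_iff_add_eq_0 add.commute)
  then have "(u * q powi i) ^ 2 = 1" by simp
  then have "u^2 * q powi (i * 2) = 1" by (simp add: power_mult_distrib power_int_power' mult.commute)
  then show False using uq_power by blast
qed

text \<open>A factor of a Vandermonde determinant in x + 1 / (u^2 x), where x = q^p.\<close>

definition kap :: "int \<Rightarrow> int \<Rightarrow> 'a" where
  "kap a b = (q powi a - q powi b) * (1 - u^2 * q powi (a + b))"

text \<open>The interaction of a bead at l - N with the beads below -N, all of which are occupied.
\<close>

definition sea :: "nat \<Rightarrow> nat \<Rightarrow> 'a" where
  "sea N l = (\<Prod>i<l. (1 - q powi (2 * int N - int i) / u^2) / (1 - q ^ Suc i))"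

text \<open>The Gaussian factor and the power of u q^(-N) normalise the weight so that a move up and a move down
  enter the eigenvector relation with equal coefficients.
\<close>

definition bead :: "nat \<Rightarrow> int \<Rightarrow> 'a" where
  "bead N p = (if p < - int N then 0
     else (u * q powi (- int N)) powi p * q powi (p * (p - 1) div 2) * (1 + u * q powi p) * sea N (nat (p + int N)))"

definition wt :: "nat \<Rightarrow> (nat \<Rightarrow> int) \<Rightarrow> 'a" where
  "wt N p = (\<Prod>i\<le>N. bead N (p i)) * pair_prod kap {..N} p"

lemma kap_anti: "kap a b = - kap b a"
  by (simp add: kap_def add.commute algebra_simps)

lemma kap_nonzero: "a \<noteq> b \<Longrightarrow> kap a b \<noteq> 0"
  using uq_power[of "a + b"] by (simp add: kap_def q_powi_eq_iff)

lemma sea_nonzero: "sea N l \<noteq> 0"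
proof -
  have "1 - q powi (2 * int N - int i) / u^2 \<noteq> 0" for i
  proof
    assume "1 - q powi (2 * int N - int i) / u^2 = 0"
    then have "u^2 = q powi (2 * int N - int i)"
      using u_nonzero by (simp add: field_simps)
    then have "u^2 * q powi (- (2 * int N - int i)) = 1"
      by (simp only: q_powi_add[symmetric]) simp
    then show False using uq_power by blast
  qed
  moreover have "1 - q ^ Suc i \<noteq> 0" for i using q_power[of "Suc i"] by auto
  ultimately show ?thesis using u_nonzero unfolding sea_def by (auto simp del: power_Suc)
qed

lemma bead_nonzero: "- int N \<le> p \<Longrightarrow> bead N p \<noteq> 0"
  using sea_nonzero one_plus_uq_nonzero u_nonzero q_nonzero by (simp add: bead_def)

lemma wt_isolate:
  assumes "i \<le> N"
  shows "wt N p = bead N (p i) * (\<Prod>j\<in>{..N}-{i}. kap (p i) (p j)) *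
    ((\<Prod>j\<in>{..N}-{i}. bead N (p j)) * (-1) ^ card {j\<in>{..N}. j < i} * pair_prod kap ({..N}-{i}) p)"
proof -
  have "(\<Prod>i\<le>N. bead N (p i)) = bead N (p i) * (\<Prod>j\<in>{..N}-{i}. bead N (p j))"
    using assms by (intro prod.remove) auto
  then show ?thesis
    unfolding wt_def using pair_prod_isolate[OF _ _ kap_anti, where I = "{..N}" and k = i and p = p] assms
    by (simp add: mult_ac)
qed

text \<open>All factors without bead i agree on both sides. The ratio is multiplied out because the
  factors of bead i vanish at a coincidence or below -N.\<close>

lemma wt_update:
  assumes "i \<le> N"
  shows "wt N (p(i := a)) * (bead N (p i) * (\<Prod>j\<in>{..N}-{i}. kap (p i) (p j))) =
         wt N p * (bead N a * (\<Prod>j\<in>{..N}-{i}. kap a (p j)))"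
proof -
  have c: "(\<Prod>j\<in>{..N}-{i}. f ((p(i := a)) j)) = (\<Prod>j\<in>{..N}-{i}. f (p j))" for f :: "int \<Rightarrow> 'a"
    by (rule prod.cong) auto
  have d: "pair_prod kap ({..N}-{i}) (p(i := a)) = pair_prod kap ({..N}-{i}) p"
    by (rule pair_prod_cong) auto
  show ?thesis
    unfolding wt_isolate[OF assms, of p] wt_isolate[OF assms, of "p(i := a)"] c d
    using c[of "kap a"] by (simp add: mult_ac)
qed

lemma wt_below: "i \<le> N \<Longrightarrow> p i < - int N \<Longrightarrow> wt N p = 0"
  by (auto simp: wt_isolate bead_def)

lemma wt_nonzero:
  assumes "inj_on p {..N}" "\<And>i. i \<le> N \<Longrightarrow> - int N \<le> p i"
  shows "wt N p \<noteq> 0"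
proof -
  have "kap (p i) (p j) \<noteq> 0" if "i < j" "j \<le> N" for i j
    using inj_onD[OF assms(1), of i j] that by (auto intro!: kap_nonzero)
  moreover have "bead N (p i) \<noteq> 0" if "i \<le> N" for i
    using bead_nonzero assms(2) that by blast
  ultimately show ?thesis unfolding wt_def pair_prod_def by auto
qed

text \<open>The product of the \<open>bead\<close> factors is symmetric and
  \<open>pair_prod kap\<close> is antisymmetric. Isolating both exchanged beads leaves
  \<open>kap (p i) (p j)\<close> as the only factor that changes sign.\<close>

lemma alternating_wt: "alternating N (wt N)"
proof -
  have zero: "wt N p = 0" if ij: "i \<le> N" "j \<le> N" "i \<noteq> j" "p i = p j" for p i j
  proof -
    have "(\<Prod>j\<in>{..N}-{i}. kap (p i) (p j)) = 0"
      by (rule prod_zero) (use ij in \<open>auto intro!: bexI[of _ j] simp: kap_def\<close>)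
    then show ?thesis using wt_isolate[of i N p] ij by simp
  qed
  have swap: "wt N (p(i := p j, j := p i)) = - wt N p" if ij: "i \<le> N" "j \<le> N" "i \<noteq> j" for p i j
  proof -
    define I where "I = {..N} - {i} - {j}"
    define r where "r = (\<Prod>l\<in>I. bead N (p l)) * (-1) ^ card {l\<in>{..N}. l < i} * (-1) ^ card {l\<in>{..N}-{i}. l < j} * pair_prod kap I p"
    have iso: "wt N p' = bead N (p' i) * bead N (p' j) * kap (p' i) (p' j) * (\<Prod>l\<in>I. kap (p' i) (p l))
        * (\<Prod>l\<in>I. kap (p' j) (p l)) * r"
      if p': "\<And>l. l \<in> I \<Longrightarrow> p' l = p l" for p'
    proof -
      have rm: "(\<Prod>l\<in>{..N}-{i}. f l) = f j * (\<Prod>l\<in>I. f l)" for f :: "nat \<Rightarrow> 'a"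
        unfolding I_def using ij by (intro prod.remove) auto
      have pp: "pair_prod kap ({..N}-{i}) p' = (-1) ^ card {l\<in>{..N}-{i}. l < j} * (\<Prod>l\<in>I. kap (p' j) (p' l)) * pair_prod kap I p'"
        unfolding I_def by (intro pair_prod_isolate kap_anti) (use ij in auto)
      have e: "(\<Prod>l\<in>I. f (p' l)) = (\<Prod>l\<in>I. f (p l))" for f :: "int \<Rightarrow> 'a"
        by (rule prod.cong) (use p' in auto)
      have e': "pair_prod kap I p' = pair_prod kap I p" by (rule pair_prod_cong) (use p' in auto)
      show ?thesis
        unfolding wt_isolate[OF ij(1), of p'] rm pp e e' r_def by (simp only: mult_ac)
    qed
    have "wt N p = bead N (p i) * bead N (p j) * kap (p i) (p j) * (\<Prod>l\<in>I. kap (p i) (p l)) * (\<Prod>l\<in>I. kap (p j) (p l)) * r"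
      by (rule iso) simp
    moreover have "wt N (p(i := p j, j := p i)) =
       bead N (p j) * bead N (p i) * kap (p j) (p i) * (\<Prod>l\<in>I. kap (p j) (p l)) * (\<Prod>l\<in>I. kap (p i) (p l)) * r"
      using iso[of "p(i := p j, j := p i)"] ij by (simp add: I_def)
    moreover have "kap (p j) (p i) = - kap (p i) (p j)" by (rule kap_anti)
    ultimately show ?thesis by (simp add: mult_ac)
  qed
  show ?thesis unfolding alternating_def using swap zero by blast
qed

text \<open>The exponent p (p - 1) / 2 grows by p and \<open>sea\<close> gains one factor; the
  quotient of neighbouring values is stated without denominators.\<close>

lemma bead_step:
  assumes "- int N \<le> p"
  shows "bead N (p + 1) * (1 + u * q powi p) * (1 - q powi (p + 1 + int N)) =
     bead N p * (1 + u * q powi (p + 1)) * (u * q powi (- int N)) * q powi p * (1 - q powi (int N - p) / u^2)"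
proof -
  define l where "l = nat (p + int N)"
  have p: "p = int l - int N" using assms by (simp add: l_def)
  have n: "nat (p + 1 + int N) = Suc l" using p by simp
  have tri: "(p + 1) * p div 2 = p * (p - 1) div 2 + p"
  proof -
    have "(p + 1) * p = p * (p - 1) + p * 2" by (simp add: algebra_simps)
    then show ?thesis by simp
  qed
  have s: "sea N (Suc l) * (1 - q powi (p + 1 + int N)) = sea N l * (1 - q powi (int N - p) / u^2)"
  proof -
    have "1 - q ^ Suc l \<noteq> 0" using q_power[of "Suc l"] by auto
    moreover have "q powi (p + 1 + int N) = q ^ Suc l" using p by (metis n power_int_of_nat add.commute add.left_commute diff_add_cancel of_nat_Suc)
    moreover have "2 * int N - int l = int N - p" using p by simp
    then have "sea N (Suc l) = sea N l * ((1 - q powi (int N - p) / u^2) / (1 - q ^ Suc l))"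
      by (simp only: sea_def prod.lessThan_Suc)
    ultimately show ?thesis by (simp del: power_Suc)
  qed
  have b0: "u * q powi (- int N) \<noteq> 0" using u_nonzero q_nonzero by simp
  define g where "g = (u * q powi (- int N)) powi p * q powi (p * (p - 1) div 2)"
  have "bead N (p + 1) = g * (u * q powi (- int N)) * q powi p * (1 + u * q powi (p + 1)) * sea N (Suc l)"
    using assms n tri b0 by (simp add: bead_def g_def power_int_add_1 q_powi_add)
  moreover have "bead N p = g * (1 + u * q powi p) * sea N l"
    using assms by (simp add: bead_def l_def g_def)
  moreover have "g * (u * q powi (- int N)) * q powi p * (1 + u * q powi (p + 1)) * sea N (Suc l) * (1 + u * q powi p) * (1 - q powi (p + 1 + int N))
     = g * (u * q powi (- int N)) * q powi p * (1 + u * q powi (p + 1)) * (1 + u * q powi p) * (sea N (Suc l) * (1 - q powi (p + 1 + int N)))"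
    by (simp only: mult_ac)
  ultimately show ?thesis unfolding s by (simp only: mult_ac)
qed

section \<open>Moving one bead by k steps\<close>

definition seabot :: "nat \<Rightarrow> nat \<Rightarrow> 'a" where
  "seabot N k = (\<Prod>b<k. q powi (int b - int N))"

text \<open>The constant left over when \<open>bead\<close> is shifted by k: upward moves carry it,
  downward moves carry its inverse. \<open>beta_square\<close> makes the two agree once the
  monomials of the mirror points are collected.\<close>

definition beta :: "nat \<Rightarrow> nat \<Rightarrow> 'a" where
  "beta N k = seabot N k / u ^ k"

lemma seabot_eq: "seabot N k = q powi (int k * (int k - 1) div 2 - int k * int N)"
proof (induction k)
  case (Suc k)
  have "(1 + int k) * int k = int k * (int k - 1) + int k * 2" by (simp add: algebra_simps)
  then have "(1 + int k) * int k div 2 = int k * (int k - 1) div 2 + int k" by simp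
  then have "int (Suc k) * (int (Suc k) - 1) div 2 - int (Suc k) * int N =
     (int k * (int k - 1) div 2 - int k * int N) + (int k - int N)" by (simp add: algebra_simps)
  then show ?case using Suc by (simp only: q_powi_add) (simp add: seabot_def)
qed (simp add: seabot_def)

text \<open>The products run over the positions -N, ..., k - 1 - N. On the left stands one factor of
  \<open>kap\<close> between such a position and the new place of the bead, on the right the other
  factor of \<open>kap\<close> for the old place. The \<open>sea\<close> is thus exchanged for the k
  lowest explicit beads, which is why \<open>wt_shift_eigen\<close> requires those to be
  present.\<close>

lemma bead_shift:
  assumes "- int N \<le> p"
  shows "bead N (p + int k) * (1 + u * q powi p) * (\<Prod>b<k. q powi (p + int k) - q powi (int b - int N)) =
     bead N p * (1 + u * q powi (p + int k)) * beta N k * (\<Prod>b<k. 1 - u^2 * q powi (p + (int b - int N)))"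
proof (induction k)
  case 0
  show ?case by (simp add: beta_def seabot_def)
next
  case (Suc k)
  define x where "x = p + int k"
  have x: "- int N \<le> x" using assms by (simp add: x_def)
  have sx: "p + int (Suc k) = x + 1" by (simp add: x_def)
  have u0: "1 + u * q powi x \<noteq> 0" by (rule one_plus_uq_nonzero)
  define P where "P = (\<Prod>b<k. q powi x - q powi (int b - int N))"
  define R where "R = (\<Prod>b<k. 1 - u^2 * q powi (p + (int b - int N)))"
  \<comment> \<open>Each factor with b > 0 is q times the factor with b - 1 one step earlier, so
    only the factor at the bottom is new.\<close>
  have A: "(\<Prod>b<Suc k. q powi (x + 1) - q powi (int b - int N)) = (q powi (x + 1) - q powi (- int N)) * (q ^ k * P)"
  proof -
    have "(\<Prod>b<Suc k. q powi (x + 1) - q powi (int b - int N)) =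
      (q powi (x + 1) - q powi (- int N)) * (\<Prod>b<k. q powi (x + 1) - q powi (int (Suc b) - int N))"
      unfolding prod.lessThan_Suc_shift by simp
    also have "(\<Prod>b<k. q powi (x + 1) - q powi (int (Suc b) - int N)) = (\<Prod>b<k. q * (q powi x - q powi (int b - int N)))"
      by (rule prod.cong) (auto simp: q_powi_add q_powi_diff algebra_simps)
    also have "\<dots> = q ^ k * P" by (simp add: prod.distrib P_def)
    finally show ?thesis .
  qed
  have A': "q powi (x + 1) - q powi (- int N) = - (q powi (- int N)) * (1 - q powi (x + 1 + int N))"
    using q_nonzero by (simp add: q_powi_add power_int_minus field_simps)
  have B: "(\<Prod>b<Suc k. 1 - u^2 * q powi (p + (int b - int N))) = R * (1 - u^2 * q powi (x - int N))"
    by (simp add: R_def x_def algebra_simps)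
  have B': "1 - q powi (int N - x) / u^2 = - (q powi (int N - x) / u^2) * (1 - u^2 * q powi (x - int N))"
    using u_nonzero q_nonzero by (simp add: q_powi_diff field_simps)
  have C: "beta N (Suc k) = beta N k * q powi (int k - int N) / u"
    using u_nonzero by (simp add: beta_def seabot_def)
  have IH: "bead N x * (1 + u * q powi p) * P = bead N p * (1 + u * q powi x) * beta N k * R"
    using Suc by (simp add: x_def P_def R_def)
  have step: "bead N (x + 1) * (1 + u * q powi x) * (1 - q powi (x + 1 + int N)) =
     bead N x * (1 + u * q powi (x + 1)) * (u * q powi (- int N)) * q powi x * (1 - q powi (int N - x) / u^2)"
    by (rule bead_step[OF x])
  have "(bead N (x + 1) * (1 + u * q powi p) * (\<Prod>b<Suc k. q powi (x + 1) - q powi (int b - int N))) * (1 + u * q powi x) =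
     (bead N (x + 1) * (1 + u * q powi x) * (1 - q powi (x + 1 + int N))) * (- (q powi (- int N)) * q ^ k * ((1 + u * q powi p) * P))"
    unfolding A A' by (simp only: mult_ac)
  also have "\<dots> = (bead N x * (1 + u * q powi p) * P) * ((1 + u * q powi (x + 1)) * (u * q powi (- int N)) * q powi x *
      (- (q powi (int N - x) / u^2) * (1 - u^2 * q powi (x - int N))) * (- (q powi (- int N)) * q ^ k))"
    unfolding step B' by (simp only: mult_ac)
  also have "\<dots> = (bead N p * (1 + u * q powi (x + 1)) * (beta N k * R * (1 - u^2 * q powi (x - int N))) * (1 + u * q powi x)) *
      ((u * q powi (- int N)) * q powi x * (q powi (int N - x) / u^2) * (q powi (- int N)) * q ^ k)"
    unfolding IH by (simp add: mult_ac)
  also have "(u * q powi (- int N)) * q powi x * (q powi (int N - x) / u^2) * (q powi (- int N)) * q ^ k = q powi (int k - int N) / u"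
    using u_nonzero q_nonzero by (simp add: q_powi_diff power_int_minus field_simps power2_eq_square)
  finally have "(bead N (x + 1) * (1 + u * q powi p) * (\<Prod>b<Suc k. q powi (x + 1) - q powi (int b - int N))) * (1 + u * q powi x) =
    (bead N p * (1 + u * q powi (x + 1)) * beta N (Suc k) * (\<Prod>b<Suc k. 1 - u^2 * q powi (p + (int b - int N)))) * (1 + u * q powi x)"
    unfolding B C by (simp only: mult_ac times_divide_eq_left times_divide_eq_right)
  then show ?case unfolding sx using u0 by simp
qed

lemma beta_square:
  assumes "k \<le> N + 1"
  shows "beta N k ^ 2 * (u^2) ^ k * (q ^ k) ^ (N + (N + 1 - k)) = 1"
proof -
  have "int k * (int k - 1) div 2 * 2 = int k * (int k - 1)" by simp
  then have e: "(int k * (int k - 1) div 2 - int k * int N) * 2 = int k * (int k - 1) - 2 * (int k * int N)"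
    by (simp only: left_diff_distrib)
  have "seabot N k ^ 2 = q powi (int k * (int k - 1) - 2 * (int k * int N))"
    unfolding seabot_eq power_int_power' by (simp only: of_nat_numeral e)
  moreover have "(q ^ k) ^ (N + (N + 1 - k)) = q powi (int k * (2 * int N + 1 - int k))"
  proof -
    have "int (k * (N + (N + 1 - k))) = int k * (2 * int N + 1 - int k)"
      using assms by (simp add: of_nat_diff)
    then show ?thesis unfolding power_mult[symmetric] by (metis power_int_of_nat)
  qed
  moreover have "q powi (int k * (int k - 1) - 2 * (int k * int N)) * q powi (int k * (2 * int N + 1 - int k)) = 1"
    unfolding q_powi_add[symmetric] by (simp add: algebra_simps)
  ultimately show ?thesis
    using u_nonzero by (simp add: beta_def power_divide power_mult[symmetric] mult.commute field_simps)
qed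

end

section \<open>The eigenvector relation\<close>

context qparam
begin

text \<open>The three contributions of \<open>residue_sum\<close>: infinity gives the term with u^k
  q^k, the pole at 0 the term with the inverse of u, and the poles at e y^2 = 1 the extra 1 for odd
  k.\<close>

definition eig :: "nat \<Rightarrow> 'a" where
  "eig k = (-1) ^ k * (inverse u ^ k - u ^ k * q ^ k) / (1 - q ^ k) + (if odd k then 1 else 0)"

text \<open>Relative to \<open>wt N p\<close>, moving bead i up is a constant times the summand of
  \<open>residue_sum\<close> at x i, and moving it down is the same constant times the summand at
  the mirror point z i. Beads of B cannot go down, so only S is mirrored, and all moves together
  form the full sum over Y.\<close>

lemma wt_shift_eigen:
  assumes inj: "inj_on p {..N}" and low: "\<And>i. i \<le> N \<Longrightarrow> - int N \<le> p i"
    and k0: "0 < k" and bottom: "\<And>b. b < k \<Longrightarrow> int b - int N \<in> p ` {..N}"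
  shows "shift_sum N (int k) (wt N) p + shift_sum N (- int k) (wt N) p = eig k * wt N p"
proof -
  define J where "J = {..N}"
  define B where "B = {i\<in>J. p i < int k - int N}"
  define S where "S = J - B"
  define x where "x i = q powi p i" for i
  define R where "R = q ^ k"
  define c where "c = u^2"
  define e where "e = u^2 * R"
  define z where "z j = 1 / (c * x j)" for j
  define Y where "Y = x ` J \<union> z ` S"
  define F where "F y = (\<Prod>j\<in>J. 1 - e * y * x j) * (\<Prod>j\<in>S. R * y - x j)" for y
  define tm where "tm y = F y * (1 - u * y) * (1 + u * R * y) / ((1 - e * y^2) * y * (\<Prod>y'\<in>Y-{y}. y - y'))" for y
  define PS where "PS = (\<Prod>j\<in>S. - c * x j)"
  \<comment> \<open>The common constant: \<open>beta\<close> comes from \<open>bead_shift\<close>, R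
    - 1 from the term j = i among the R x i - x j, and PS from bringing the x i - z j to the form (1
    - c x i x j) / (- c x j).\<close>
  define kappa where "kappa = beta N k / ((R - 1) * PS)"
  have fin: "finite J" "finite B" "finite S" by (auto simp: J_def B_def S_def)
  have BJ: "B \<subseteq> J" and SJ: "S \<subseteq> J" by (auto simp: B_def S_def)
  have R0: "R \<noteq> 0" using q_nonzero by (simp add: R_def)
  have R1: "R - 1 \<noteq> 0" using q_power[OF k0] by (simp add: R_def)
  have c0: "c \<noteq> 0" using u_nonzero by (simp add: c_def)
  have eR: "e = c * R" by (simp add: c_def e_def)
  have Rk: "R = q powi int k" by (simp add: R_def)
  have x0: "x i \<noteq> 0" for i by (simp add: x_def q_nonzero)
  have gen: "c * q powi a \<noteq> 1" for a using uq_power by (simp add: c_def)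
  \<comment> \<open>The lower bound on p and the assumption on the lowest positions identify B with
    these k positions, so that products over B become those of \<open>bead_shift\<close>.\<close>
  have pB: "p ` B = (\<lambda>b. int b - int N) ` {..<k}"
  proof
    show "p ` B \<subseteq> (\<lambda>b. int b - int N) ` {..<k}"
    proof
      fix a assume "a \<in> p ` B"
      then have "- int N \<le> a" "a < int k - int N" using low by (auto simp: B_def J_def)
      then show "a \<in> (\<lambda>b. int b - int N) ` {..<k}"
        by (intro image_eqI[of _ _ "nat (a + int N)"]) auto
    qed
    show "(\<lambda>b. int b - int N) ` {..<k} \<subseteq> p ` B"
      using bottom by (fastforce simp: B_def J_def)
  qed
  have injb: "inj_on (\<lambda>b. int b - int N) {..<k}" by (auto simp: inj_on_def)
  have injB: "inj_on p B" using inj BJ by (auto simp: J_def inj_on_def)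
  have prodB: "(\<Prod>b\<in>B. f (p b)) = (\<Prod>b<k. f (int b - int N))" for f :: "int \<Rightarrow> 'a"
  proof -
    have "(\<Prod>b\<in>B. f (p b)) = prod f (p ` B)" using injB by (simp add: prod.reindex)
    also have "\<dots> = (\<Prod>b<k. f (int b - int N))" unfolding pB using injb by (simp add: prod.reindex)
    finally show ?thesis .
  qed
  have cardB: "card B = k"
    using card_image[OF injB] card_image[OF injb] pB by simp
  have cardJ: "card J = N + 1" by (simp add: J_def)
  have cardS: "card S = N + 1 - k" unfolding S_def using fin BJ cardB cardJ by (simp add: card_Diff_subset)
  have kN: "k \<le> N + 1" using card_mono[OF fin(1) BJ] cardB cardJ by simp
  have injx: "inj_on x J"
    using inj by (auto simp: inj_on_def x_def J_def q_powi_eq_iff)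
  have cxx: "c * x i * x j \<noteq> 1" for i j
    using gen[of "p i + p j"] by (simp add: x_def q_powi_add mult.assoc)
  have exx: "e * (x j)^2 \<noteq> 1" for j
  proof -
    have "e * (x j)^2 = c * q powi (int k + (p j + p j))"
      by (simp only: eR Rk x_def q_powi_add power2_eq_square mult_ac)
    then show ?thesis using gen by simp
  qed
  have exx2: "c * (x j)^2 \<noteq> R" for j
  proof
    assume "c * (x j)^2 = R"
    then have "c * q powi (p j + p j - int k) = 1"
      using R0 by (simp only: q_powi_add q_powi_diff x_def[symmetric] Rk[symmetric] power2_eq_square) simp
    then show False using gen by blast
  qed
  have PS0: "PS \<noteq> 0" using fin c0 x0 by (simp add: PS_def)
  have xz: "x i \<noteq> z j" for i j
    using cxx[of i j] x0[of j] c0 by (auto simp: z_def field_simps)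
  have injz: "inj_on z S"
    using injx SJ x0 c0 by (auto simp: inj_on_def z_def)
  have disj: "x ` J \<inter> z ` S = {}" using xz by auto
  have res: "(\<Sum>y\<in>Y. tm y) = (\<Prod>j\<in>J. - e * x j) * R ^ card S - (\<Prod>j\<in>S. - x j) / (\<Prod>y\<in>Y. - y)
     + (if odd (card B) then u * (R - 1) * e ^ (card B div 2) * R ^ card S * PS else 0)"
    unfolding tm_def Y_def F_def z_def e_def c_def PS_def
    by (rule residue_sum[OF fin(1) BJ _ S_def injx])
       (use k0 cardB cxx exx exx2 u_nonzero R0 x0 in \<open>auto simp: c_def e_def\<close>)
  have sumY: "(\<Sum>y\<in>Y. tm y) = (\<Sum>i\<in>J. tm (x i)) + (\<Sum>j\<in>S. tm (z j))"
    unfolding Y_def using fin disj by (simp add: sum.union_disjoint sum.reindex injx injz)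
  have prodJ: "(\<Prod>j\<in>J. f j) = (\<Prod>j\<in>B. f j) * (\<Prod>j\<in>S. f j)" for f :: "nat \<Rightarrow> 'a"
    using prod.subset_diff[OF BJ fin(1), of f] by (simp add: S_def mult.commute)
  have prodi: "(\<Prod>j\<in>J. f j) = f i * (\<Prod>j\<in>J-{i}. f j)" if "i \<in> J" for i and f :: "nat \<Rightarrow> 'a"
    using that by (rule prod.remove[OF fin(1)])
  have prodSi: "(\<Prod>j\<in>S. f j) = f i * (\<Prod>j\<in>S-{i}. f j)" if "i \<in> S" for i and f :: "nat \<Rightarrow> 'a"
    using that by (rule prod.remove[OF fin(3)])
  have kapx: "kap (p i + int k) (p j) = (R * x i - x j) * (1 - e * x i * x j)" 
       "kap (p i) (p j) = (x i - x j) * (1 - c * x i * x j)"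
       "kap (p i - int k) (p j) = (x i / R - x j) * (1 - c * x i / R * x j)" for i j
    by (simp_all add: kap_def x_def Rk eR c_def q_powi_add q_powi_diff mult_ac)

  have up: "wt N (p(i := p i + int k)) = wt N p * (kappa * tm (x i))" if i: "i \<in> J" for i
  proof -
    define P1 where "P1 = (\<Prod>j\<in>J-{i}. R * x i - x j)"
    define P2 where "P2 = (\<Prod>j\<in>J-{i}. 1 - e * x i * x j)"
    define P3 where "P3 = (\<Prod>j\<in>J-{i}. x i - x j)"
    define P4 where "P4 = (\<Prod>j\<in>J-{i}. 1 - c * x i * x j)"
    define B1 where "B1 = (\<Prod>j\<in>B. R * x i - x j)"
    define B4 where "B4 = (\<Prod>j\<in>B. 1 - c * x i * x j)"
    define S1 where "S1 = (\<Prod>j\<in>S. R * x i - x j)"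
    define S4 where "S4 = (\<Prod>j\<in>S. 1 - c * x i * x j)"
    have BS1: "B1 * S1 = (R - 1) * x i * P1"
      using prodJ[of "\<lambda>j. R * x i - x j"] prodi[OF i, of "\<lambda>j. R * x i - x j"]
      by (simp add: B1_def S1_def P1_def algebra_simps)
    have BS4: "B4 * S4 = (1 - c * (x i)^2) * P4"
      using prodJ[of "\<lambda>j. 1 - c * x i * x j"] prodi[OF i, of "\<lambda>j. 1 - c * x i * x j"]
      by (simp add: B4_def S4_def P4_def power2_eq_square mult.assoc)
    have nz: "P3 \<noteq> 0" "P4 \<noteq> 0" "B4 \<noteq> 0" "S4 \<noteq> 0"
      using fin cxx inj_onD[OF injx] i by (auto simp: P3_def P4_def B4_def S4_def)
    have B1nz: "B1 \<noteq> 0"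
    proof -
      have "R * x i \<noteq> x j" if "j \<in> B" for j
      proof
        assume "R * x i = x j"
        then have "q powi (int k + p i) = q powi p j" by (simp add: Rk x_def q_powi_add)
        then have "p j = int k + p i" by (simp add: q_powi_eq_iff)
        then show False using that low[of i] i by (simp add: B_def J_def)
      qed
      then show ?thesis using fin by (simp add: B1_def)
    qed
    have den: "(\<Prod>y'\<in>Y-{x i}. x i - y') = P3 * (S4 / PS)"
    proof -
      have "Y - {x i} = x ` (J - {i}) \<union> z ` S"
        using i xz inj_onD[OF injx] by (auto simp: Y_def)
      moreover have "x ` (J - {i}) \<inter> z ` S = {}" using disj by auto
      moreover have "inj_on x (J - {i})" using injx by (auto simp: inj_on_def)
      ultimately have "(\<Prod>y'\<in>Y-{x i}. x i - y') = P3 * (\<Prod>j\<in>S. x i - z j)"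
        using fin injz by (simp add: prod.union_disjoint prod.reindex P3_def)
      also have "(\<Prod>j\<in>S. x i - z j) = (\<Prod>j\<in>S. (1 - c * x i * x j) / (- c * x j))"
        by (rule prod.cong) (use x0 c0 in \<open>auto simp: z_def field_simps\<close>)
      finally show ?thesis unfolding prod_dividef S4_def PS_def .
    qed
    have Fx: "F (x i) = (1 - e * (x i)^2) * P2 * S1"
      unfolding F_def P2_def S1_def prodi[OF i, of "\<lambda>j. 1 - e * x i * x j"]
      by (simp add: power2_eq_square mult.assoc)
    have bs: "bead N (p i + int k) * (1 + u * x i) * B1 = bead N (p i) * (1 + u * (R * x i)) * beta N k * B4"
    proof -
      have "B1 = (\<Prod>b<k. q powi (p i + int k) - q powi (int b - int N))"
        unfolding B1_def x_def prodB[of "\<lambda>a. R * q powi p i - q powi a"]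
        by (simp add: Rk q_powi_add mult.commute)
      moreover have "B4 = (\<Prod>b<k. 1 - u^2 * q powi (p i + (int b - int N)))"
        unfolding B4_def x_def prodB[of "\<lambda>a. 1 - c * q powi p i * q powi a"]
        by (simp add: q_powi_add[symmetric] c_def mult.assoc)
      moreover have "R * x i = q powi (p i + int k)" by (simp add: Rk x_def q_powi_add mult.commute)
      ultimately show ?thesis using bead_shift[of N "p i" k] low[of i] i by (simp add: x_def J_def)
    qed
    \<comment> \<open>The term j = i among the 1 - c x i x j does not occur in the weight. Its half
      1 + u x i is the factor of \<open>bead\<close> at the old position, and its other half cancels
      the factor 1 - u y of the summand.\<close>
    have hh: "(1 - u * x i) * (1 + u * x i) = 1 - c * (x i)^2"
      by (simp add: c_def algebra_simps power2_eq_square)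
    have ux: "1 + u * x i \<noteq> 0" using one_plus_uq_nonzero by (simp add: x_def)
    have cx2: "1 - c * (x i)^2 \<noteq> 0" using cxx[of i i] by (simp add: power2_eq_square mult.assoc)
    have ex2: "1 - e * (x i)^2 \<noteq> 0" using exx[of i] by simp
    have alg1: "bt / (r * PS) * ((h * P2 * S1) * a * b / (h * xx * (P3 * (S4 / PS)))) = bt * P2 * S1 * a * b / (r * xx * P3 * S4)"
      if "h \<noteq> 0" "xx \<noteq> 0" "r \<noteq> 0" for h r a b bt xx
      using that PS0 nz by (simp add: field_simps)
    have kt: "kappa * tm (x i) = beta N k * P2 * S1 * (1 - u * x i) * (1 + u * R * x i) / ((R - 1) * x i * P3 * S4)"
      unfolding tm_def kappa_def den Fx by (rule alg1[OF ex2 x0 R1])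
    have S1: "S1 = (R - 1) * x i * P1 / B1" and S4: "S4 = (1 - c * (x i)^2) * P4 / B4"
      using BS1 BS4 B1nz nz by (simp_all add: eq_divide_eq mult.commute)
    have alg2: "bt * P2 * (r * xx * P1 / B1) * a * b / (r * xx * P3 * (d * P4 / B4)) = bt * P1 * P2 * B4 * a * b / (B1 * d * P3 * P4)"
      if "xx \<noteq> 0" "r \<noteq> 0" "d \<noteq> 0" for r a b d bt xx
      using that nz B1nz by (simp add: field_simps)
    have kt2: "kappa * tm (x i) = beta N k * P1 * P2 * B4 * (1 - u * x i) * (1 + u * R * x i) / (B1 * (1 - c * (x i)^2) * P3 * P4)"
      unfolding kt S1 S4 by (rule alg2[OF x0 R1 cx2])
    have alg3: "bd * (P3 * P4) * (bt * P1 * P2 * B4 * a * b / (B1 * (a * w) * P3 * P4)) = bd' * (P1 * P2)"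
      if "bd' * w * B1 = bd * b * bt * B4" "a * w \<noteq> 0" for a b w bt bd bd'
    proof -
      have "bd * (P3 * P4) * (bt * P1 * P2 * B4 * a * b / (B1 * (a * w) * P3 * P4)) = (bd * b * bt * B4) * P1 * P2 / (B1 * w)"
        using that(2) nz B1nz by (simp add: field_simps)
      also have "\<dots> = bd' * (P1 * P2)"
        unfolding that(1)[symmetric] using that(2) B1nz by (simp add: field_simps)
      finally show ?thesis .
    qed
    have key: "bead N (p i) * (P3 * P4) * (kappa * tm (x i)) = bead N (p i + int k) * (P1 * P2)"
      unfolding kt2 hh[symmetric] by (rule alg3) (use bs hh cx2 in \<open>simp_all add: mult.assoc\<close>)
    have "wt N (p(i := p i + int k)) * (bead N (p i) * (P3 * P4)) = wt N p * (bead N (p i + int k) * (P1 * P2))"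
      using wt_update[of i N p "p i + int k"] i
      unfolding kapx prod.distrib J_def[symmetric] P1_def P2_def P3_def P4_def by (simp add: J_def)
    also have "\<dots> = wt N p * (kappa * tm (x i)) * (bead N (p i) * (P3 * P4))"
      unfolding key[symmetric] by (simp only: mult_ac)
    finally show ?thesis
      using nz bead_nonzero[of N "p i"] low[of i] i by (simp add: J_def)
  qed

  have down: "wt N (p(i := p i - int k)) = wt N p * (kappa * tm (z i))" if i: "i \<in> S" for i
  proof -
    have iJ: "i \<in> J" using i SJ by auto
    define s where "s = N + 1 - k"
    have ss: "card S = s" "N + 1 = s + k" using cardS kN by (auto simp: s_def)
    define D1 where "D1 = (\<Prod>j\<in>J-{i}. x i / R - x j)"
    define D2 where "D2 = (\<Prod>j\<in>J-{i}. 1 - c * x i / R * x j)"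
    define P3 where "P3 = (\<Prod>j\<in>J-{i}. x i - x j)"
    define P4 where "P4 = (\<Prod>j\<in>J-{i}. 1 - c * x i * x j)"
    define B2 where "B2 = (\<Prod>j\<in>B. 1 - c * x i / R * x j)"
    define B3 where "B3 = (\<Prod>j\<in>B. x i - x j)"
    define S2 where "S2 = (\<Prod>j\<in>S. 1 - c * x i / R * x j)"
    define S3 where "S3 = (\<Prod>j\<in>S-{i}. x i - x j)"
    define PSi where "PSi = (\<Prod>j\<in>S-{i}. - c * x j)"
    have gen2: "1 - c * x i / R * x j \<noteq> 0" for j
    proof -
      have "c * x i / R * x j = c * q powi (p i - int k + p j)"
        by (simp add: x_def Rk q_powi_add q_powi_diff)
      then show ?thesis using gen by simp
    qed
    have iB: "i \<notin> B" using i by (simp add: S_def)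
    have xB: "x i \<noteq> x j" if "j \<in> B" for j
      using inj_onD[OF injx, of i j] iJ iB BJ that by auto
    have nz: "P3 \<noteq> 0" "P4 \<noteq> 0" "B2 \<noteq> 0" "B3 \<noteq> 0" "S2 \<noteq> 0" "S3 \<noteq> 0" "PSi \<noteq> 0" "D2 \<noteq> 0"
      using fin cxx gen2 inj_onD[OF injx] iJ xB SJ c0 x0
      by (auto simp: P3_def P4_def B2_def B3_def S2_def S3_def PSi_def D2_def)
    have BS2: "B2 * S2 = (1 - c * (x i)^2 / R) * D2"
      using prodJ[of "\<lambda>j. 1 - c * x i / R * x j"] prodi[OF iJ, of "\<lambda>j. 1 - c * x i / R * x j"]
      by (simp add: B2_def S2_def D2_def power2_eq_square mult.assoc)
    have BS3: "B3 * S3 = P3"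
    proof -
      have "J - {i} = B \<union> (S - {i})" using iB BJ by (auto simp: S_def)
      moreover have "B \<inter> (S - {i}) = {}" by (auto simp: S_def)
      ultimately show ?thesis using fin by (simp add: P3_def B3_def S3_def prod.union_disjoint)
    qed
    have PSs: "PS = - c * x i * PSi" unfolding PS_def PSi_def by (rule prodSi[OF i])
    \<comment> \<open>At the mirror point the factors of F become those of \<open>kap\<close> at p i
      - k: 1 - e y x j is proportional to x i / R - x j, and R y - x j to 1 - c x i x j / R.\<close>
    have Fz: "F (z i) = ((R / x i) ^ (s + k) * ((x i / R - x i) * D1)) * ((R / (c * x i)) ^ s * S2)"
    proof -
      have "(\<Prod>j\<in>J. 1 - e * z i * x j) = (\<Prod>j\<in>J. (R / x i) * (x i / R - x j))"
        by (rule prod.cong) (use x0[of i] c0 R0 in \<open>auto simp: z_def eR field_simps\<close>)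
      also have "\<dots> = (R / x i) ^ (s + k) * (\<Prod>j\<in>J. x i / R - x j)"
        unfolding prod.distrib using ss cardJ by simp
      also have "(\<Prod>j\<in>J. x i / R - x j) = (x i / R - x i) * D1"
        unfolding D1_def by (rule prodi[OF iJ])
      finally have A: "(\<Prod>j\<in>J. 1 - e * z i * x j) = (R / x i) ^ (s + k) * ((x i / R - x i) * D1)" .
      have "(\<Prod>j\<in>S. R * z i - x j) = (\<Prod>j\<in>S. (R / (c * x i)) * (1 - c * x i / R * x j))"
        by (rule prod.cong) (use x0[of i] c0 R0 in \<open>auto simp: z_def field_simps\<close>)
      also have "\<dots> = (R / (c * x i)) ^ s * S2"
        unfolding prod.distrib using ss by (simp add: S2_def)
      finally show ?thesis unfolding F_def A by simp
    qed
    have den: "(\<Prod>y'\<in>Y-{z i}. z i - y') = ((1 / (c * x i)) ^ (s + k) * ((1 - c * (x i)^2) * P4)) * (S3 / (x i ^ (s - 1) * PSi))"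
    proof -
      have "Y - {z i} = x ` J \<union> z ` (S - {i})"
        using i xz xz[THEN not_sym] inj_onD[OF injz] by (auto simp: Y_def)
      moreover have "x ` J \<inter> z ` (S - {i}) = {}" using disj by auto
      moreover have "inj_on z (S - {i})" using injz by (auto simp: inj_on_def)
      ultimately have "(\<Prod>y'\<in>Y-{z i}. z i - y') = (\<Prod>j\<in>J. z i - x j) * (\<Prod>j\<in>S-{i}. z i - z j)"
        using fin injx by (simp add: prod.union_disjoint prod.reindex)
      also have "(\<Prod>j\<in>J. z i - x j) = (\<Prod>j\<in>J. (1 / (c * x i)) * (1 - c * x i * x j))"
        by (rule prod.cong) (use x0[of i] c0 in \<open>auto simp: z_def field_simps\<close>)
      also have "\<dots> = (1 / (c * x i)) ^ (s + k) * (\<Prod>j\<in>J. 1 - c * x i * x j)"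
        unfolding prod.distrib using ss cardJ by simp
      also have "(\<Prod>j\<in>J. 1 - c * x i * x j) = (1 - c * (x i)^2) * P4"
        unfolding P4_def prodi[OF iJ, of "\<lambda>j. 1 - c * x i * x j"] by (simp add: power2_eq_square mult.assoc)
      also have "(\<Prod>j\<in>S-{i}. z i - z j) = (\<Prod>j\<in>S-{i}. (x i - x j) / (x i * (- c * x j)))"
      proof (rule prod.cong[OF refl])
        fix j
        show "z i - z j = (x i - x j) / (x i * (- c * x j))"
          using x0[of i] x0[of j] c0 by (simp add: z_def field_simps)
      qed
      also have "\<dots> = S3 / (x i ^ (s - 1) * PSi)"
        unfolding prod_dividef prod.distrib S3_def PSi_def using ss i fin by simp
      finally show ?thesis .
    qed
    have k_le: "- int N \<le> p i - int k"
      using i iJ by (auto simp: S_def B_def)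
    have bs: "bead N (p i) * (1 + u * (x i / R)) * B3 = bead N (p i - int k) * (1 + u * x i) * beta N k * B2"
    proof -
      have "B3 = (\<Prod>b<k. q powi (p i - int k + int k) - q powi (int b - int N))"
        unfolding B3_def x_def prodB[of "\<lambda>a. q powi p i - q powi a"] by simp
      moreover have "B2 = (\<Prod>b<k. 1 - u^2 * q powi (p i - int k + (int b - int N)))"
        unfolding B2_def x_def prodB[of "\<lambda>a. 1 - c * q powi p i / R * q powi a"]
        by (simp add: q_powi_add q_powi_diff c_def Rk mult.assoc)
      moreover have "x i / R = q powi (p i - int k)" by (simp add: Rk x_def q_powi_diff)
      ultimately show ?thesis using bead_shift[OF k_le, of k] by (simp add: x_def)
    qed
    have ux: "1 + u * x i \<noteq> 0" using one_plus_uq_nonzero by (simp add: x_def)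
    have uxR: "R + u * x i \<noteq> 0"
    proof -
      have "R + u * x i = R * (1 + u * q powi (p i - int k))"
        using R0 by (simp add: x_def Rk q_powi_diff field_simps)
      then show ?thesis using R0 one_plus_uq_nonzero by simp
    qed
    \<comment> \<open>The exponent exceeds that of \<open>beta_square\<close> by one, hence R on the
      right. This turns the collected monomials into 1 / \<open>beta\<close>, the constant of a
      downward move.\<close>
    have bb: "beta N k ^ 2 * c ^ k * R ^ (s + k + s) = R"
    proof -
      have "beta N k ^ 2 * c ^ k * R ^ (N + s) = 1"
        using beta_square[OF kN] by (simp add: c_def R_def s_def)
      moreover have "s + k + s = Suc (N + s)" using ss by simp
      then have "beta N k ^ 2 * c ^ k * R ^ (s + k + s) = R * (beta N k ^ 2 * c ^ k * R ^ (N + s))"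
        by (simp only: power_Suc mult_ac)
      ultimately show ?thesis by simp
    qed
    have beta0: "beta N k \<noteq> 0"
      using bb R0 k0 by (auto simp: power_0_left)
    have s1: "x i ^ s = x i * x i ^ (s - 1)"
    proof -
      have "s > 0" using ss i fin by (metis card_gt_0_iff empty_iff)
      then show ?thesis by (cases s) auto
    qed
    have cx2: "1 - c * (x i)^2 \<noteq> 0" using cxx[of i i] by (simp add: power2_eq_square mult.assoc)
    have cxR: "c * (x i)^2 - R \<noteq> 0" using exx2[of i] by simp
    \<comment> \<open>As for upward moves, 1 - u y cancels one half of 1 - c (x i)^2, while 1 + u R
      y becomes up to a monomial the factor 1 + u x i / R of \<open>bead\<close> at p i - k.\<close>
    have hz: "(1 - u * z i) * (1 + u * R * z i) / ((1 - e * (z i)^2) * z i) = (u * x i - 1) * (u * x i + R) * (c * x i) / (c * (x i)^2 - R)"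
    proof -
      have a: "1 - u * z i = (u * x i - 1) / (u * x i)" "1 + u * R * z i = (u * x i + R) / (u * x i)"
        using x0[of i] u_nonzero by (simp_all add: z_def c_def field_simps power2_eq_square)
      have b: "1 - e * (z i)^2 = (c * (x i)^2 - R) / (c * (x i)^2)"
        using x0[of i] c0 by (simp add: z_def eR field_simps power2_eq_square)
      have "c * (x i)^2 = (u * x i)^2" by (simp add: c_def power_mult_distrib)
      then show ?thesis unfolding a b using x0[of i] c0 u_nonzero cxR
        by (simp add: z_def field_simps power2_eq_square)
    qed
    have tz: "tm (z i) = F (z i) * ((u * x i - 1) * (u * x i + R) * (c * x i) / (c * (x i)^2 - R)) / (\<Prod>y'\<in>Y-{z i}. z i - y')"
      unfolding tm_def hz[symmetric] by simp
    have pw: "(R / x i) ^ (s + k) * (R / (c * x i)) ^ s * (x i ^ (s - 1)) / (1 / (c * x i)) ^ (s + k) = R ^ (s + k + s) * c ^ k / x i"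
    proof -
      have *: "X ^ s = y * X' \<Longrightarrow> y \<noteq> 0 \<Longrightarrow> X' \<noteq> 0 \<Longrightarrow> X \<noteq> 0 \<Longrightarrow> (R / X) ^ (s + k) * (R / (c * X)) ^ s * X' / (1 / (c * X)) ^ (s + k) = R ^ (s + k + s) * c ^ k / y" for X X' y
        using c0 R0 by (simp add: power_divide power_add power_mult_distrib field_simps)
      show ?thesis by (rule *[OF s1]) (use x0[of i] in auto)
    qed
    have alg1: "(A1 * (m * D1)) * (A2 * S2) * hz / (A3 * (d * P4) * (S3 / (A4 * PSi))) =
         (A1 * A2 * A4 / A3) * (m * D1 * S2 * PSi * hz) / (d * P4 * S3)"
      if "A3 \<noteq> 0" "A4 \<noteq> 0" "d \<noteq> 0" for A1 A2 A3 A4 m hz d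
      using that nz by (simp add: field_simps)
    have t1: "tm (z i) = ((R / x i) ^ (s + k) * (R / (c * x i)) ^ s * (x i ^ (s - 1)) / (1 / (c * x i)) ^ (s + k)) *
       ((x i / R - x i) * D1 * S2 * PSi * ((u * x i - 1) * (u * x i + R) * (c * x i) / (c * (x i)^2 - R))) / ((1 - c * (x i)^2) * P4 * S3)"
      unfolding tz Fz den by (rule alg1) (use x0[of i] c0 cx2 in auto)
    have S2: "S2 = (1 - c * (x i)^2 / R) * D2 / B2" and S3: "S3 = P3 / B3"
      using BS2 BS3 nz by (simp_all add: eq_divide_eq mult.commute)
    have hh: "1 - c * (x i)^2 = (1 + u * x i) * - (u * x i - 1)"
      by (simp add: c_def algebra_simps power2_eq_square)
    have ux1: "u * x i - 1 \<noteq> 0" using hh cx2 by auto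
    have alg2: "E / xx * (- (xx * r / R) * D1 * (- (g / R) * D2 / B2) * PSi * (m * (R * w) * (c * xx) / g)) / (w' * - m * P4 * (P3 / B3))
       = E * r / R * w * (PSi * (- c * xx)) * D1 * D2 * B3 / (w' * P4 * P3 * B2)"
      if "xx \<noteq> 0" "g \<noteq> 0" "m \<noteq> 0" "w' \<noteq> 0" for E xx r g m w w'
      using that nz R0 by (simp add: field_simps)
    have t2: "tm (z i) = R ^ (s + k + s) * c ^ k * (R - 1) / R * (1 + u * (x i / R)) * (PSi * (- c * x i)) * D1 * D2 * B3 / ((1 + u * x i) * P4 * P3 * B2)"
    proof -
      have f1: "x i / R - x i = - (x i * (R - 1) / R)" using R0 by (simp add: field_simps)
      have f2: "(1 - c * (x i)^2 / R) = - ((c * (x i)^2 - R) / R)" using R0 by (simp add: field_simps)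
      have f3: "u * x i + R = R * (1 + u * (x i / R))" using R0 by (simp add: field_simps)
      show ?thesis unfolding t1 pw S2 S3 f1 f2 f3 hh by (rule alg2[OF x0 cxR ux1 ux])
    qed
    have alg3: "bt / (r * PS) * (E * C * r / R * w * PS * D1 * D2 * B3 / G) = (bt * E * C / R) * w * D1 * D2 * B3 / G"
      if "r \<noteq> 0" "G \<noteq> 0" for bt r E C w G
      using that PS0 R0 by (simp add: field_simps)
    have kt: "kappa * tm (z i) = (beta N k * R ^ (s + k + s) * c ^ k / R) * (1 + u * (x i / R)) * D1 * D2 * B3 / ((1 + u * x i) * P4 * P3 * B2)"
    proof -
      have PS': "PSi * (- c * x i) = PS" using PSs by simp
      show ?thesis unfolding kappa_def t2 PS' by (rule alg3[OF R1]) (use ux nz in auto)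
    qed
    have b1: "beta N k * R ^ (s + k + s) * c ^ k / R = 1 / beta N k"
      using bb beta0 R0 by (simp add: field_simps power2_eq_square)
    have alg4: "bd * (P3 * P4) * (1 / bt * w * D1 * D2 * B3 / (w' * P4 * P3 * B2)) = bd' * (D1 * D2)"
      if "bd * w * B3 = bd' * w' * bt * B2" "w' \<noteq> 0" "bt \<noteq> 0" for bd bd' bt w w'
    proof -
      have "bd * (P3 * P4) * (1 / bt * w * D1 * D2 * B3 / (w' * P4 * P3 * B2)) = (bd * w * B3) * D1 * D2 / (bt * w' * B2)"
        using that(2,3) nz by (simp add: field_simps)
      also have "\<dots> = bd' * (D1 * D2)"
        unfolding that(1) using that(2,3) nz by (simp add: field_simps)
      finally show ?thesis .
    qed
    have key: "bead N (p i) * (P3 * P4) * (kappa * tm (z i)) = bead N (p i - int k) * (D1 * D2)"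
      unfolding kt b1 by (rule alg4[OF bs ux beta0])
    have "wt N (p(i := p i - int k)) * (bead N (p i) * (P3 * P4)) = wt N p * (bead N (p i - int k) * (D1 * D2))"
      using wt_update[of i N p "p i - int k"] iJ
      unfolding kapx prod.distrib J_def[symmetric] D1_def D2_def P3_def P4_def by (simp add: J_def)
    also have "\<dots> = wt N p * (kappa * tm (z i)) * (bead N (p i) * (P3 * P4))"
      unfolding key[symmetric] by (simp only: mult_ac)
    finally show ?thesis
      using nz bead_nonzero[of N "p i"] low[of i] iJ by (simp add: J_def)
  qed

  have "shift_sum N (int k) (wt N) p = (\<Sum>i\<in>J. wt N p * (kappa * tm (x i)))"
    unfolding shift_sum_def J_def[symmetric] by (rule sum.cong) (use up in auto)
  \<comment> \<open>A bead of B would be moved below -N, where \<open>bead\<close> is zero by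
    definition.\<close>
  moreover have "shift_sum N (- int k) (wt N) p = (\<Sum>i\<in>S. wt N p * (kappa * tm (z i)))"
  proof -
    have "shift_sum N (- int k) (wt N) p = (\<Sum>i\<in>S. wt N (p(i := p i - int k)))"
      unfolding shift_sum_def J_def[symmetric]
    proof (rule sum.mono_neutral_cong_right)
      show "\<forall>i\<in>J - S. wt N (p(i := p i + - int k)) = 0"
      proof
        fix i assume "i \<in> J - S"
        then have "i \<le> N" "p i - int k < - int N" by (auto simp: S_def B_def J_def)
        then show "wt N (p(i := p i + - int k)) = 0" by (intro wt_below[of i]) auto
      qed
    qed (use fin SJ in auto)
    also have "\<dots> = (\<Sum>i\<in>S. wt N p * (kappa * tm (z i)))"
      by (rule sum.cong) (use down in auto)
    finally show ?thesis .
  qed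
  ultimately have tot: "shift_sum N (int k) (wt N) p + shift_sum N (- int k) (wt N) p = wt N p * (kappa * (\<Sum>y\<in>Y. tm y))"
    unfolding sumY by (simp add: sum_distrib_left distrib_left)

  define s where "s = N + 1 - k"
  have ss: "card S = s" "N + 1 = s + k" using cardS kN by (auto simp: s_def)
  define XB where "XB = seabot N k"
  have XB: "(\<Prod>b\<in>B. x b) = XB" unfolding x_def XB_def seabot_def by (rule prodB)
  have XB0: "XB \<noteq> 0" using fin x0 by (simp add: XB[symmetric])
  have beta: "beta N k = XB / u ^ k" by (simp add: beta_def XB_def)
  have XB2: "XB ^ 2 * R ^ (N + s) = 1"
    using beta_square[OF kN] u_nonzero
    by (simp add: beta c_def R_def s_def power_divide power_mult[symmetric] mult.commute)
  have prods: "(\<Prod>j\<in>J. - e * x j) = (- e) ^ k * XB * (R ^ s * PS)"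
  proof -
    have "(\<Prod>j\<in>B. - e * x j) = (- e) ^ k * XB"
      unfolding prod.distrib using XB cardB by simp
    moreover have "(\<Prod>j\<in>S. - e * x j) = (\<Prod>j\<in>S. R * (- c * x j))"
      by (rule prod.cong) (auto simp: eR)
    moreover have "(\<Prod>j\<in>S. R * (- c * x j)) = R ^ s * PS"
      unfolding prod.distrib PS_def using ss by simp
    ultimately show ?thesis unfolding prodJ by simp
  qed
  have p0: "(\<Prod>j\<in>S. - x j) / (\<Prod>y\<in>Y. - y) = PS / ((-1) ^ k * XB)"
  proof -
    have "(\<Prod>y\<in>Y. - y) = (\<Prod>j\<in>J. - x j) * (\<Prod>j\<in>S. - z j)"
      unfolding Y_def using fin disj by (simp add: prod.union_disjoint prod.reindex injx injz)
    also have "(\<Prod>j\<in>J. - x j) = (-1) ^ k * XB * (\<Prod>j\<in>S. - x j)"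
    proof -
      have "(\<Prod>j\<in>B. - x j) = (\<Prod>j\<in>B. (-1) * x j)" by simp
      also have "\<dots> = (-1) ^ k * XB" unfolding prod.distrib XB by (simp add: cardB)
      finally show ?thesis unfolding prodJ by simp
    qed
    also have "(\<Prod>j\<in>S. - z j) = 1 / PS"
    proof -
      have "(\<Prod>j\<in>S. - z j) = (\<Prod>j\<in>S. 1 / (- c * x j))"
        by (rule prod.cong) (auto simp: z_def)
      then show ?thesis unfolding PS_def prod_dividef by simp
    qed
    finally have "(\<Prod>y\<in>Y. - y) = (-1) ^ k * XB * (\<Prod>j\<in>S. - x j) * (1 / PS)" .
    moreover have "(\<Prod>j\<in>S. - x j) \<noteq> 0" using fin x0 by simp
    ultimately show ?thesis by simp
  qed
  have part1: "kappa * ((\<Prod>j\<in>J. - e * x j) * R ^ card S) = (-1) ^ k * u ^ k * R / (R - 1)"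
  proof -
    have "kappa * ((\<Prod>j\<in>J. - e * x j) * R ^ card S) = (-1) ^ k * (c ^ k / u ^ k) * (XB ^ 2 * R ^ (k + s + s)) / (R - 1)"
      unfolding kappa_def beta prods ss unfolding eR power_minus[of "c * R"] power_mult_distrib
      using PS0 by (simp add: power_add power2_eq_square)
    also have "k + s + s = Suc (N + s)" using ss by simp
    also have "XB ^ 2 * R ^ Suc (N + s) = R" using XB2 by simp
    also have "c ^ k / u ^ k = u ^ k" using u_nonzero by (simp add: c_def power_mult[symmetric] mult_2 power_add)
    finally show ?thesis .
  qed
  have part2: "kappa * ((\<Prod>j\<in>S. - x j) / (\<Prod>y\<in>Y. - y)) = (-1) ^ k * inverse u ^ k / (R - 1)"
  proof -
    have "(XB / U) / (r * PS) * (PS / (g * XB)) = (1 / g) * (1 / U) / r" if "U \<noteq> 0" "r \<noteq> 0" "g \<noteq> 0" for U r g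
      using that PS0 XB0 by (simp add: field_simps)
    from this[of "u ^ k" "R - 1" "(-1) ^ k"] show ?thesis
      unfolding p0 kappa_def beta using u_nonzero R1 by (cases "even k") (simp_all add: power_inverse field_simps)
  qed
  \<comment> \<open>For k = 2 l + 1 the exponent of \<open>seabot\<close> is k (l - N), so XB is the
    power l - N of R and everything cancels.\<close>
  have part3: "kappa * (u * (R - 1) * e ^ (card B div 2) * R ^ card S * PS) = 1" if odd: "odd k"
  proof -
    obtain l where l: "k = 2 * l + 1" using odd by (elim oddE)
    have "XB * R ^ N = R ^ l"
    proof -
      have "int k * (int k - 1) div 2 = int k * int l" using l by simp
      then have "XB = q powi (int (k * l) - int (k * N))"
        unfolding XB_def seabot_eq by simp
      then show ?thesis unfolding R_def power_mult[symmetric] q_powi_diff power_int_of_nat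
        using q_nonzero by simp
    qed
    then have x: "XB * R ^ (l + s) = 1"
    proof -
      have "N = l + (l + s)" using ss l by simp
      then have "XB * R ^ (l + s) * R ^ l = R ^ l" using \<open>XB * R ^ N = R ^ l\<close>
        by (simp add: power_add mult_ac)
      then show ?thesis using R0 by simp
    qed
    have "kappa * (u * (R - 1) * e ^ (card B div 2) * R ^ card S * PS) = (u * c ^ l / u ^ k) * (XB * R ^ (l + s))"
      unfolding kappa_def beta cardB ss using PS0 R1 l
      by (simp add: eR power_mult_distrib power_add)
    also have "u * c ^ l = u ^ k" by (simp add: c_def l power_mult)
    finally show ?thesis using x u_nonzero by simp
  qed
  have "kappa * (\<Sum>y\<in>Y. tm y) = (-1) ^ k * u ^ k * R / (R - 1) - (-1) ^ k * inverse u ^ k / (R - 1) + (if odd k then 1 else 0)"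
  proof -
    have "kappa * (if odd (card B) then u * (R - 1) * e ^ (card B div 2) * R ^ card S * PS else 0) = (if odd k then 1 else 0)"
    proof (cases "odd k")
      case True
      then have "odd (card B)" using cardB by simp
      then show ?thesis using part3[OF True] True by (simp only: if_True not_False_eq_True)
    qed (simp add: cardB)
    then show ?thesis unfolding res distrib_left right_diff_distrib part1 part2 by (simp only:)
  qed
  also have "\<dots> = eig k"
  proof -
    have "(X - Y) / (R - 1) = (Y - X) / (1 - R)" for X Y
      using minus_divide_divide[of "X - Y" "R - 1"] by simp
    from this[of "(-1) ^ k * u ^ k * R" "(-1) ^ k * inverse u ^ k"] show ?thesis
      unfolding eig_def R_def[symmetric]
      by (simp only: right_diff_distrib diff_divide_distrib mult.assoc)
  qed
  finally show ?thesis unfolding tot by simp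
qed

end


section \<open>The generating function of the weights\<close>

lemma state_sum_cong:
  "(\<And>A. A \<subseteq> {1..n} \<Longrightarrow> w (conf A) = w' (conf A)) \<Longrightarrow> state_sum n w = state_sum n w'"
  unfolding state_sum_def by (auto intro!: sum.cong)

lemma state_sum_add: "state_sum n (\<lambda>p. w p + w' p) = state_sum n w + state_sum n w'"
  unfolding state_sum_def by (simp add: sum.distrib distrib_right flip: fps_const_add)

lemma state_sum_diff: "state_sum n (\<lambda>p. w p - w' p) = state_sum n w - state_sum n w'"
  unfolding state_sum_def by (simp add: sum_subtractf left_diff_distrib flip: fps_const_sub)

lemma state_sum_cmult: "state_sum n (\<lambda>p. c * w p) = fps_const c * state_sum n w"
  unfolding state_sum_def by (simp add: sum_distrib_left mult.assoc flip: fps_const_mult)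

lemma state_sum_sum: "state_sum n (\<lambda>p. \<Sum>k\<in>I. w k p) = (\<Sum>k\<in>I. state_sum n (w k))"
proof (induction I rule: infinite_finite_induct)
  case (insert x F)
  then show ?case by (simp add: state_sum_add)
qed (simp_all add: state_sum_def)

lemma fps_nth_X_deriv: "fps_nth (fps_X * fps_deriv F) j = of_nat j * fps_nth F j"
  for F :: "'a::comm_ring_1 fps"
  by (cases j) auto

lemma inj_on_conf: "inj_on (conf A) I"
proof (rule inj_onI)
  fix i j assume "conf A i = conf A j"
  then have "\<bar>conf A i\<bar> = \<bar>conf A j\<bar>" by simp
  then show "i = j" by simp
qed

text \<open>Multiplication by 1 - X^k takes differences of step k. These turn j / k on the multiples
  of k into the indicator of the positive multiples, and that into X^k.\<close>

lemma fps_nth_geometric_square: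
  fixes k :: nat
  assumes "0 < k"
  shows "fps_nth (fps_X ^ k * inverse (1 - fps_X ^ k) ^ 2) j = (if k dvd j then of_nat (j div k) else (0::'a::field))"
proof -
  define A where "A = Abs_fps (\<lambda>j. if k dvd j then of_nat (j div k) else (0::'a))"
  define B where "B = Abs_fps (\<lambda>j. if k dvd j \<and> j \<noteq> 0 then 1 else (0::'a))"
  have shift: "fps_nth ((1 - fps_X ^ k) * F) j = fps_nth F j - (if j < k then 0 else fps_nth F (j - k))" for F :: "'a fps" and j
    by (simp add: left_diff_distrib fps_X_power_mult_nth)
  have dv: "k dvd j - k \<longleftrightarrow> k dvd j" if "k \<le> j" for j using that by (simp add: dvd_minus_self)
  have "(1 - fps_X ^ k) * A = B"
  proof (rule fps_ext)
    fix j show "fps_nth ((1 - fps_X ^ k) * A) j = fps_nth B j"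
    proof (cases "j < k")
      case True
      then show ?thesis using assms unfolding shift by (auto simp: A_def B_def dest: dvd_imp_le)
    next
      case False
      have "j div k = Suc ((j - k) div k)" using False assms by (simp add: le_div_geq)
      then show ?thesis using False assms unfolding shift by (auto simp: A_def B_def dv)
    qed
  qed
  moreover have "(1 - fps_X ^ k) * B = fps_X ^ k"
  proof (rule fps_ext)
    fix j show "fps_nth ((1 - fps_X ^ k) * B) j = fps_nth (fps_X ^ k) j"
    proof (cases "j < k")
      case True
      then show ?thesis using assms unfolding shift by (auto simp: B_def fps_X_power_iff dest: dvd_imp_le)
    next
      case False
      then show ?thesis using assms unfolding shift by (auto simp: B_def dv fps_X_power_iff)
    qed
  qed
  ultimately have e: "fps_X ^ k = (1 - fps_X ^ k) ^ 2 * A" by (simp add: power2_eq_square mult.assoc)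
  have "inverse (1 - fps_X ^ k) * (1 - fps_X ^ k) = (1 :: 'a fps)"
    using assms by (intro inverse_mult_eq_1) simp
  then have "inverse (1 - fps_X ^ k) ^ 2 * (1 - fps_X ^ k) ^ 2 = (1 :: 'a fps)"
    unfolding power_mult_distrib[symmetric] by simp
  then have "fps_X ^ k * inverse (1 - fps_X ^ k) ^ 2 = A"
    by (subst e) (simp add: mult_ac)
  then show ?thesis by (simp add: A_def)
qed

text \<open>If C k are the coefficients of X g' / g, this is the logarithmic derivative of the
  product of g (X^m) over m >= 1, because the sum of m X^(m k) over m is X^k / (1 - X^k)^2.\<close>

definition log_series :: "(nat \<Rightarrow> 'a::comm_ring_1) \<Rightarrow> 'a fps" where
  "log_series C = Abs_fps (\<lambda>j. \<Sum>k\<in>{k\<in>{1..j}. k dvd j}. C k * of_nat (j div k))"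

lemma fps_cong_log_series:
  fixes C :: "nat \<Rightarrow> 'a::field"
  shows "fps_cong n (\<Sum>k=1..n. fps_const (C k) * (fps_X ^ k * inverse (1 - fps_X ^ k) ^ 2)) (log_series C)"
  unfolding fps_cong_def
proof (intro allI impI)
  fix m assume m: "m \<le> n"
  have "fps_nth (\<Sum>k=1..n. fps_const (C k) * (fps_X ^ k * inverse (1 - fps_X ^ k) ^ 2)) m =
     (\<Sum>k=1..n. C k * (if k dvd m then of_nat (m div k) else 0))"
    unfolding fps_sum_nth by (rule sum.cong) (simp_all add: fps_nth_geometric_square)
  also have "\<dots> = (\<Sum>k\<in>{k\<in>{1..m}. k dvd m}. C k * of_nat (m div k))"
  proof (rule sum.mono_neutral_cong_right)
    show "\<forall>i\<in>{1..n} - {k \<in> {1..m}. k dvd m}. C i * (if i dvd m then of_nat (m div i) else 0) = 0"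
    proof
      fix i assume i: "i \<in> {1..n} - {k \<in> {1..m}. k dvd m}"
      show "C i * (if i dvd m then of_nat (m div i) else 0) = 0"
      proof (cases "i dvd m")
        case True
        then have "m = 0" using i by (auto dest: dvd_imp_le)
        then show ?thesis by simp
      qed simp
    qed
  qed (use m in auto)
  finally show "fps_nth (\<Sum>k=1..n. fps_const (C k) * (fps_X ^ k * inverse (1 - fps_X ^ k) ^ 2)) m = fps_nth (log_series C) m"
    by (simp add: log_series_def)
qed

section \<open>Moves applied to sign choices\<close>

context qparam
begin

abbreviation "low_sum N k w \<equiv> shift_sum N (- int k) w"
abbreviation "up_sum N k w \<equiv> shift_sum N (int k) w"

lemma wt_low_below:
  "i \<le> N \<Longrightarrow> p i < - int N \<Longrightarrow> low_sum N k (wt N) p = 0"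
  unfolding shift_sum_def
proof (rule sum.neutral, rule ballI)
  fix j assume "i \<le> N" "p i < - int N" "j \<in> {..N}"
  then show "wt N (p(j := p j + - int k)) = 0"
    by (intro wt_below[of i]) auto
qed

text \<open>Indices above n always carry a minus sign. For moves by k with n + k <= N this supplies
  the occupied bottom that \<open>wt_shift_eigen\<close> asks for.\<close>

lemma conf_bottom:
  assumes "A \<subseteq> {1..n}" "n + b < N"
  shows "conf A (N - b) = int b - int N"
proof -
  have "N - b \<notin> A"
  proof
    assume "N - b \<in> A"
    then have "N - b \<le> n" using assms(1) by auto
    then show False using assms(2) by linarith
  qed
  then show ?thesis using assms by (simp add: conf_def of_nat_diff)
qed

text \<open>The double move of \<open>energy_identity\<close> with L = -N. The restriction matters:
  a bead pushed below -N could be brought back by the upward move and would contribute.\<close>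

definition hop_sum :: "nat \<Rightarrow> nat \<Rightarrow> (nat \<Rightarrow> int) \<Rightarrow> 'a" where
  "hop_sum N k p = (\<Sum>i\<in>{i\<in>{..N}. - int N \<le> p i - int k}. up_sum N k (wt N) (p(i := p i - int k)))"

lemma hop_sum_eq:
  assumes A: "A \<subseteq> {1..n}" and k: "0 < k" "n + k \<le> N"
  shows "hop_sum N k (conf A) = eig k * low_sum N k (wt N) (conf A) - low_sum N k (low_sum N k (wt N)) (conf A)"
proof -
  define p where "p = conf A"
  have low: "- int N \<le> p i" if "i \<le> N" for i using that by (simp add: p_def conf_def)
  have key: "up_sum N k (wt N) (p(i := p i - int k)) =
      eig k * wt N (p(i := p i - int k)) - low_sum N k (wt N) (p(i := p i - int k))"
    if i: "i \<le> N" "- int N \<le> p i - int k" for i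
  proof (cases "inj_on (p(i := p i - int k)) {..N}")
    case True
    have "up_sum N k (wt N) (p(i := p i - int k)) + low_sum N k (wt N) (p(i := p i - int k)) =
       eig k * wt N (p(i := p i - int k))"
    proof (rule wt_shift_eigen[OF True _ k(1)])
      fix j assume "j \<le> N"
      then show "- int N \<le> (p(i := p i - int k)) j" using low i by simp
    next
      fix b assume b: "b < k"
      then have c: "p (N - b) = int b - int N" using conf_bottom[OF A, of b N] k by (simp add: p_def)
      have "N - b \<noteq> i" using c b i by auto
      then have "(p(i := p i - int k)) (N - b) = int b - int N" using c by simp
      then show "int b - int N \<in> p(i := p i - int k) ` {..N}"
        by (metis atMost_iff diff_le_self image_eqI)
    qed
    then show ?thesis by (simp add: eq_diff_eq)
  next
    case False
    then obtain a b where ab: "a \<le> N" "b \<le> N" "a \<noteq> b" "(p(i := p i - int k)) a = (p(i := p i - int k)) b"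
      unfolding inj_on_def by blast
    have z: "w (p(i := p i - int k)) = 0" if "alternating N w" for w :: "(nat \<Rightarrow> int) \<Rightarrow> 'a"
      by (rule alternating_coincide[OF that ab])
    show ?thesis
      using z[OF alternating_wt] z[OF alternating_shift_sum[OF alternating_wt, where k = "int k"]]
        z[OF alternating_shift_sum[OF alternating_wt, where k = "- int k"]] by simp
  qed
  have "hop_sum N k p = (\<Sum>i\<in>{i\<in>{..N}. - int N \<le> p i - int k}.
      eig k * wt N (p(i := p i - int k)) - low_sum N k (wt N) (p(i := p i - int k)))"
    unfolding hop_sum_def by (rule sum.cong) (use key in auto)
  also have "\<dots> = (\<Sum>i\<le>N. eig k * wt N (p(i := p i - int k)) - low_sum N k (wt N) (p(i := p i - int k)))"
  proof (rule sum.mono_neutral_left)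
    show "\<forall>i\<in>{..N} - {i \<in> {..N}. - int N \<le> p i - int k}.
      eig k * wt N (p(i := p i - int k)) - low_sum N k (wt N) (p(i := p i - int k)) = 0"
    proof
      fix i assume "i \<in> {..N} - {i \<in> {..N}. - int N \<le> p i - int k}"
      then have "i \<le> N" "(p(i := p i - int k)) i < - int N" by auto
      then show "eig k * wt N (p(i := p i - int k)) - low_sum N k (wt N) (p(i := p i - int k)) = 0"
        using wt_below wt_low_below by simp
    qed
  qed auto
  also have "\<dots> = eig k * low_sum N k (wt N) p - low_sum N k (low_sum N k (wt N)) p"
    unfolding shift_sum_def[of N "- int k" "wt N" p] shift_sum_def[of N "- int k" "low_sum N k (wt N)" p]
    by (simp add: sum_subtractf sum_distrib_left)
  finally show ?thesis by (simp add: p_def)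
qed

text \<open>Every bead starts at n or below, so a drop by more than 2 n ends below -n, where all
  positions down to -N are occupied.\<close>

lemma hop_sum_large:
  assumes A: "A \<subseteq> {1..n}" and k: "2 * n < k"
  shows "hop_sum N k (conf A) = 0"
  unfolding hop_sum_def
proof (rule sum.neutral, rule ballI)
  fix i assume "i \<in> {i \<in> {..N}. - int N \<le> conf A i - int k}"
  then have i: "i \<le> N" "- int N \<le> conf A i - int k" by auto
  define j where "j = nat (int k - conf A i)"
  have up: "conf A i \<le> int n" using A by (auto simp: conf_def)
  have j: "j \<le> N" "n < j" using i up k by (auto simp: j_def)
  have "j \<notin> A" using j A by auto
  then have cj: "conf A j = conf A i - int k" using up k by (simp add: conf_def j_def)
  then have "j \<noteq> i" using k by auto
  then show "up_sum N k (wt N) ((conf A)(i := conf A i - int k)) = 0"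
    using i j cj by (intro alternating_coincide[OF alternating_shift_sum[OF alternating_wt], of i N j]) auto
qed

text \<open>Since the ground state -N, ..., 0 is the sign choice of the empty set, the height above
  it is twice the sum of A. The drops beyond 2 n in \<open>energy_identity\<close> contribute
  nothing.\<close>

lemma hop_sum_total:
  assumes A: "A \<subseteq> {1..n}" and n: "n \<le> N"
  shows "(\<Sum>k=1..2*n. hop_sum N k (conf A)) = of_nat (2 * \<Sum>A) * wt N (conf A)"
proof -
  have AN: "A \<subseteq> {1..N}" using A n by auto
  have "(\<Sum>k=1..2*n. hop_sum N k (conf A)) = (\<Sum>k=1..2*N. hop_sum N k (conf A))"
  proof (rule sum.mono_neutral_left)
    show "\<forall>i\<in>{1..2 * N} - {1..2 * n}. hop_sum N i (conf A) = 0"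
      using hop_sum_large[OF A] by auto
  qed (use n in auto)
  also have "\<dots> = (of_int (\<Sum>i\<le>N. conf A i - (- int N)) - of_nat (\<Sum>i\<le>N. i)) * wt N (conf A)"
    unfolding hop_sum_def
    by (rule energy_identity[OF alternating_wt]) (auto simp: conf_def)
  also have "(of_int (\<Sum>i\<le>N. conf A i - (- int N)) - of_nat (\<Sum>i\<le>N. i) :: 'a) = of_int ((\<Sum>i\<le>N. conf A i - (- int N)) - int (\<Sum>i\<le>N. i))"
    by simp
  also have "(\<Sum>i\<le>N. conf A i - (- int N)) - int (\<Sum>i\<le>N. i) = 2 * int (\<Sum>A)"
  proof -
    have "2 * int (\<Sum>i\<le>N. i) = int N * (int N + 1)"
      by (induction N) (auto simp: algebra_simps)
    moreover have "(\<Sum>i\<le>N. conf A i - (- int N)) = (\<Sum>i\<le>N. conf A i) + int N * (int N + 1)"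
      by (simp add: sum.distrib algebra_simps)
    moreover have "(\<Sum>i\<le>N. conf A i) + int (\<Sum>i\<le>N. i) = 2 * int (\<Sum>A)"
      unfolding sum_eq_conf[OF AN] by (simp add: sum.distrib)
    ultimately show ?thesis by linarith
  qed
  finally show ?thesis by simp
qed

text \<open>The two moves commute, so the difference to \<open>hop_sum\<close> consists of the terms
  in which a bead falls below -N. Such a term survives only if the same bead is brought back; the k
  beads with indices above N - k are concerned.\<close>

lemma up_low_sum:
  assumes A: "A \<subseteq> {1..n}" and k: "n + k \<le> N"
  shows "up_sum N k (low_sum N k (wt N)) (conf A) = hop_sum N k (conf A) + of_nat k * wt N (conf A)"
proof -
  define p where "p = conf A"
  define W where "W = {i\<in>{..N}. - int N \<le> p i - int k}"
  define g where "g i j = wt N (p(j := p j - int k, i := (p(j := p j - int k)) i + int k))" for i j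
  have "up_sum N k (low_sum N k (wt N)) p = (\<Sum>i\<le>N. \<Sum>j\<le>N. g i j)"
    unfolding shift_sum_def
  proof (intro sum.cong refl)
    fix i j
    have "(p(i := p i + int k))(j := (p(i := p i + int k)) j + - int k) = p(j := p j - int k, i := (p(j := p j - int k)) i + int k)"
      by (cases "i = j") auto
    then show "wt N ((p(i := p i + int k))(j := (p(i := p i + int k)) j + - int k)) = g i j"
      by (simp add: g_def)
  qed
  also have "\<dots> = (\<Sum>j\<le>N. \<Sum>i\<le>N. g i j)" by (rule sum.swap)
  also have "\<dots> = (\<Sum>j\<in>W. \<Sum>i\<le>N. g i j) + (\<Sum>j\<in>{..N}-W. \<Sum>i\<le>N. g i j)"
  proof -
    have "W \<subseteq> {..N}" by (auto simp: W_def)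
    then show ?thesis using sum.subset_diff[of W "{..N}" "\<lambda>j. \<Sum>i\<le>N. g i j"] by (simp add: add.commute)
  qed
  also have "(\<Sum>j\<in>W. \<Sum>i\<le>N. g i j) = hop_sum N k p"
    unfolding hop_sum_def shift_sum_def g_def W_def ..
  also have "(\<Sum>j\<in>{..N}-W. \<Sum>i\<le>N. g i j) = (\<Sum>j\<in>{..N}-W. wt N p)"
  proof (rule sum.cong[OF refl])
    fix j assume j: "j \<in> {..N} - W"
    have "(\<Sum>i\<le>N. g i j) = (\<Sum>i\<le>N. if i = j then wt N p else 0)"
    proof (rule sum.cong[OF refl])
      fix i
      show "g i j = (if i = j then wt N p else 0)"
        unfolding g_def using j by (auto simp: W_def intro!: wt_below[of j])
    qed
    then show "(\<Sum>i\<le>N. g i j) = wt N p" using j by simp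
  qed
  also have "{..N} - W = {N - k<..N}"
    using A k by (auto simp: W_def p_def conf_def split: if_splits)
  finally show ?thesis using k by (simp add: p_def)
qed

text \<open>The square stems from using the reflection twice, \<open>eig (2 * k)\<close> from the
  power X^k that a move of even length 2 k contributes to the reflection, and the 1 from the beads
  that fall below the bottom.\<close>

definition log_coeff :: "nat \<Rightarrow> 'a" where
  "log_coeff k = (eig (2 * k) + 1 - (eig k + (if even k then 1 else 0))^2) / 2"

text \<open>By \<open>hop_sum_total\<close> and \<open>hop_sum_eq\<close>, twice the left-hand side
  is the sum over k of eig k times the sum of D w, minus the sum of D (D w). The reflection
  expresses both through the sum of w. With N = 3 n the k lowest positions are occupied for all k up
  to 2 n, the only ones that contribute.\<close>

lemma state_sum_log_derivative:
  assumes N: "N = 3 * n"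
  shows "fps_cong n (fps_X * fps_deriv (state_sum n (wt N))) (log_series log_coeff * state_sum n (wt N))"
proof -
  define f where "f = state_sum n (wt N)"
  define b where "b k = (if even k then fps_X ^ (k div 2) else 0 :: 'a fps)" for k :: nat
  define e where "e k = fps_const (eig k)" for k
  define Z where "Z k = (fps_X ^ k :: 'a fps)" for k :: nat
  define iv where "iv k = inverse (1 - fps_X ^ k :: 'a fps)" for k :: nat
  define xi where "xi k = ((e k - b k) * (b k - Z k * e k) + of_nat k * Z k * (1 - Z k)) * (iv k)^2" for k
  have iv: "iv k * (1 - Z k) = 1" if "0 < k" for k
    unfolding iv_def Z_def using that by (intro inverse_mult_eq_1) simp
  have step: "fps_cong n (e k * state_sum n (low_sum N k (wt N)) - state_sum n (low_sum N k (low_sum N k (wt N)))) (xi k * f)"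
    if k: "k \<in> {1..2*n}" for k
  proof -
    have k0: "0 < k" and kN: "n + k \<le> N" using k N by auto
    define G where "G = state_sum n (low_sum N k (wt N))"
    define H where "H = state_sum n (low_sum N k (low_sum N k (wt N)))"
    have U: "state_sum n (up_sum N k (wt N)) = e k * f - G"
    proof -
      have "state_sum n (up_sum N k (wt N)) = state_sum n (\<lambda>p. eig k * wt N p - low_sum N k (wt N) p)"
      proof (rule state_sum_cong)
        fix A :: "nat set" assume A: "A \<subseteq> {1..n}"
        have "up_sum N k (wt N) (conf A) + low_sum N k (wt N) (conf A) = eig k * wt N (conf A)"
        proof (rule wt_shift_eigen[OF inj_on_conf _ k0])
          fix i assume "i \<le> N" then show "- int N \<le> conf A i" by (simp add: conf_def)
        next
          fix b assume "b < k"
          then have "conf A (N - b) = int b - int N" using kN by (intro conf_bottom[OF A]) auto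
          then show "int b - int N \<in> conf A ` {..N}" by (metis atMost_iff diff_le_self image_eqI)
        qed
        then show "up_sum N k (wt N) (conf A) = eig k * wt N (conf A) - low_sum N k (wt N) (conf A)"
          by (simp add: eq_diff_eq)
      qed
      then show ?thesis by (simp add: state_sum_diff state_sum_cmult e_def f_def G_def)
    qed
    have UD: "state_sum n (up_sum N k (low_sum N k (wt N))) = e k * G - H + of_nat k * f"
    proof -
      have "state_sum n (up_sum N k (low_sum N k (wt N))) =
        state_sum n (\<lambda>p. (eig k * low_sum N k (wt N) p - low_sum N k (low_sum N k (wt N)) p) + of_nat k * wt N p)"
        by (rule state_sum_cong) (use up_low_sum hop_sum_eq k0 kN in auto)
      then show ?thesis
        unfolding state_sum_add state_sum_diff state_sum_cmult
        by (simp add: e_def f_def G_def H_def fps_of_nat)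
    qed
    \<comment> \<open>Reflection for w determines G from f; reflection for D w, in
      \<open>c2\<close>, then determines H from G and f.\<close>
    have c1: "fps_cong n (G + Z k * (e k * f - G)) (b k * f)"
      using boundary_reflection[OF alternating_wt[of N] wt_below _ k0, where n = n] N
      unfolding U by (simp add: f_def G_def b_def Z_def)
    have c2: "fps_cong n (H + Z k * (e k * G - H + of_nat k * f)) (b k * G)"
      using boundary_reflection[OF alternating_shift_sum[OF alternating_wt[of N], where k = "- int k"] wt_low_below[where k = k] _ k0, where n = n] N
      unfolding UD by (simp add: G_def H_def b_def Z_def)
    have d1: "fps_cong n ((1 - Z k) * G) ((b k - Z k * e k) * f)"
      using fps_cong_diff[OF c1 fps_cong_refl[of n "Z k * e k * f"]] by (simp add: algebra_simps)
    have d2: "fps_cong n ((1 - Z k) * H) ((b k - Z k * e k) * G - of_nat k * Z k * f)"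
      using fps_cong_diff[OF c2 fps_cong_refl[of n "Z k * (e k * G + of_nat k * f)"]] by (simp add: algebra_simps)
    have d3: "fps_cong n ((1 - Z k) * (e k * G - H)) ((e k - b k) * G + of_nat k * Z k * f)"
      using fps_cong_diff[OF fps_cong_refl[of n "(1 - Z k) * e k * G"] d2] by (simp add: algebra_simps)
    have d4: "fps_cong n ((1 - Z k) * ((e k - b k) * G + of_nat k * Z k * f))
       (((e k - b k) * (b k - Z k * e k) + of_nat k * Z k * (1 - Z k)) * f)"
      using fps_cong_add[OF fps_cong_mult[OF fps_cong_refl[of n "e k - b k"] d1] fps_cong_refl[of n "(1 - Z k) * of_nat k * Z k * f"]]
      by (simp add: algebra_simps)
    have "fps_cong n ((iv k)^2 * ((1 - Z k) * ((1 - Z k) * (e k * G - H)))) (xi k * f)"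
      using fps_cong_mult[OF fps_cong_refl[of n "(iv k)^2"] fps_cong_trans[OF fps_cong_mult[OF fps_cong_refl[of n "1 - Z k"] d3] d4]]
      by (simp add: xi_def mult_ac)
    also have "(iv k)^2 * ((1 - Z k) * ((1 - Z k) * (e k * G - H))) = (iv k * (1 - Z k)) * ((iv k * (1 - Z k)) * (e k * G - H))"
      by (simp only: power2_eq_square mult_ac)
    finally show ?thesis using iv[OF k0] by (simp add: G_def H_def)
  qed
  have "of_nat 2 * (fps_X * fps_deriv f) = state_sum n (\<lambda>p. \<Sum>k=1..2*n. hop_sum N k p)"
  proof -
    have "fps_deriv (\<Sum>i\<in>I. F i) = (\<Sum>i\<in>I. fps_deriv (F i))" for I and F :: "nat set \<Rightarrow> 'a fps"
      by (induction I rule: infinite_finite_induct) auto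
    moreover have "fps_X * fps_deriv (fps_const c * fps_X ^ m) = of_nat m * (fps_const c * fps_X ^ m)" for c :: 'a and m
      by (rule fps_ext) (simp add: fps_nth_X_deriv fps_X_power_iff flip: fps_of_nat)
    ultimately have "of_nat 2 * (fps_X * fps_deriv f) =
       (\<Sum>A\<in>Pow {1..n}. of_nat 2 * (of_nat (\<Sum>A) * (fps_const (wt N (conf A)) * fps_X ^ (\<Sum>A))))"
      unfolding f_def state_sum_def by (simp only: sum_distrib_left)
    also have "\<dots> = state_sum n (\<lambda>p. \<Sum>k=1..2*n. hop_sum N k p)"
      unfolding state_sum_def
    proof (rule sum.cong[OF refl])
      fix A assume "A \<in> Pow {1..n}"
      then have "(\<Sum>k=1..2*n. hop_sum N k (conf A)) = of_nat (2 * \<Sum>A) * wt N (conf A)"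
        using N by (intro hop_sum_total[of A n]) auto
      then show "of_nat 2 * (of_nat (\<Sum>A) * (fps_const (wt N (conf A)) * fps_X ^ (\<Sum>A))) =
         fps_const (\<Sum>k=1..2*n. hop_sum N k (conf A)) * fps_X ^ (\<Sum>A)"
        by (simp only: fps_const_mult[symmetric] fps_of_nat of_nat_mult mult_ac)
    qed
    finally show ?thesis .
  qed
  also have "\<dots> = (\<Sum>k=1..2*n. e k * state_sum n (low_sum N k (wt N)) - state_sum n (low_sum N k (low_sum N k (wt N))))"
    unfolding state_sum_sum
  proof (rule sum.cong[OF refl])
    fix k assume k: "k \<in> {1..2*n}"
    have "state_sum n (hop_sum N k) = state_sum n (\<lambda>p. eig k * low_sum N k (wt N) p - low_sum N k (low_sum N k (wt N)) p)"
      by (rule state_sum_cong) (use hop_sum_eq k N in auto)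
    then show "state_sum n (hop_sum N k) = e k * state_sum n (low_sum N k (wt N)) - state_sum n (low_sum N k (low_sum N k (wt N)))"
      by (simp add: state_sum_diff state_sum_cmult e_def)
  qed
  finally have "fps_cong n (of_nat 2 * (fps_X * fps_deriv f)) ((\<Sum>k=1..2*n. xi k) * f)"
    unfolding sum_distrib_right using fps_cong_sum[of "{1..2*n}" n, OF step] by simp
  moreover have "fps_cong n (\<Sum>k=1..2*n. xi k) (of_nat 2 * log_series log_coeff)"
  proof -
    define d where "d k = fps_const (if even k then 1 else 0 :: 'a)" for k :: nat
    define g where "g k = Z k * (iv k)^2" for k
    have small: "fps_cong n (c * g k) 0" if "n < k" for c k
    proof -
      have "fps_cong n (c * (iv k)^2 * (fps_const 1 * fps_X ^ k)) (c * (iv k)^2 * 0)"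
        by (intro fps_cong_mult fps_cong_refl fps_cong_power_0 that)
      then show ?thesis by (simp add: g_def Z_def mult_ac)
    qed
    \<comment> \<open>For k = 2 l one has b k = X^l, with square X^k. The cross term is brought to
      the common shape by X^l (1 + X^k) = X^l (1 + X^l)^2 - 2 X^k.\<close>
    have xi: "xi k = - ((e k)^2 + d k) * g k + of_nat k * (Z k * iv k)
        + (if even k then e k * (g (k div 2) - 2 * g k) else 0)" if "0 < k" for k
    proof (cases "even k")
      case False
      have "Z k * (1 - Z k) * (iv k)^2 = Z k * iv k * (iv k * (1 - Z k))" by (simp add: power2_eq_square mult_ac)
      then have z: "Z k * (1 - Z k) * (iv k)^2 = Z k * iv k" using iv[OF that] by simp
      have "xi k = - ((e k)^2) * (Z k * (iv k)^2) + of_nat k * (Z k * (1 - Z k) * (iv k)^2)"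
        using False by (simp add: xi_def b_def power2_eq_square algebra_simps)
      then show ?thesis unfolding z using False by (simp add: g_def d_def)
    next
      case True
      then obtain l where l: "k = 2 * l" by auto
      then have l0: "0 < l" using that by simp
      have "Z k * (1 - Z k) * (iv k)^2 = Z k * iv k * (iv k * (1 - Z k))" by (simp add: power2_eq_square mult_ac)
      then have z: "Z k * (1 - Z k) * (iv k)^2 = Z k * iv k" using iv[OF that] by simp
      have Zl: "Z k = Z l * Z l" by (simp add: Z_def l mult_2 power_add)
      have bl: "b k = Z l" by (simp add: b_def Z_def l)
      have ivl: "iv l = iv k * (1 + Z l)"
      proof -
        have "iv k * (1 + Z l) = iv k * (1 + Z l) * (iv l * (1 - Z l))" using iv[OF l0] by simp
        also have "\<dots> = iv l * (iv k * (1 - Z k))" unfolding Zl by (simp add: algebra_simps)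
        finally show ?thesis using iv[OF that] by simp
      qed
      have gl: "g l = Z l * (1 + Z l)^2 * (iv k)^2"
        unfolding g_def ivl by (simp add: power_mult_distrib mult_ac)
      have "xi k = - ((e k)^2 + 1) * (Z k * (iv k)^2) + of_nat k * (Z k * (1 - Z k) * (iv k)^2) + e k * (Z l * (1 + Z l)^2 * (iv k)^2 - 2 * (Z k * (iv k)^2))"
        unfolding xi_def bl Zl by (simp add: power2_eq_square algebra_simps)
      then show ?thesis unfolding z gl[symmetric] using True l by (simp add: g_def d_def)
    qed
    have "(\<Sum>k=1..2*n. xi k) = (\<Sum>k=1..2*n. - ((e k)^2 + d k) * g k + of_nat k * (Z k * iv k) - 2 * d k * e k * g k)
       + (\<Sum>k=1..2*n. if even k then e k * g (k div 2) else 0)"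
      unfolding sum.distrib[symmetric]
      by (rule sum.cong) (auto simp: xi d_def algebra_simps)
    also have "(\<Sum>k=1..2*n. if even k then e k * g (k div 2) else 0) = (\<Sum>l=1..n. e (2 * l) * g l)"
    proof -
      have "(\<Sum>k=1..2*n. if even k then e k * g (k div 2) else 0) = (\<Sum>k\<in>{k\<in>{1..2*n}. even k}. e k * g (k div 2))"
        by (rule sum.inter_filter[symmetric]) simp
      also have "\<dots> = (\<Sum>l=1..n. e (2 * l) * g l)"
        by (rule sum.reindex_bij_witness[where i = "\<lambda>l. 2 * l" and j = "\<lambda>k. k div 2"]) auto
      finally show ?thesis .
    qed
    finally have s1: "(\<Sum>k=1..2*n. xi k) = (\<Sum>k=1..2*n. - ((e k)^2 + d k) * g k + of_nat k * (Z k * iv k) - 2 * d k * e k * g k) + (\<Sum>l=1..n. e (2 * l) * g l)" .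
    \<comment> \<open>The moves with k above n are felt modulo X^(n+1) only through the terms in
      \<open>g (k div 2)\<close>, which have been split off already.\<close>
    have "fps_cong n (\<Sum>k=1..2*n. - ((e k)^2 + d k) * g k + of_nat k * (Z k * iv k) - 2 * d k * e k * g k)
        (\<Sum>k=1..n. - ((e k)^2 + d k) * g k + of_nat k * (Z k * iv k) - 2 * d k * e k * g k)"
    proof (rule sum_fps_cong_subset)
      fix k assume "k \<in> {1..2*n} - {1..n}"
      then have nk: "n < k" "0 < k" by auto
      have "Z k * iv k = (1 - Z k) * g k" 
      proof -
        have "(1 - Z k) * g k = Z k * iv k * (iv k * (1 - Z k))" by (simp add: g_def power2_eq_square mult_ac)
        then show ?thesis using iv[OF nk(2)] by simp
      qed
      then have "- ((e k)^2 + d k) * g k + of_nat k * (Z k * iv k) - 2 * d k * e k * g k =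
         (- ((e k)^2 + d k) + of_nat k * (1 - Z k) - 2 * d k * e k) * g k"
        by (simp only:) (simp add: algebra_simps)
      then show "fps_cong n (- ((e k)^2 + d k) * g k + of_nat k * (Z k * iv k) - 2 * d k * e k * g k) 0"
        using small[OF nk(1)] by simp
    qed auto
    then have "fps_cong n (\<Sum>k=1..2*n. xi k) ((\<Sum>k=1..n. - ((e k)^2 + d k) * g k + of_nat k * (Z k * iv k) - 2 * d k * e k * g k) + (\<Sum>l=1..n. e (2 * l) * g l))"
      unfolding s1 by (intro fps_cong_add fps_cong_refl)
    also have "\<dots> = (\<Sum>k=1..n. (e (2 * k) - (e k)^2 - d k - 2 * d k * e k) * g k) + (\<Sum>k=1..n. of_nat k * (Z k * iv k))"
      by (simp add: sum.distrib[symmetric] algebra_simps)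
    finally have s2: "fps_cong n (\<Sum>k=1..2*n. xi k)
       ((\<Sum>k=1..n. (e (2 * k) - (e k)^2 - d k - 2 * d k * e k) * g k) + (\<Sum>k=1..n. of_nat k * (Z k * iv k)))" .
    \<comment> \<open>Both sides generate the divisor sums: on the left as the sum of the divisors k
      of m, on the right as the sum of the complementary divisors.\<close>
    have s3: "fps_cong n (\<Sum>k=1..n. of_nat k * (Z k * iv k)) (\<Sum>k=1..n. g k)"
      unfolding fps_cong_def
    proof (intro allI impI)
      fix m assume m: "m \<le> n"
      have dm: "Suc 0 \<le> x \<and> x \<le> n" if "x dvd m" "0 < m" for x
        using that m by (meson Suc_leI dvd_imp_le dvd_pos_nat order_trans)
      have zi: "fps_nth (Z k * iv k) m = (if k dvd m \<and> m \<noteq> 0 then 1 else 0)" if k: "0 < k" for k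
      proof -
        have "(1 - Z k) * g k = Z k * iv k * (iv k * (1 - Z k))" by (simp add: g_def power2_eq_square mult_ac)
        then have "Z k * iv k = (1 - Z k) * g k" using iv[OF k] by simp
        then have "fps_nth (Z k * iv k) m = fps_nth (g k) m - (if m < k then 0 else fps_nth (g k) (m - k))"
          by (simp add: left_diff_distrib Z_def fps_X_power_mult_nth)
        moreover have "fps_nth (g k) j = (if k dvd j then of_nat (j div k) else 0)" for j
          unfolding g_def Z_def iv_def by (rule fps_nth_geometric_square[OF k])
        moreover have "m div k = Suc ((m - k) div k)" if "k \<le> m" using that k by (simp add: le_div_geq)
        ultimately show ?thesis using k by (auto simp: dvd_minus_self dest: dvd_imp_le)
      qed
      have "fps_nth (\<Sum>k=1..n. of_nat k * (Z k * iv k)) m = (\<Sum>k=1..n. of_nat k * (if k dvd m \<and> m \<noteq> 0 then 1 else 0))"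
        unfolding fps_sum_nth
      proof (rule sum.cong[OF refl])
        fix k assume "k \<in> {1..n}"
        then have "0 < k" by simp
        have "fps_nth (of_nat k * (Z k * iv k)) m = of_nat k * fps_nth (Z k * iv k) m"
          by (simp flip: fps_of_nat)
        then show "fps_nth (of_nat k * (Z k * iv k)) m = of_nat k * (if k dvd m \<and> m \<noteq> 0 then 1 else 0)"
          unfolding zi[OF \<open>0 < k\<close>] .
      qed
      also have "\<dots> = (\<Sum>k\<in>{k. k dvd m \<and> m \<noteq> 0}. of_nat k)"
        by (rule sum.mono_neutral_cong_right) (use dm in auto)
      also have "\<dots> = (\<Sum>k\<in>{k. k dvd m \<and> m \<noteq> 0}. of_nat (m div k))"
        by (rule sum.reindex_bij_witness[where i = "\<lambda>k. m div k" and j = "\<lambda>k. m div k"])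
           (auto simp: dvd_div_eq_mult div_dvd_iff_mult elim!: dvdE)
      also have "\<dots> = (\<Sum>k=1..n. if k dvd m then of_nat (m div k) else 0)"
        by (rule sum.mono_neutral_cong_left) (use dm in \<open>auto intro!: Nat.gr0I\<close>)
      also have "\<dots> = fps_nth (\<Sum>k=1..n. g k) m"
        unfolding fps_sum_nth g_def Z_def iv_def
        by (rule sum.cong) (simp_all add: fps_nth_geometric_square)
      finally show "fps_nth (\<Sum>k=1..n. of_nat k * (Z k * iv k)) m = fps_nth (\<Sum>k=1..n. g k) m" .
    qed
    have "fps_cong n (\<Sum>k=1..2*n. xi k) ((\<Sum>k=1..n. (e (2 * k) - (e k)^2 - d k - 2 * d k * e k) * g k) + (\<Sum>k=1..n. g k))"
      by (rule fps_cong_trans[OF s2]) (intro fps_cong_add fps_cong_refl s3)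
    also have "\<dots> = (\<Sum>k=1..n. of_nat 2 * (fps_const (log_coeff k) * g k))"
      unfolding sum.distrib[symmetric]
    proof (rule sum.cong[OF refl])
      fix k
      have "of_nat 2 * fps_const (log_coeff k) = fps_const (2 * log_coeff k)"
        by (simp only: fps_of_nat[symmetric] fps_const_mult) simp
      also have "2 * log_coeff k = eig (2 * k) + 1 - (eig k + (if even k then 1 else 0))^2"
        by (simp add: log_coeff_def)
      also have "fps_const \<dots> = e (2 * k) + 1 - (e k + d k)^2"
        by (simp add: e_def d_def flip: fps_const_add fps_const_sub fps_const_power)
      also have "\<dots> = e (2 * k) - (e k)^2 - d k - 2 * d k * e k + 1"
      proof -
        have "d k * d k = d k" by (simp add: d_def)
        then show ?thesis by (simp add: power2_eq_square algebra_simps)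
      qed
      finally have eq: "of_nat 2 * fps_const (log_coeff k) = e (2 * k) - (e k)^2 - d k - 2 * d k * e k + 1" .
      show "(e (2 * k) - (e k)^2 - d k - 2 * d k * e k) * g k + g k = of_nat 2 * (fps_const (log_coeff k) * g k)"
        unfolding mult.assoc[symmetric] eq by (simp only: distrib_right mult_1)
    qed
    also have "\<dots> = of_nat 2 * (\<Sum>k=1..n. fps_const (log_coeff k) * g k)"
      by (simp only: sum_distrib_left)
    finally show ?thesis
      using fps_cong_mult[OF fps_cong_refl[of n "of_nat 2"] fps_cong_log_series[of n log_coeff]]
      unfolding g_def Z_def iv_def by (rule fps_cong_trans)
  qed
  then have "fps_cong n ((\<Sum>k=1..2*n. xi k) * f) (of_nat 2 * log_series log_coeff * f)"
    by (intro fps_cong_mult fps_cong_refl)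
  ultimately have "fps_cong n (of_nat 2 * (fps_X * fps_deriv f)) (of_nat 2 * log_series log_coeff * f)"
    by (rule fps_cong_trans)
  from fps_cong_mult[OF fps_cong_refl[of n "fps_const (1/2)"] this]
  have "fps_cong n (fps_const (1/2) * of_nat 2 * (fps_X * fps_deriv f)) (fps_const (1/2) * of_nat 2 * (log_series log_coeff * f))"
    by (simp only: mult.assoc)
  moreover have "fps_const (1/2) * of_nat 2 = (1 :: 'a fps)"
    by (simp only: fps_of_nat[symmetric] fps_const_mult) simp
  ultimately show ?thesis unfolding f_def by (simp only: mult_1)
qed

end


section \<open>Weights in terms of strict partitions\<close>

lemma prod_split:
  "A = B \<union> C \<Longrightarrow> B \<inter> C = {} \<Longrightarrow> finite B \<Longrightarrow> finite C \<Longrightarrow> prod f A = prod f B * prod f C"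
  by (simp add: prod.union_disjoint)

context qparam
begin

text \<open>\<open>gu\<close> is the hook factor of a box on or above the diagonal,
  \<open>gd\<close> that of a box below it.\<close>

definition gu :: "nat \<Rightarrow> 'a" where "gu h = (1 - q ^ h / u^2) / (1 - q ^ h)"
definition gd :: "nat \<Rightarrow> 'a" where "gd h = (1 - u^2 * q ^ h) / (1 - q ^ h)"

text \<open>The value of \<open>strict_weight\<close> on the singleton of m.\<close>

definition vac :: "nat \<Rightarrow> 'a" where
  "vac m = (1 + u * q ^ m) / (u + q ^ m) * gu (2 * m) * (\<Prod>t\<in>{1..<m}. gu (m - t)) * (\<Prod>t<m. gd (m - t))"

text \<open>The weight of the partition with half diagonal hooks A, box by box: the hook 2 m on the
  diagonal, the hooks m + m' in the rest of the Durfee square, the hooks m - t outside it. The value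
  t = 0 occurs only below the diagonal. The prefactor u^(-d) is absorbed into the denominators u +
  q^m.\<close>

definition strict_weight :: "nat set \<Rightarrow> 'a" where
  "strict_weight A = (\<Prod>m\<in>A. (1 + u * q ^ m) / (u + q ^ m) * gu (2 * m) * (\<Prod>t\<in>{1..<m}-A. gu (m - t))
      * (\<Prod>t\<in>{..<m}-A. gd (m - t)) * (\<Prod>m'\<in>{m'\<in>A. m' < m}. gu (m + m') * gd (m + m')))"

lemma one_minus_uq: "1 - u^2 * q powi i \<noteq> 0"
  using uq_power[of i] by simp

lemma one_minus_qu: "1 - q powi i / u^2 \<noteq> 0"
proof
  assume "1 - q powi i / u^2 = 0"
  then have "u^2 = q powi i" using u_nonzero by (simp add: field_simps)
  then have "u^2 * q powi (- i) = 1" by (simp only: q_powi_add[symmetric]) simp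
  then show False using uq_power by blast
qed

lemma gu_nonzero: "0 < h \<Longrightarrow> gu h \<noteq> 0"
  using one_minus_qu[of "int h"] q_power[of h] by (simp add: gu_def)

lemma gd_nonzero: "0 < h \<Longrightarrow> gd h \<noteq> 0"
  using one_minus_uq[of "int h"] q_power[of h] by (simp add: gd_def)

text \<open>Numerators and denominators run through the same exponents N - m + 1, ..., N + m, the
  numerators in reverse order.\<close>

lemma sea_ratio:
  assumes "m \<le> N"
  shows "sea N (N + m) = sea N (N - m) * (\<Prod>a\<in>{N-m+1..N+m}. gu a)"
proof -
  define f where "f i = (1 - q powi (2 * int N - int i) / u^2) / (1 - q ^ Suc i)" for i
  have "sea N (N + m) = sea N (N - m) * (\<Prod>i\<in>{N - m..<N + m}. f i)"
    unfolding sea_def f_def by (rule prod_split) (use assms in auto)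
  also have "(\<Prod>i\<in>{N - m..<N + m}. f i) =
     (\<Prod>i\<in>{N - m..<N + m}. 1 - q powi (2 * int N - int i) / u^2) / (\<Prod>i\<in>{N - m..<N + m}. 1 - q ^ Suc i)"
    unfolding f_def by (rule prod_dividef)
  also have "(\<Prod>i\<in>{N - m..<N + m}. 1 - q powi (2 * int N - int i) / u^2) = (\<Prod>a\<in>{N-m+1..N+m}. 1 - q ^ a / u^2)"
  proof (rule prod.reindex_bij_witness[where i = "\<lambda>a. 2 * N - a" and j = "\<lambda>i. 2 * N - i"])
    fix i assume "i \<in> {N - m..<N + m}"
    then have "2 * int N - int i = int (2 * N - i)" using assms by auto
    then show "1 - q ^ (2 * N - i) / u^2 = 1 - q powi (2 * int N - int i) / u^2"
      by (simp only: power_int_of_nat)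
  qed (use assms in auto)
  also have "(\<Prod>i\<in>{N - m..<N + m}. 1 - q ^ Suc i) = (\<Prod>a\<in>{N-m+1..N+m}. 1 - q ^ a)"
    by (rule prod.reindex_bij_witness[where i = "\<lambda>a. a - 1" and j = Suc]) (use assms in auto)
  finally show ?thesis unfolding gu_def prod_dividef .
qed

text \<open>Says how the factor between m and an unflipped bead -j reacts to the sign change of m.
  The monomials, collected over all j here and in \<open>kap_flip_above\<close>, cancel against
  those of \<open>bead\<close>.\<close>

lemma kap_flip_below:
  assumes "j < m"
  shows "kap (int m) (- int j) / kap (- int m) (- int j) = q ^ (2 * m) / u^2 * (gd (m - j) / gu (m + j))"
proof -
  have nz: "1 - q ^ (m - j) \<noteq> 0" "1 - q ^ (m + j) \<noteq> 0"
    using q_power[of "m - j"] q_power[of "m + j"] assms by auto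
  have nz2: "1 - q ^ (m + j) / u^2 \<noteq> 0" using one_minus_qu[of "int (m + j)"] by (simp only: power_int_of_nat) simp
  have a: "kap (int m) (- int j) = - (1 - q ^ (m + j)) / q ^ j * (1 - u^2 * q ^ (m - j))"
  proof -
    have "int m + - int j = int (m - j)" using assms by simp
    then show ?thesis unfolding kap_def
      using q_nonzero by (simp only: power_int_of_nat) (simp add: power_int_minus power_add field_simps)
  qed
  have b: "kap (- int m) (- int j) = (1 - q ^ (m - j)) / q ^ m * (- (u^2) / q ^ (m + j)) * (1 - q ^ (m + j) / u^2)"
  proof -
    have "- int m + - int j = - int (m + j)" by simp
    moreover have "q ^ m = q ^ (m - j) * q ^ j" using assms by (simp flip: power_add)
    ultimately show ?thesis unfolding kap_def
      using q_nonzero u_nonzero by (simp only: power_int_minus power_int_of_nat) (simp add: power_add field_simps)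
  qed
  have alg: "- B / J * P / (A / M * (- c / (M * J)) * W) = M * M / c * (P / A / (W / B))"
    if "A \<noteq> 0" "B \<noteq> 0" "W \<noteq> 0" "c \<noteq> 0" "M \<noteq> 0" "J \<noteq> 0" for A B W c M J P :: 'a
    using that by (simp add: field_simps)
  show ?thesis unfolding a b gu_def gd_def mult_2 power_add[of q m m] power_add[of q m j]
    by (rule alg) (use nz nz2 q_nonzero u_nonzero in \<open>auto simp: power_add\<close>)
qed

lemma kap_flip_above:
  assumes "m < j"
  shows "kap (int m) (- int j) / kap (- int m) (- int j) = q ^ (2 * m) * (gu (j - m) / gu (j + m))"
proof -
  have nz: "1 - q ^ (j - m) \<noteq> 0" "1 - q ^ (j + m) \<noteq> 0"
    using q_power[of "j - m"] q_power[of "j + m"] assms by auto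
  have nz2: "1 - q ^ (j + m) / u^2 \<noteq> 0" using one_minus_qu[of "int (j + m)"] by (simp only: power_int_of_nat) simp
  have qq: "q ^ j = q ^ (j - m) * q ^ m" using assms by (simp flip: power_add)
  have a: "kap (int m) (- int j) = - (1 - q ^ (j + m)) / q ^ j * (- (u^2) / q ^ (j - m)) * (1 - q ^ (j - m) / u^2)"
  proof -
    have "int m + - int j = - int (j - m)" using assms by simp
    then show ?thesis unfolding kap_def
      using q_nonzero u_nonzero by (simp only: power_int_minus power_int_of_nat) (simp add: power_add field_simps)
  qed
  have b: "kap (- int m) (- int j) = - (1 - q ^ (j - m)) / q ^ j * (- (u^2) / q ^ (j + m)) * (1 - q ^ (j + m) / u^2)"
  proof -
    have "- int m + - int j = - int (j + m)" by simp
    then show ?thesis unfolding kap_def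
      using q_nonzero u_nonzero qq by (simp only: power_int_minus power_int_of_nat) (simp add: power_add field_simps)
  qed
  have alg: "- B / J * (- c / D) * E / (- A / J * (- c / (D * M * M)) * W) = M * M * (E / A / (W / B))"
    if "A \<noteq> 0" "B \<noteq> 0" "W \<noteq> 0" "c \<noteq> 0" "M \<noteq> 0" "J \<noteq> 0" "D \<noteq> 0" for A B W c M J D E :: 'a
    using that by (simp add: field_simps)
  have jm: "q ^ (j + m) = q ^ (j - m) * q ^ m * q ^ m" by (simp add: power_add qq)
  show ?thesis unfolding a b gu_def mult_2 power_add[of q m m] jm
    by (rule alg) (use nz nz2 q_nonzero u_nonzero in \<open>auto simp: jm\<close>)
qed

text \<open>Compared with an unflipped j, two boxes of hook m - j disappear from the diagram and two
  boxes of hook m + j enter its Durfee square.\<close>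

lemma kap_flip_pair:
  assumes "j < m"
  shows "kap (int m) (int j) / kap (- int m) (int j) =
     kap (int m) (- int j) / kap (- int m) (- int j) * ((gu (m + j) * gd (m + j)) / (gu (m - j) * gd (m - j)))"
proof -
  define X where "X = q ^ m"
  define Y where "Y = q ^ j"
  define D where "D = q ^ (m - j)"
  have XY: "X = D * Y" unfolding X_def Y_def D_def using assms by (simp flip: power_add)
  have nz: "X \<noteq> 0" "Y \<noteq> 0" "D \<noteq> 0" using q_nonzero by (auto simp: X_def Y_def D_def)
  have pj: "q ^ (m + j) = X * Y" by (simp add: X_def Y_def power_add)
  have n1: "1 - D \<noteq> 0" using q_power[of "m - j"] assms by (simp add: D_def)
  have n2: "1 - X * Y \<noteq> 0" using q_power[of "m + j"] assms by (simp flip: pj)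
  have n3: "1 - u^2 * D \<noteq> 0" using one_minus_uq[of "int (m - j)"] by (simp only: power_int_of_nat D_def) simp
  have n4: "1 - u^2 * (X * Y) \<noteq> 0" using one_minus_uq[of "int (m + j)"] by (simp only: power_int_of_nat pj) simp
  have n5: "1 - D / u^2 \<noteq> 0" using one_minus_qu[of "int (m - j)"] by (simp only: power_int_of_nat D_def) simp
  have n6: "1 - X * Y / u^2 \<noteq> 0" using one_minus_qu[of "int (m + j)"] by (simp only: power_int_of_nat pj) simp
  have e: "int m + int j = int (m + j)" "int m + - int j = int (m - j)" "- int m + int j = - int (m - j)" "- int m + - int j = - int (m + j)"
    using assms by auto
  have k1: "kap (int m) (int j) = - Y * (1 - D) * (1 - u^2 * (X * Y))"
    unfolding kap_def e power_int_of_nat pj X_def[symmetric] Y_def[symmetric] using XY by (simp add: algebra_simps)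
  have k2: "kap (- int m) (int j) = (1 - X * Y) / X * (- (u^2) / D) * (1 - D / u^2)"
    unfolding kap_def e power_int_minus power_int_of_nat pj X_def[symmetric] Y_def[symmetric] D_def[symmetric]
    using nz u_nonzero by (simp add: field_simps)
  have k3: "kap (int m) (- int j) = - (1 - X * Y) / Y * (1 - u^2 * D)"
    unfolding kap_def e power_int_minus power_int_of_nat pj X_def[symmetric] Y_def[symmetric] D_def[symmetric]
    using nz by (simp add: field_simps)
  have k4: "kap (- int m) (- int j) = (1 - D) / X * (- (u^2) / (X * Y)) * (1 - X * Y / u^2)"
  proof -
    have i1: "inverse X - inverse Y = (1 - D) / X"
    proof -
      have "(1 - D) / X = inverse X - D / X" by (simp add: divide_inverse left_diff_distrib)
      also have "D / X = inverse Y" unfolding XY using nz by (simp add: divide_inverse)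
      finally show ?thesis ..
    qed
    have i2: "1 - u^2 * inverse Z = - (u^2) / Z * (1 - Z / u^2)" if "Z \<noteq> 0" for Z
      using that u_nonzero by (simp add: field_simps)
    show ?thesis
      unfolding kap_def e power_int_minus power_int_of_nat pj X_def[symmetric] Y_def[symmetric] i1
      using nz by (subst i2) (auto simp only: mult.assoc mult_eq_0_iff)
  qed
  have alg: "(- Y * d * p) / (s / X * (- c / D) * r) = (- s / Y * t) / (d / X * (- c / (X * Y)) * w) * ((w / s * (p / s)) / (r / d * (t / d)))"
    if "X = D * Y" "D \<noteq> 0" "Y \<noteq> 0" "d \<noteq> 0" "p \<noteq> 0" "s \<noteq> 0" "r \<noteq> 0" "t \<noteq> 0" "w \<noteq> 0" "c \<noteq> 0"
    for X D Y d p s r t w c :: 'a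
    unfolding that(1) using that(2-) by (simp add: field_simps)
  show ?thesis
    unfolding k1 k2 k3 k4 gu_def gd_def pj D_def[symmetric]
    by (rule alg[OF XY]) (use n1 n2 n3 n4 n5 n6 nz u_nonzero in auto)
qed

text \<open>The \<open>gu\<close> factors telescope. \<open>sea\<close> contributes the arguments N
  - m + 1 to N + m, the beads with index above m contribute 1 to N - m over 2 m + 1 to N + m, and
  those below m divide by m to 2 m - 1. What is left, 1 to m - 1 and 2 m, does not depend on
  N.\<close>

lemma vacuum_flip:
  assumes m: "0 < m" "m \<le> N"
  shows "bead N (int m) / bead N (- int m) * (\<Prod>j\<in>{..N}-{m}. kap (int m) (- int j) / kap (- int m) (- int j)) = vac m"
proof -
  have split: "{..N} - {m} = {..<m} \<union> {m<..N}" using m by auto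
  have P1: "(\<Prod>j<m. kap (int m) (- int j) / kap (- int m) (- int j)) =
     (q ^ (2 * m) / u^2) ^ m * ((\<Prod>t<m. gd (m - t)) / (\<Prod>a\<in>{m..<2*m}. gu a))"
  proof -
    have "(\<Prod>j<m. kap (int m) (- int j) / kap (- int m) (- int j)) = (\<Prod>j<m. q ^ (2 * m) / u^2 * (gd (m - j) / gu (m + j)))"
      by (rule prod.cong) (auto simp: kap_flip_below)
    also have "\<dots> = (q ^ (2 * m) / u^2) ^ m * ((\<Prod>t<m. gd (m - t)) / (\<Prod>j<m. gu (m + j)))"
      unfolding prod.distrib prod_constant card_lessThan
      by (simp only: prod_dividef)
    also have "(\<Prod>j<m. gu (m + j)) = (\<Prod>a\<in>{m..<2*m}. gu a)"
      by (rule prod.reindex_bij_witness[where i = "\<lambda>a. a - m" and j = "\<lambda>j. m + j"]) auto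
    finally show ?thesis .
  qed
  have P2: "(\<Prod>j\<in>{m<..N}. kap (int m) (- int j) / kap (- int m) (- int j)) =
     (q ^ (2 * m)) ^ (N - m) * ((\<Prod>a\<in>{1..N-m}. gu a) / (\<Prod>a\<in>{2*m+1..N+m}. gu a))"
  proof -
    have "(\<Prod>j\<in>{m<..N}. kap (int m) (- int j) / kap (- int m) (- int j)) = (\<Prod>j\<in>{m<..N}. q ^ (2 * m) * (gu (j - m) / gu (j + m)))"
      by (rule prod.cong) (auto simp: kap_flip_above)
    also have "\<dots> = (q ^ (2 * m)) ^ (N - m) * ((\<Prod>j\<in>{m<..N}. gu (j - m)) / (\<Prod>j\<in>{m<..N}. gu (j + m)))"
      unfolding prod.distrib prod_constant card_greaterThanAtMost
      by (simp only: prod_dividef)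
    also have "(\<Prod>j\<in>{m<..N}. gu (j - m)) = (\<Prod>a\<in>{1..N-m}. gu a)"
      by (rule prod.reindex_bij_witness[where i = "\<lambda>a. a + m" and j = "\<lambda>j. j - m"]) auto
    also have "(\<Prod>j\<in>{m<..N}. gu (j + m)) = (\<Prod>a\<in>{2*m+1..N+m}. gu a)"
      by (rule prod.reindex_bij_witness[where i = "\<lambda>a. a - m" and j = "\<lambda>j. j + m"]) auto
    finally show ?thesis .
  qed
  have gnz: "(\<Prod>a\<in>I. gu a) \<noteq> 0" if "0 \<notin> I" "finite I" for I
  proof -
    have "gu a \<noteq> 0" if "a \<in> I" for a
      using that \<open>0 \<notin> I\<close> gu_nonzero[of a] by (cases a) auto
    then show ?thesis using that by simp
  qed
  have B: "bead N (int m) / bead N (- int m) = (u / q ^ N) ^ (2 * m) / q ^ m * ((1 + u * q ^ m) / (1 + u / q ^ m)) * (\<Prod>a\<in>{N-m+1..N+m}. gu a)"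
  proof -
    have n1: "nat (int m + int N) = N + m" "nat (- int m + int N) = N - m" using m by auto
    have t: "q powi (- int m * (- int m - 1) div 2) = q powi (int m * (int m - 1) div 2) * q ^ m"
    proof -
      have "- int m * (- int m - 1) = int m * (int m - 1) + int m * 2" by (simp add: algebra_simps)
      then have "- int m * (- int m - 1) div 2 = int m * (int m - 1) div 2 + int m" by simp
      then show ?thesis by (simp only: q_powi_add power_int_of_nat)
    qed
    have s0: "sea N (N - m) \<noteq> 0" by (rule sea_nonzero)
    define g where "g = u / q ^ N"
    have g: "u * q powi (- int N) = g" by (simp add: g_def power_int_minus divide_inverse)
    have g0: "g \<noteq> 0" using u_nonzero q_nonzero by (simp add: g_def)
    define r where "r = q powi (int m * (int m - 1) div 2)"
    have r0: "r \<noteq> 0" by (simp add: r_def q_nonzero)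
    have b1: "bead N (int m) = g ^ m * r * (1 + u * q ^ m) * (sea N (N - m) * (\<Prod>a\<in>{N-m+1..N+m}. gu a))"
      unfolding bead_def g n1 sea_ratio[OF m(2)] r_def by simp
    have b2: "bead N (- int m) = inverse (g ^ m) * (r * q ^ m) * (1 + u / q ^ m) * sea N (N - m)"
      using m unfolding bead_def g n1 t r_def by (simp add: power_int_minus divide_inverse)
    have w: "1 + u / q ^ m \<noteq> 0" using one_plus_uq_nonzero[of "- int m"] by (simp add: power_int_minus divide_inverse)
    have alg: "G * r * a * (S * P) / (inverse G * (r * x) * b * S) = G * G / x * (a / b) * P"
      if "G \<noteq> 0" "S \<noteq> 0" for G a S P x b
      using that r0 by (simp add: field_simps)
    show ?thesis unfolding b1 b2 g_def[symmetric] mult_2 power_add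
      by (rule alg) (use g0 s0 in auto)
  qed
  have full: "(\<Prod>a\<in>{N-m+1..N+m}. gu a) * ((\<Prod>a\<in>{1..N-m}. gu a) / (\<Prod>a\<in>{2*m+1..N+m}. gu a)) / (\<Prod>a\<in>{m..<2*m}. gu a)
     = gu (2 * m) * (\<Prod>a\<in>{1..<m}. gu a)"
  proof -
    have e1: "(\<Prod>a\<in>{1..N+m}. gu a) = (\<Prod>a\<in>{1..N-m}. gu a) * (\<Prod>a\<in>{N-m+1..N+m}. gu a)"
      by (rule prod_split) (use m in auto)
    have e2: "(\<Prod>a\<in>{1..N+m}. gu a) = (\<Prod>a\<in>{1..2*m}. gu a) * (\<Prod>a\<in>{2*m+1..N+m}. gu a)"
      by (rule prod_split) (use m in auto)
    have "(\<Prod>a\<in>{1..2*m}. gu a) = (\<Prod>a\<in>{1..<m}. gu a) * (\<Prod>a\<in>insert (2*m) {m..<2*m}. gu a)"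
      by (rule prod_split) (use m in auto)
    then have e3: "(\<Prod>a\<in>{1..2*m}. gu a) = (\<Prod>a\<in>{1..<m}. gu a) * (gu (2 * m) * (\<Prod>a\<in>{m..<2*m}. gu a))"
      by simp
    have "(\<Prod>a\<in>{2*m+1..N+m}. gu a) \<noteq> 0" by (rule gnz) auto
    moreover have "(\<Prod>a\<in>{m..<2*m}. gu a) \<noteq> 0" by (rule gnz) (use m in auto)
    moreover have "(\<Prod>a\<in>{1..N-m}. gu a) * (\<Prod>a\<in>{N-m+1..N+m}. gu a) =
       (\<Prod>a\<in>{1..<m}. gu a) * (gu (2 * m) * (\<Prod>a\<in>{m..<2*m}. gu a)) * (\<Prod>a\<in>{2*m+1..N+m}. gu a)"
      using e1 e2 e3 by simp
    ultimately show ?thesis by (simp add: eq_divide_eq divide_eq_eq mult_ac)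
  qed
  have rev: "(\<Prod>t\<in>{1..<m}. gu (m - t)) = (\<Prod>a\<in>{1..<m}. gu a)"
    by (rule prod.reindex_bij_witness[where i = "\<lambda>a. m - a" and j = "\<lambda>a. m - a"]) auto
  \<comment> \<open>The power of u q^(-N) in \<open>bead\<close> cancels the monomials of the N
    pairs that contain m.\<close>
  have mono: "(u / q ^ N) ^ (2 * m) * (q ^ (2 * m) / u^2) ^ m * (q ^ (2 * m)) ^ (N - m) = 1"
  proof -
    have "(q ^ (2 * m)) ^ m * (q ^ (2 * m)) ^ (N - m) = (q ^ N) ^ (2 * m)"
    proof -
      obtain d where "N = m + d" using m le_Suc_ex by blast
      then show ?thesis by (simp add: power_add[symmetric] power_mult[symmetric] algebra_simps)
    qed
    moreover have "u ^ (2 * m) = (u^2) ^ m" by (simp add: power_mult)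
    ultimately show ?thesis
      using u_nonzero q_nonzero by (simp add: power_divide field_simps)
  qed
  \<comment> \<open>The spare q^m comes from the Gaussian factor of \<open>bead\<close> and produces
    the denominator u + q^m of \<open>strict_weight\<close>.\<close>
  have hh: "(1 + u * q ^ m) / (1 + u / q ^ m) / q ^ m = (1 + u * q ^ m) / (u + q ^ m)"
  proof -
    have "(1 + u / q ^ m) * q ^ m = u + q ^ m" using q_nonzero by (simp add: distrib_right add.commute)
    then show ?thesis by (simp only: divide_divide_eq_left)
  qed
  have "(\<Prod>j\<in>{..N}-{m}. kap (int m) (- int j) / kap (- int m) (- int j)) =
     ((q ^ (2 * m) / u^2) ^ m * ((\<Prod>t<m. gd (m - t)) / (\<Prod>a\<in>{m..<2*m}. gu a))) *
     ((q ^ (2 * m)) ^ (N - m) * ((\<Prod>a\<in>{1..N-m}. gu a) / (\<Prod>a\<in>{2*m+1..N+m}. gu a)))"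
    unfolding P1[symmetric] P2[symmetric] by (rule prod_split[OF split]) auto
  then have "bead N (int m) / bead N (- int m) * (\<Prod>j\<in>{..N}-{m}. kap (int m) (- int j) / kap (- int m) (- int j)) =
    ((u / q ^ N) ^ (2 * m) * (q ^ (2 * m) / u^2) ^ m * (q ^ (2 * m)) ^ (N - m)) * ((1 + u * q ^ m) / (1 + u / q ^ m) / q ^ m) *
    ((\<Prod>a\<in>{N-m+1..N+m}. gu a) * ((\<Prod>a\<in>{1..N-m}. gu a) / (\<Prod>a\<in>{2*m+1..N+m}. gu a)) / (\<Prod>a\<in>{m..<2*m}. gu a)) * (\<Prod>t<m. gd (m - t))"
    unfolding B by (simp add: mult_ac)
  also have "\<dots> = vac m"
    unfolding mono hh full vac_def rev by (simp add: mult_ac)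
  finally show ?thesis .
qed

text \<open>Elements are added in increasing order, so m lies above all beads flipped before, and
  each of these needs only the correction of \<open>kap_flip_pair\<close> to the flip in the ground
  state.\<close>

lemma wt_insert:
  assumes A: "A \<subseteq> {1..<m}" and m: "0 < m" "m \<le> N"
  shows "wt N (conf (insert m A)) = wt N (conf A) * (vac m * (\<Prod>j\<in>A. (gu (m + j) * gd (m + j)) / (gu (m - j) * gd (m - j))))"
proof -
  have finA: "finite A" using A finite_subset by blast
  have mA: "m \<notin> A" using A by auto
  have upd: "conf (insert m A) = (conf A)(m := int m)"
    by (auto simp: conf_def)
  have cm: "conf A m = - int m" using mA by (simp add: conf_def)
  define ratio where "ratio j = kap (int m) (- int j) / kap (- int m) (- int j)" for j
  have nz: "kap (- int m) (conf A j) \<noteq> 0" if "j \<noteq> m" for j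
  proof (rule kap_nonzero)
    show "- int m \<noteq> conf A j" using that A by (auto simp: conf_def)
  qed
  have "(\<Prod>j\<in>{..N}-{m}. kap (int m) (conf A j) / kap (- int m) (conf A j)) =
      (\<Prod>j\<in>{..N}-{m}. ratio j * (if j \<in> A then (gu (m + j) * gd (m + j)) / (gu (m - j) * gd (m - j)) else 1))"
  proof (rule prod.cong[OF refl])
    fix j assume "j \<in> {..N} - {m}"
    show "kap (int m) (conf A j) / kap (- int m) (conf A j) =
       ratio j * (if j \<in> A then (gu (m + j) * gd (m + j)) / (gu (m - j) * gd (m - j)) else 1)"
    proof (cases "j \<in> A")
      case True
      then have "j < m" using A by auto
      then show ?thesis using kap_flip_pair[of j m] True by (simp add: conf_def ratio_def)
    qed (simp add: conf_def ratio_def)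
  qed
  also have "\<dots> = (\<Prod>j\<in>{..N}-{m}. ratio j) * (\<Prod>j\<in>A. (gu (m + j) * gd (m + j)) / (gu (m - j) * gd (m - j)))"
  proof -
    have "(\<Prod>j\<in>{..N}-{m}. if j \<in> A then (gu (m + j) * gd (m + j)) / (gu (m - j) * gd (m - j)) else 1) =
      (\<Prod>j\<in>A. (gu (m + j) * gd (m + j)) / (gu (m - j) * gd (m - j)))"
      by (rule prod.mono_neutral_cong_right) (use A m finA in auto)
    then show ?thesis unfolding prod.distrib by simp
  qed
  finally have pr: "(\<Prod>j\<in>{..N}-{m}. kap (int m) (conf A j)) / (\<Prod>j\<in>{..N}-{m}. kap (- int m) (conf A j)) =
     (\<Prod>j\<in>{..N}-{m}. ratio j) * (\<Prod>j\<in>A. (gu (m + j) * gd (m + j)) / (gu (m - j) * gd (m - j)))"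
    unfolding prod_dividef .
  have v: "bead N (int m) / bead N (- int m) * (\<Prod>j\<in>{..N}-{m}. ratio j) = vac m"
    unfolding ratio_def by (rule vacuum_flip[OF m])
  have b0: "bead N (- int m) \<noteq> 0" using m by (intro bead_nonzero) simp
  have k0: "(\<Prod>j\<in>{..N}-{m}. kap (- int m) (conf A j)) \<noteq> 0" using nz by auto
  have "wt N (conf (insert m A)) * (bead N (- int m) * (\<Prod>j\<in>{..N}-{m}. kap (- int m) (conf A j))) =
     wt N (conf A) * (bead N (int m) * (\<Prod>j\<in>{..N}-{m}. kap (int m) (conf A j)))"
    using wt_update[OF m(2), of "conf A" "int m"] unfolding upd cm .
  then have "wt N (conf (insert m A)) = wt N (conf A) * (bead N (int m) / bead N (- int m) *
     ((\<Prod>j\<in>{..N}-{m}. kap (int m) (conf A j)) / (\<Prod>j\<in>{..N}-{m}. kap (- int m) (conf A j))))"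
    using b0 k0 by (simp add: field_simps)
  then show ?thesis unfolding pr v[symmetric] by (simp only: mult_ac)
qed

text \<open>The factors of an element involve only smaller numbers, so a new maximum leaves the old
  ones unchanged. In its own factor the elements of A are removed from the holes and enter as
  partners.\<close>

lemma strict_weight_insert:
  assumes A: "A \<subseteq> {1..<m}"
  shows "strict_weight (insert m A) = strict_weight A * (vac m * (\<Prod>j\<in>A. (gu (m + j) * gd (m + j)) / (gu (m - j) * gd (m - j))))"
proof -
  have finA: "finite A" using A finite_subset by blast
  have mA: "m \<notin> A" using A by auto
  define t where "t B k = (1 + u * q ^ k) / (u + q ^ k) * gu (2 * k) * (\<Prod>t\<in>{1..<k}-B. gu (k - t))
      * (\<Prod>t\<in>{..<k}-B. gd (k - t)) * (\<Prod>m'\<in>{m'\<in>B. m' < k}. gu (k + m') * gd (k + m'))" for B k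
  have old: "t (insert m A) k = t A k" if "k \<in> A" for k
  proof -
    have "k < m" using that A by auto
    then have "{1..<k} - insert m A = {1..<k} - A" "{..<k} - insert m A = {..<k} - A" "{m' \<in> insert m A. m' < k} = {m'\<in>A. m' < k}"
      by auto
    then show ?thesis by (simp only: t_def)
  qed
  have new: "t (insert m A) m = vac m * (\<Prod>j\<in>A. (gu (m + j) * gd (m + j)) / (gu (m - j) * gd (m - j)))"
  proof -
    have s: "{1..<m} - insert m A = {1..<m} - A" "{..<m} - insert m A = {..<m} - A" "{m' \<in> insert m A. m' < m} = A"
      using A by auto
    have nz: "(\<Prod>j\<in>A. gu (m - j)) \<noteq> 0" "(\<Prod>j\<in>A. gd (m - j)) \<noteq> 0"
      using finA A gu_nonzero gd_nonzero by auto
    have d1: "(\<Prod>t\<in>{1..<m}. gu (m - t)) = (\<Prod>t\<in>{1..<m}-A. gu (m - t)) * (\<Prod>t\<in>A. gu (m - t))"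
      by (rule prod.subset_diff[OF A]) simp
    have "A \<subseteq> {..<m}" using A by auto
    then have d2: "(\<Prod>t<m. gd (m - t)) = (\<Prod>t\<in>{..<m}-A. gd (m - t)) * (\<Prod>t\<in>A. gd (m - t))"
      by (rule prod.subset_diff) simp
    have alg: "a * U * D * P = a * (U * g) * (D * d) * (P / (g * d))" if "g \<noteq> 0" "d \<noteq> 0" for a U D P g d :: 'a
      using that by simp
    show ?thesis unfolding t_def s vac_def d1 d2 prod_dividef prod.distrib[of "\<lambda>j. gu (m - j)"]
      by (rule alg[OF nz])
  qed
  have "strict_weight (insert m A) = t (insert m A) m * (\<Prod>k\<in>A. t (insert m A) k)"
    unfolding strict_weight_def t_def[symmetric] using finA mA by simp
  also have "(\<Prod>k\<in>A. t (insert m A) k) = (\<Prod>k\<in>A. t A k)" by (rule prod.cong) (auto simp: old)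
  also have "\<dots> = strict_weight A" by (simp only: strict_weight_def t_def)
  finally show ?thesis unfolding new by (simp only: mult.commute)
qed

lemma wt_conf:
  assumes "A \<subseteq> {1..N}"
  shows "wt N (conf A) = wt N (conf {}) * strict_weight A"
proof -
  have "finite A" using assms finite_subset by blast
  then show ?thesis using assms
  proof (induction A rule: finite_linorder_max_induct)
    case empty
    show ?case by (simp add: strict_weight_def)
  next
    case (insert m A)
    then have A: "A \<subseteq> {1..<m}" and m: "0 < m" "m \<le> N" by auto
    have "A \<subseteq> {1..N}" using insert.prems by simp
    then show ?case
      using insert.IH unfolding wt_insert[OF A m] strict_weight_insert[OF A] by (simp only: mult.assoc)
  qed
qed

end


section \<open>Logarithmic derivatives and infinite products\<close>

text \<open>Multiplied out, so that it also makes sense for coefficients that form no field, here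
  the power series in q.\<close>

definition has_log_deriv :: "'a::comm_ring_1 fps \<Rightarrow> 'a fps \<Rightarrow> bool" where
  "has_log_deriv F E \<longleftrightarrow> fps_nth F 0 = 1 \<and> fps_X * fps_deriv F = E * F"

lemma has_log_deriv_one: "has_log_deriv 1 0"
  by (simp add: has_log_deriv_def)

lemma has_log_deriv_mult:
  assumes "has_log_deriv F E" "has_log_deriv G E'"
  shows "has_log_deriv (F * G) (E + E')"
proof -
  have "fps_X * fps_deriv (F * G) = (fps_X * fps_deriv F) * G + F * (fps_X * fps_deriv G)"
    by (simp add: algebra_simps)
  also have "\<dots> = (E + E') * (F * G)"
    using assms by (simp add: has_log_deriv_def algebra_simps)
  finally show ?thesis using assms by (simp add: has_log_deriv_def)
qed

lemma has_log_deriv_power: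
  assumes "has_log_deriv F E"
  shows "has_log_deriv (F ^ n) (of_nat n * E)"
proof (induction n)
  case 0 then show ?case by (simp add: has_log_deriv_one)
next
  case (Suc n)
  then show ?case using has_log_deriv_mult[OF assms Suc] by (simp add: algebra_simps)
qed

lemma has_log_deriv_prod:
  assumes "\<And>i. i \<in> I \<Longrightarrow> has_log_deriv (F i) (E i)"
  shows "has_log_deriv (prod F I) (sum E I)"
  using assms by (induction I rule: infinite_finite_induct)
    (auto intro!: has_log_deriv_mult has_log_deriv_one)

text \<open>Dividing by G inverts its constant term 1. In a ring with an arbitrary inverse operation
  the value of that inverse has to be supplied.\<close>

lemma has_log_deriv_divide:
  fixes F G :: "'a::{comm_ring_1, inverse} fps"
  assumes F: "has_log_deriv F E" and G: "has_log_deriv G E'" and one: "inverse (1::'a) = 1"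
  shows "has_log_deriv (F / G) (E - E')"
proof -
  define V where "V = inverse G"
  have G0: "fps_nth G 0 = 1" using G by (simp add: has_log_deriv_def)
  have GV: "G * V = 1"
    unfolding V_def fps_inverse_def by (rule fps_right_inverse) (simp add: G0 one)
  have V0: "fps_nth V 0 = 1"
    using arg_cong[OF GV, of "\<lambda>f. fps_nth f 0"] G0 by (simp add: fps_mult_nth)
  have "(fps_X * fps_deriv G) * V + G * (fps_X * fps_deriv V) = fps_X * fps_deriv (G * V)"
    by (simp add: algebra_simps)
  moreover have XG: "fps_X * fps_deriv G = E' * G" using G by (simp add: has_log_deriv_def)
  ultimately have "E' * (G * V) + G * (fps_X * fps_deriv V) = 0"
    unfolding XG GV by (simp add: mult.assoc GV)
  then have "V * (E' + G * (fps_X * fps_deriv V)) = 0" unfolding GV by simp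
  then have "(G * V) * (fps_X * fps_deriv V) = - E' * V"
    by (simp add: algebra_simps eq_neg_iff_add_eq_0)
  then have "has_log_deriv V (- E')" using V0 unfolding GV by (simp add: has_log_deriv_def)
  moreover have "F / G = F * V"
    unfolding V_def using G0 by (intro fps_divide_unit) simp
  ultimately show ?thesis using has_log_deriv_mult[OF F] by fastforce
qed

text \<open>The expansion of m c X^m / (1 - c X^m).\<close>

definition single_log :: "nat \<Rightarrow> 'a::comm_ring_1 \<Rightarrow> 'a fps" where
  "single_log m c = Abs_fps (\<lambda>j. if m dvd j \<and> 0 < j then of_nat m * c ^ (j div m) else 0)"

lemma has_log_deriv_one_minus:
  fixes c :: "'a::comm_ring_1"
  assumes m: "0 < m"
  shows "has_log_deriv (1 - fps_const c * fps_X ^ m) (- single_log m c)"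
proof -
  have "fps_X * fps_deriv (1 - fps_const c * fps_X ^ m) = - single_log m c * (1 - fps_const c * fps_X ^ m)"
  proof (rule fps_ext)
    fix j
    have e1: "fps_nth (fps_X * fps_deriv (1 - fps_const c * fps_X ^ m)) j = (if j = m then - of_nat m * c else 0)"
      unfolding fps_nth_X_deriv using m by (simp add: fps_X_power_iff)
    have e2: "single_log m c * (1 - fps_const c * fps_X ^ m) = single_log m c - fps_X ^ m * (fps_const c * single_log m c)"
      by (simp add: algebra_simps)
    have e3: "fps_nth (single_log m c - fps_X ^ m * (fps_const c * single_log m c)) j =
      fps_nth (single_log m c) j - (if j < m then 0 else c * fps_nth (single_log m c) (j - m))"
      by (simp add: fps_X_power_mult_nth)
    have e4: "fps_nth (single_log m c) j - (if j < m then 0 else c * fps_nth (single_log m c) (j - m)) = (if j = m then of_nat m * c else 0)"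
    proof (cases "j < m")
      case True
      then show ?thesis by (auto simp: single_log_def dest: dvd_imp_le)
    next
      case False
      then have "j div m = Suc ((j - m) div m)" "m dvd j - m \<longleftrightarrow> m dvd j"
        using m by (auto simp: le_div_geq dvd_minus_self)
      then show ?thesis using False m by (auto simp: single_log_def)
    qed
    show "fps_nth (fps_X * fps_deriv (1 - fps_const c * fps_X ^ m)) j =
       fps_nth (- single_log m c * (1 - fps_const c * fps_X ^ m)) j"
      unfolding mult_minus_left fps_neg_nth e1 e2 e3 e4 by simp
  qed
  then show ?thesis using m by (simp add: has_log_deriv_def)
qed

lemma has_log_deriv_nth:
  assumes "has_log_deriv F E" "fps_nth E 0 = 0"
  shows "of_nat j * fps_nth F j = (\<Sum>i=1..j. fps_nth E i * fps_nth F (j - i))"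
proof -
  have "of_nat j * fps_nth F j = fps_nth (E * F) j"
    using assms(1) fps_nth_X_deriv[of F j] by (simp add: has_log_deriv_def)
  also have "\<dots> = (\<Sum>i=0..j. fps_nth E i * fps_nth F (j - i))" by (rule fps_mult_nth)
  also have "\<dots> = (\<Sum>i=1..j. fps_nth E i * fps_nth F (j - i))"
    using assms(2) by (subst sum.atLeast_Suc_atMost) auto
  finally show ?thesis .
qed

text \<open>Phrased for bare sequences, so that it applies to coefficients that have been mapped
  into Laurent series one by one.\<close>

lemma has_log_deriv_unique_nth:
  fixes a b :: "nat \<Rightarrow> 'a::{idom, ring_char_0}"
  assumes "a 0 = b 0"
    and "\<And>j. 0 < j \<Longrightarrow> j \<le> n \<Longrightarrow> of_nat j * a j = (\<Sum>i=1..j. e i * a (j - i))"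
    and "\<And>j. 0 < j \<Longrightarrow> j \<le> n \<Longrightarrow> of_nat j * b j = (\<Sum>i=1..j. e i * b (j - i))"
  shows "j \<le> n \<Longrightarrow> a j = b j"
proof (induction j rule: less_induct)
  case (less j)
  show ?case
  proof (cases "j = 0")
    case True then show ?thesis using assms(1) by simp
  next
    case False
    have "(\<Sum>i=1..j. e i * a (j - i)) = (\<Sum>i=1..j. e i * b (j - i))"
      by (rule sum.cong) (use less in auto)
    then have "of_nat j * a j = of_nat j * b j" using assms(2,3)[of j] less.prems False by simp
    then show ?thesis using False by simp
  qed
qed

section \<open>Coefficientwise q-adic limits\<close>

lemma fps_tendsto_mult:
  fixes f g :: "nat \<Rightarrow> 'a::comm_ring_1 fps"
  assumes "f \<longlonglongrightarrow> a" "g \<longlonglongrightarrow> b"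
  shows "(\<lambda>n. f n * g n) \<longlonglongrightarrow> a * b"
  unfolding tendsto_fps_iff
proof
  fix n
  have "\<forall>\<^sub>F x in sequentially. \<forall>i\<in>{0..n}. fps_nth (f x) i = fps_nth a i"
    using assms(1) unfolding tendsto_fps_iff by (intro eventually_ball_finite) auto
  moreover have "\<forall>\<^sub>F x in sequentially. \<forall>i\<in>{0..n}. fps_nth (g x) i = fps_nth b i"
    using assms(2) unfolding tendsto_fps_iff by (intro eventually_ball_finite) auto
  ultimately show "\<forall>\<^sub>F x in sequentially. fps_nth (f x * g x) n = fps_nth (a * b) n"
    by eventually_elim (auto simp: fps_mult_nth intro!: sum.cong)
qed

lemma fps_tendsto_add:
  fixes f g :: "nat \<Rightarrow> 'a::comm_ring_1 fps"
  assumes "f \<longlonglongrightarrow> a" "g \<longlonglongrightarrow> b"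
  shows "(\<lambda>n. f n + g n) \<longlonglongrightarrow> a + b"
  unfolding tendsto_fps_iff
proof
  fix n
  have "\<forall>\<^sub>F x in sequentially. fps_nth (f x) n = fps_nth a n" "\<forall>\<^sub>F x in sequentially. fps_nth (g x) n = fps_nth b n"
    using assms unfolding tendsto_fps_iff by blast+
  then show "\<forall>\<^sub>F x in sequentially. fps_nth (f x + g x) n = fps_nth (a + b) n"
    by eventually_elim simp
qed

lemma fps_tendsto_sum:
  fixes f :: "'i \<Rightarrow> nat \<Rightarrow> 'a::comm_ring_1 fps"
  assumes "\<And>i. i \<in> I \<Longrightarrow> f i \<longlonglongrightarrow> a i"
  shows "(\<lambda>n. \<Sum>i\<in>I. f i n) \<longlonglongrightarrow> (\<Sum>i\<in>I. a i)"
  using assms by (induction I rule: infinite_finite_induct) (auto intro!: fps_tendsto_add)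

text \<open>\<open>has_log_deriv_nth\<close> expresses each coefficient of F through earlier ones
  and those of E, so convergence passes from E to F by induction; characteristic 0 allows the
  division by j.\<close>

lemma log_deriv_limit:
  fixes F E :: "nat \<Rightarrow> 'a::field_char_0 fps fps"
  assumes F: "\<And>r. has_log_deriv (F r) (E r)" and E0: "\<And>r. fps_nth (E r) 0 = 0"
    and lim: "\<And>j. (\<lambda>r. fps_nth (E r) j) \<longlonglongrightarrow> fps_nth E' j"
  obtains G where "has_log_deriv G E'" "\<And>j. (\<lambda>r. fps_nth (F r) j) \<longlonglongrightarrow> fps_nth G j"
proof -
  have conv: "\<exists>L. (\<lambda>r. fps_nth (F r) j) \<longlonglongrightarrow> L" for j
  proof (induction j rule: less_induct)
    case (less j)
    show ?case
    proof (cases "j = 0")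
      case True
      then have "(\<lambda>r. fps_nth (F r) j) = (\<lambda>r. 1)" using F by (auto simp: has_log_deriv_def)
      then show ?thesis by auto
    next
      case False
      from less have "\<forall>k<j. \<exists>L. (\<lambda>r. fps_nth (F r) k) \<longlonglongrightarrow> L" by blast
      then obtain L where L: "\<And>k. k < j \<Longrightarrow> (\<lambda>r. fps_nth (F r) k) \<longlonglongrightarrow> L k" by metis
      have "(\<lambda>r. fps_const (1 / of_nat j) * (\<Sum>i=1..j. fps_nth (E r) i * fps_nth (F r) (j - i))) \<longlonglongrightarrow>
          fps_const (1 / of_nat j) * (\<Sum>i=1..j. fps_nth E' i * L (j - i))"
        by (intro fps_tendsto_mult fps_tendsto_sum lim L tendsto_const) auto
      moreover have "fps_const (1 / of_nat j) * (\<Sum>i=1..j. fps_nth (E r) i * fps_nth (F r) (j - i)) = fps_nth (F r) j" for r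
      proof -
        have "fps_const (1 / of_nat j) * of_nat j = (1 :: 'a fps)"
          using False by (simp only: fps_of_nat[symmetric] fps_const_mult) simp
        then show ?thesis
          unfolding has_log_deriv_nth[OF F E0, symmetric] mult.assoc[symmetric] by simp
      qed
      ultimately show ?thesis by auto
    qed
  qed
  then obtain L where L: "\<And>j. (\<lambda>r. fps_nth (F r) j) \<longlonglongrightarrow> L j" by metis
  define G where "G = Abs_fps L"
  have G: "(\<lambda>r. fps_nth (F r) j) \<longlonglongrightarrow> fps_nth G j" for j using L by (simp add: G_def)
  have "has_log_deriv G E'"
    unfolding has_log_deriv_def
  proof
    have "(\<lambda>r. fps_nth (F r) 0) \<longlonglongrightarrow> 1" using F by (simp add: has_log_deriv_def)
    then show "fps_nth G 0 = 1" using G[of 0] LIMSEQ_unique by blast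
    show "fps_X * fps_deriv G = E' * G"
    proof (rule fps_ext)
      fix j
      have "(\<lambda>r. of_nat j * fps_nth (F r) j) \<longlonglongrightarrow> of_nat j * fps_nth G j"
        by (intro fps_tendsto_mult G tendsto_const)
      moreover have "(\<lambda>r. \<Sum>i=0..j. fps_nth (E r) i * fps_nth (F r) (j - i)) \<longlonglongrightarrow> (\<Sum>i=0..j. fps_nth E' i * fps_nth G (j - i))"
        by (intro fps_tendsto_mult fps_tendsto_sum lim G)
      moreover have "of_nat j * fps_nth (F r) j = (\<Sum>i=0..j. fps_nth (E r) i * fps_nth (F r) (j - i))" for r
        using F[of r] fps_nth_X_deriv[of "F r" j] by (simp add: has_log_deriv_def fps_mult_nth)
      ultimately have "of_nat j * fps_nth G j = (\<Sum>i=0..j. fps_nth E' i * fps_nth G (j - i))"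
        using LIMSEQ_unique by simp
      then show "fps_nth (fps_X * fps_deriv G) j = fps_nth (E' * G) j"
        unfolding fps_nth_X_deriv by (simp only: fps_mult_nth)
    qed
  qed
  then show ?thesis using G that by blast
qed

lemma fprod_log_deriv:
  assumes F: "\<And>k. 1 \<le> k \<Longrightarrow> has_log_deriv (f k) (E k)" and E0: "\<And>k. 1 \<le> k \<Longrightarrow> fps_nth (E k) 0 = 0"
    and lim: "\<And>j. (\<lambda>N. \<Sum>k=1..N. fps_nth (E k) j) \<longlonglongrightarrow> fps_nth E' j"
  shows "fprod_converges f \<and> has_log_deriv (fprod f :: 'a::field_char_0 fps fps) E'"
proof -
  have "has_log_deriv (\<Prod>k=1..N. f k) (\<Sum>k=1..N. E k)" for N
    by (rule has_log_deriv_prod) (use F in auto)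
  moreover have "fps_nth (\<Sum>k=1..N. E k) 0 = 0" for N
    using E0 by (simp add: fps_sum_nth)
  moreover have "(\<lambda>N. fps_nth (\<Sum>k=1..N. E k) j) \<longlonglongrightarrow> fps_nth E' j" for j
    using lim by (simp add: fps_sum_nth)
  ultimately obtain G where G: "has_log_deriv G E'" "\<And>j. (\<lambda>N. fps_nth (\<Prod>k=1..N. f k) j) \<longlonglongrightarrow> fps_nth G j"
    by (rule log_deriv_limit[of "\<lambda>N. \<Prod>k=1..N. f k" "\<lambda>N. \<Sum>k=1..N. E k" E']) (rule that)
  have "fprod f = G"
    unfolding fprod_def using limI[OF G(2)] by (intro fps_ext) simp
  then show ?thesis unfolding fprod_converges_def convergent_def using G by blast
qed

text \<open>The series of w s q^(k s) over s >= 1, which is what a sum over r leaves at the k-th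
  power.\<close>

definition ray :: "(nat \<Rightarrow> nat) \<Rightarrow> nat \<Rightarrow> 'a::comm_ring_1 fps" where
  "ray w k = Abs_fps (\<lambda>n. if k dvd n \<and> 0 < n then of_nat (w (n div k)) else 0)"

lemma ray_limit:
  assumes k: "0 < k"
  shows "(\<lambda>R. \<Sum>r=1..R. of_nat (w r) * (fps_X ^ r) ^ k) \<longlonglongrightarrow> (ray w k :: 'a::comm_ring_1 fps)"
  unfolding tendsto_fps_iff
proof
  fix n
  have "fps_nth (\<Sum>r=1..R. of_nat (w r) * (fps_X ^ r) ^ k :: 'a fps) n = fps_nth (ray w k) n" if R: "n \<le> R" for R
  proof -
    have "fps_nth (\<Sum>r=1..R. of_nat (w r) * (fps_X ^ r) ^ k :: 'a fps) n = (\<Sum>r=1..R. if r * k = n then of_nat (w r) else 0)"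
      unfolding fps_sum_nth
      unfolding power_mult[symmetric] fps_of_nat[symmetric]
      by (rule sum.cong) (auto simp: fps_X_power_iff)
    also have "\<dots> = fps_nth (ray w k) n"
    proof (cases "k dvd n \<and> 0 < n")
      case True
      then obtain s where s: "n = k * s" "0 < s" using k by (auto elim!: dvdE)
      have "s \<le> R" using s R k by (metis One_nat_def Suc_leI le_trans mult_le_mono1 nat_mult_1)
      have "(\<Sum>r=1..R. if r * k = n then of_nat (w r) else 0 :: 'a) = (\<Sum>r=1..R. if r = s then of_nat (w s) else 0)"
        by (rule sum.cong) (use s k in auto)
      also have "\<dots> = of_nat (w s)" using s \<open>s \<le> R\<close> by simp
      finally show ?thesis using True s k by (simp add: ray_def)
    next
      case False
      have "(\<Sum>r=1..R. if r * k = n then of_nat (w r) else 0 :: 'a) = 0"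
        by (rule sum.neutral) (use False k in auto)
      then show ?thesis using False by (auto simp: ray_def)
    qed
    finally show ?thesis .
  qed
  then show "\<forall>\<^sub>F R in sequentially. fps_nth (\<Sum>r=1..R. of_nat (w r) * (fps_X ^ r) ^ k :: 'a fps) n = fps_nth (ray w k) n"
    unfolding eventually_sequentially by blast
qed

lemma ray_one:
  assumes k: "0 < k"
  shows "(1 - fps_X ^ k) * ray (\<lambda>r. 1) k = (fps_X ^ k :: 'a::comm_ring_1 fps)"
proof (rule fps_ext)
  fix j
  have "fps_nth ((1 - fps_X ^ k) * ray (\<lambda>r. 1) k) j = fps_nth (ray (\<lambda>r. 1) k) j - (if j < k then 0 else fps_nth (ray (\<lambda>r. 1) k) (j - k) :: 'a)"
    by (simp add: left_diff_distrib fps_X_power_mult_nth)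
  moreover have "k dvd j - k \<longleftrightarrow> k dvd j" if "k \<le> j" using that by (simp add: dvd_minus_self)
  ultimately show "fps_nth ((1 - fps_X ^ k) * ray (\<lambda>r. 1) k) j = fps_nth (fps_X ^ k :: 'a fps) j"
    using k by (cases "j < k") (auto simp: ray_def fps_X_power_iff dest: dvd_imp_le)
qed

text \<open>The differences of (r + 1) div 2 are 1 at odd r and 0 at even r; differences of step 2
  then leave only the first odd term.\<close>

lemma ray_half:
  assumes k: "0 < k"
  shows "(1 - fps_X ^ (2 * k)) * ((1 - fps_X ^ k) * ray (\<lambda>r. (r + 1) div 2) k) = (fps_X ^ k :: 'a::comm_ring_1 fps)"
proof -
  define B :: "'a fps" where "B = Abs_fps (\<lambda>n. if k dvd n \<and> odd (n div k) then 1 else 0)"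
  have shift: "fps_nth ((1 - fps_X ^ l) * F) j = fps_nth F j - (if j < l then 0 else fps_nth F (j - l))" for F :: "'a fps" and j l
    by (simp add: left_diff_distrib fps_X_power_mult_nth)
  have "(1 - fps_X ^ k) * ray (\<lambda>r. (r + 1) div 2) k = B"
  proof (rule fps_ext)
    fix j
    show "fps_nth ((1 - fps_X ^ k) * ray (\<lambda>r. (r + 1) div 2) k) j = fps_nth B j"
    proof (cases "k dvd j")
      case False
      then have "k \<le> j \<Longrightarrow> \<not> k dvd j - k" by (simp add: dvd_minus_self)
      then show ?thesis using False unfolding shift by (auto simp: ray_def B_def)
    next
      case True
      then obtain s where s: "j = k * s" by auto
      show ?thesis
      proof (cases s)
        case 0
        then show ?thesis unfolding shift using s k by (simp add: ray_def B_def)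
      next
        case (Suc t)
        then have e: "j - k = k * t" "\<not> j < k" using s by auto
        have "fps_nth (ray (\<lambda>r. (r + 1) div 2) k) j = (of_nat ((s + 1) div 2) :: 'a)"
          using s Suc k by (simp add: ray_def)
        moreover have "fps_nth (ray (\<lambda>r. (r + 1) div 2) k) (j - k) = (of_nat ((t + 1) div 2) :: 'a)"
          unfolding e using k by (cases t) (auto simp: ray_def)
        moreover have "fps_nth B j = (if odd s then 1 else 0)" using s k by (simp add: B_def)
        moreover have "(s + 1) div 2 = (t + 1) div 2 + (if odd s then 1 else 0)" using Suc by (auto elim!: evenE oddE)
        ultimately show ?thesis unfolding shift using e by auto
      qed
    qed
  qed
  moreover have "(1 - fps_X ^ (2 * k)) * B = fps_X ^ k"
  proof (rule fps_ext)
    fix j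
    show "fps_nth ((1 - fps_X ^ (2 * k)) * B) j = fps_nth (fps_X ^ k) j"
    proof (cases "k dvd j")
      case False
      then have "2 * k \<le> j \<Longrightarrow> \<not> k dvd j - 2 * k" by (metis dvd_diffD dvd_triv_right)
      then show ?thesis using False unfolding shift by (auto simp: B_def fps_X_power_iff)
    next
      case True
      then obtain s where s: "j = k * s" by auto
      show ?thesis
      proof (cases "2 \<le> s")
        case True
        then obtain t where t: "s = t + 2" by (metis add.commute le_Suc_ex)
        then have e: "j - 2 * k = k * t" "\<not> j < 2 * k" using s by (auto simp: algebra_simps)
        show ?thesis unfolding shift using e s t k by (auto simp: B_def fps_X_power_iff)
      next
        case False
        then have "s = 0 \<or> s = 1" by auto
        then show ?thesis unfolding shift using s k by (auto simp: B_def fps_X_power_iff)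
      qed
    qed
  qed
  ultimately show ?thesis by simp
qed


section \<open>The product side\<close>

definition half_weight :: "nat \<Rightarrow> nat" where "half_weight r = (r + 1) div 2"

lemma nat_ceiling_half: "nat \<lceil>real r / 2\<rceil> = half_weight r"
proof -
  have "\<lceil>real r / 2\<rceil> = int ((r + 1) div 2)"
    by (cases "even r") (auto elim!: evenE oddE intro!: ceiling_unique simp: field_simps)
  then show ?thesis by (simp add: half_weight_def)
qed

text \<open>The logarithmic derivative of the inner product for m has m times this as its
  coefficient of T^(m k). It does not depend on m because T enters the factors only through T^m.
  \<open>outer_log\<close> also takes in the factor 1 + u^(-1) T^m.\<close>

definition inner_log :: "nat \<Rightarrow> ratfun fps" where
  "inner_log k = (fps_const ((- u) ^ k) - fps_const ((- inverse u) ^ k)) * ray (\<lambda>r. 1) k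
     + (1 + fps_X ^ k - fps_const ((u ^ 2) ^ k) * fps_X ^ k - fps_const ((u powi (- 2)) ^ k)) * ray half_weight k"

definition outer_log :: "nat \<Rightarrow> ratfun fps" where
  "outer_log k = inner_log k - fps_const ((- inverse u) ^ k)"

lemma single_log_nth: "fps_nth (single_log m c) j = (if m dvd j \<and> 0 < j then of_nat m * c ^ (j div m) else 0)"
  by (simp add: single_log_def)

definition inner_factor_log :: "nat \<Rightarrow> nat \<Rightarrow> ratfun fps fps" where
  "inner_factor_log m r =
     - single_log m (fps_const (- inverse u) * fps_X ^ r) + single_log m (fps_const (- u) * fps_X ^ r)
     + (of_nat (half_weight r) * (- single_log m (fps_const (u ^ 2) * fps_X ^ (r + 1)))
        + of_nat (half_weight r) * (- single_log m (fps_const (u powi (- 2)) * fps_X ^ r))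
        - (of_nat (half_weight r) * (- single_log m (fps_X ^ r))
           + of_nat (half_weight r) * (- single_log m (fps_X ^ (r + 1)))))"

lemma inner_factor_log_deriv:
  assumes m: "0 < m"
  shows "has_log_deriv (inner_factor m r)
    (inner_factor_log m r)"
proof -
  have one: "inverse (1 :: ratfun fps) = 1" by simp
  have Q: "Q ^ r = fps_const (fps_X ^ r)" for r by (simp add: q_def)
  have e1: "1 + cu a * Q ^ r * T ^ m = 1 - fps_const (fps_const (- a) * fps_X ^ r) * fps_X ^ m" for a r
  proof -
    have "cu a * Q ^ r = - fps_const (fps_const (- a) * fps_X ^ r)"
      unfolding Q fps_const_mult fps_const_neg by simp
    then show ?thesis by (simp add: T_def)
  qed
  have e2: "Q ^ r * cu a * T ^ m = fps_const (fps_const a * fps_X ^ r) * fps_X ^ m" for a r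
    unfolding Q fps_const_mult T_def by (simp add: mult.commute)
  have e3: "Q ^ r * T ^ m = fps_const (fps_X ^ r) * fps_X ^ m" for r
    unfolding Q T_def ..
  have "has_log_deriv (inner_factor m r)
    ((- single_log m (fps_const (- inverse u) * fps_X ^ r) - - single_log m (fps_const (- u) * fps_X ^ r))
     + ((of_nat (half_weight r) * (- single_log m (fps_const (u ^ 2) * fps_X ^ (r + 1)))
        + of_nat (half_weight r) * (- single_log m (fps_const (u powi (- 2)) * fps_X ^ r)))
        - (of_nat (half_weight r) * (- single_log m (fps_X ^ r))
           + of_nat (half_weight r) * (- single_log m (fps_X ^ (r + 1))))))"
    unfolding inner_factor_def nat_ceiling_half e1 e2 e3
    by (intro has_log_deriv_mult has_log_deriv_divide has_log_deriv_power has_log_deriv_one_minus m one)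
  then show ?thesis by (simp only: diff_minus_eq_add inner_factor_log_def)
qed

lemma of_nat_mult_nth: "fps_nth (of_nat n * F) j = of_nat n * fps_nth F j" for F :: "'a::comm_ring_1 fps"
  by (simp flip: fps_of_nat)

definition inner_term :: "nat \<Rightarrow> nat \<Rightarrow> ratfun fps" where
  "inner_term k r = - ((fps_const (- inverse u) * fps_X ^ r) ^ k) + (fps_const (- u) * fps_X ^ r) ^ k
     + (- (of_nat (half_weight r) * (fps_const (u ^ 2) * fps_X ^ (r + 1)) ^ k)
        - of_nat (half_weight r) * (fps_const (u powi (- 2)) * fps_X ^ r) ^ k
        + (of_nat (half_weight r) * (fps_X ^ r) ^ k + of_nat (half_weight r) * (fps_X ^ (r + 1)) ^ k))"

text \<open>Every summand is a multiple of q^(r k), with or without the multiplicity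
  \<open>half_weight r\<close>, so the sum over r splits into two \<open>ray\<close> series.\<close>

lemma inner_sum_limit:
  assumes k: "0 < k"
  shows "(\<lambda>R. \<Sum>r=1..R. inner_term k r)
    \<longlonglongrightarrow> inner_log k"
proof -
  define s1 where "s1 R = (\<Sum>r=1..R. of_nat 1 * (fps_X ^ r) ^ k :: ratfun fps)" for R
  define sh where "sh R = (\<Sum>r=1..R. of_nat (half_weight r) * (fps_X ^ r) ^ k :: ratfun fps)" for R
  define a where "a = fps_const ((- u) ^ k) - fps_const ((- inverse u) ^ k)"
  define b where "b = 1 + fps_X ^ k - fps_const ((u ^ 2) ^ k) * fps_X ^ k - fps_const ((u powi (- 2)) ^ k)"
  have pc: "(fps_const c * F) ^ k = fps_const (c ^ k) * F ^ k" for c and F :: "ratfun fps"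
    by (simp add: power_mult_distrib)
  have ps: "(fps_X ^ (r + 1)) ^ k = (fps_X ^ r) ^ k * (fps_X ^ k :: ratfun fps)" for r
    by (simp add: power_mult_distrib mult.commute)
  have "(\<Sum>r=1..R. inner_term k r)
    = a * s1 R + b * sh R" for R
    unfolding s1_def sh_def sum_distrib_left sum.distrib[symmetric]
  proof (rule sum.cong[OF refl])
    fix r
    define y where "y = (fps_X ^ r :: ratfun fps) ^ k"
    show "inner_term k r
      = a * (of_nat 1 * (fps_X ^ r) ^ k) + b * (of_nat (half_weight r) * (fps_X ^ r) ^ k)"
      unfolding inner_term_def pc ps y_def[symmetric] a_def b_def of_nat_1 by (simp only: ring_distribs mult_1 mult_ac) (simp add: algebra_simps)
  qed
  moreover have "(\<lambda>R. a * s1 R + b * sh R) \<longlonglongrightarrow> a * ray (\<lambda>r. 1) k + b * ray half_weight k"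
    unfolding s1_def sh_def
    by (intro fps_tendsto_add fps_tendsto_mult tendsto_const ray_limit[OF k])
  ultimately show ?thesis unfolding inner_log_def a_def b_def by simp
qed

lemma fprod_inner_log_deriv:
  assumes m: "0 < m"
  shows "fprod_converges (inner_factor m) \<and>
    has_log_deriv (fprod (inner_factor m)) (Abs_fps (\<lambda>j. if m dvd j \<and> 0 < j then of_nat m * inner_log (j div m) else 0))"
proof (rule fprod_log_deriv)
  fix r :: nat
  show "has_log_deriv (inner_factor m r)
    (inner_factor_log m r)"
    by (rule inner_factor_log_deriv[OF m])
  show "fps_nth (inner_factor_log m r) 0 = 0"
    by (simp add: inner_factor_log_def single_log_nth)
next
  fix j
  show "(\<lambda>R. \<Sum>r=1..R. fps_nth (inner_factor_log m r) j)
    \<longlonglongrightarrow> fps_nth (Abs_fps (\<lambda>j. if m dvd j \<and> 0 < j then of_nat m * inner_log (j div m) else 0)) j"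
  proof (cases "m dvd j \<and> 0 < j")
    case True
    define k where "k = j div m"
    have k: "0 < k" using True m by (auto simp: k_def elim!: dvdE)
    have "(\<lambda>R. of_nat m * (\<Sum>r=1..R. inner_term k r)) \<longlonglongrightarrow> of_nat m * inner_log k"
      by (intro fps_tendsto_mult tendsto_const inner_sum_limit[OF k])
    moreover have "fps_nth (single_log m c) j = of_nat m * c ^ k" for c :: "ratfun fps"
      using True by (simp add: single_log_nth k_def)
    ultimately show ?thesis
      using True by (simp only: inner_factor_log_def inner_term_def fps_add_nth fps_sub_nth fps_neg_nth of_nat_mult_nth sum_distrib_left fps_nth_Abs_fps if_True k_def[symmetric])
         (simp add: algebra_simps)
  next
    case False
    then have "fps_nth (single_log m c) j = 0" for c :: "ratfun fps"
      unfolding single_log_nth by (rule if_not_P)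
    then show ?thesis using False by (simp only: inner_factor_log_def fps_add_nth fps_sub_nth fps_neg_nth of_nat_mult_nth) auto
  qed
qed

text \<open>At T^j only divisors m of j occur, so the sum over m is finite; passing to the
  complementary divisor gives \<open>log_series\<close>.\<close>

lemma outer_product_log_deriv:
  "fprod_converges outer_factor \<and> has_log_deriv (fprod outer_factor) (log_series outer_log)"
proof (rule fprod_log_deriv)
  fix m :: nat assume "1 \<le> m"
  then have m: "0 < m" by simp
  have e: "1 + cu (inverse u) * T ^ m = 1 - fps_const (fps_const (- inverse u)) * fps_X ^ m"
  proof -
    have "cu (inverse u) = - fps_const (fps_const (- inverse u))"
      unfolding fps_const_neg by simp
    then show ?thesis by (simp only: T_def mult_minus_left add_uminus_conv_diff)
  qed
  show "has_log_deriv (outer_factor m) (- single_log m (fps_const (- inverse u)) +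
      Abs_fps (\<lambda>j. if m dvd j \<and> 0 < j then of_nat m * inner_log (j div m) else 0))"
    unfolding outer_factor_def e
    by (intro has_log_deriv_mult has_log_deriv_one_minus m) (use fprod_inner_log_deriv[OF m] in blast)
  show "fps_nth (- single_log m (fps_const (- inverse u)) +
      Abs_fps (\<lambda>j. if m dvd j \<and> 0 < j then of_nat m * inner_log (j div m) else 0)) 0 = 0"
    by (simp add: single_log_nth)
next
  fix j
  have nth: "fps_nth (- single_log m (fps_const (- inverse u)) +
      Abs_fps (\<lambda>j. if m dvd j \<and> 0 < j then of_nat m * inner_log (j div m) else 0)) j =
      (if m dvd j \<and> 0 < j then of_nat m * outer_log (j div m) else 0)" for m
    by (simp add: single_log_nth outer_log_def algebra_simps)
  have "(\<Sum>m=1..M. if m dvd j \<and> 0 < j then of_nat m * outer_log (j div m) else 0) = fps_nth (log_series outer_log) j"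
    if M: "j \<le> M" for M
  proof -
    have "(\<Sum>m=1..M. if m dvd j \<and> 0 < j then of_nat m * outer_log (j div m) else 0) =
      (\<Sum>m\<in>{m\<in>{1..j}. m dvd j}. of_nat m * outer_log (j div m))"
      by (rule sum.mono_neutral_cong_right) (use M in \<open>auto dest: dvd_imp_le\<close>)
    also have "\<dots> = (\<Sum>k\<in>{k\<in>{1..j}. k dvd j}. outer_log k * of_nat (j div k))"
      by (rule sum.reindex_bij_witness[where i = "\<lambda>k. j div k" and j = "\<lambda>k. j div k"])
         (auto elim!: dvdE simp: mult.commute)
    finally show ?thesis by (simp add: log_series_def)
  qed
  then show "(\<lambda>M. \<Sum>m=1..M. fps_nth (- single_log m (fps_const (- inverse u)) +
      Abs_fps (\<lambda>j. if m dvd j \<and> 0 < j then of_nat m * inner_log (j div m) else 0)) j) \<longlonglongrightarrow> fps_nth (log_series outer_log) j"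
    unfolding nth by (intro tendsto_eventually) (auto simp: eventually_sequentially)
qed


section \<open>Doubled distinct partitions\<close>

definition col :: "nat list \<Rightarrow> nat \<Rightarrow> nat" where
  "col xs j = card {i. j \<le> part xs i}"

lemma part_0 [simp]: "part xs 0 = 0"
  by (simp add: part_def)

lemma part_antimono:
  assumes "xs \<in> partitions" "1 \<le> i" "i \<le> i'"
  shows "part xs i' \<le> part xs i"
proof (cases "i' \<le> length xs")
  case True
  have "i - 1 < i' - 1 \<or> i = i'" using assms by auto
  then show ?thesis
    using assms True sorted_wrt_nth_less[of "(\<ge>)" xs "i - 1" "i' - 1"]
    by (auto simp: partitions_def part_def)
qed (use assms in \<open>simp add: part_def\<close>)

lemma part_pos_iff:
  assumes "xs \<in> partitions"
  shows "0 < part xs i \<longleftrightarrow> 1 \<le> i \<and> i \<le> length xs"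
proof -
  have "xs ! (i - 1) \<noteq> 0" if "1 \<le> i" "i \<le> length xs"
  proof -
    have "xs ! (i - 1) \<in> set xs" using that by (intro nth_mem) auto
    then show ?thesis using assms by (metis (mono_tags, lifting) mem_Collect_eq partitions_def)
  qed
  then show ?thesis by (auto simp: part_def)
qed

lemma partition_eqI:
  assumes "xs \<in> partitions" "ys \<in> partitions" and eq: "\<And>i. 1 \<le> i \<Longrightarrow> part xs i = part ys i"
  shows "xs = ys"
proof (rule nth_equalityI)
  have "i \<le> length xs \<longleftrightarrow> i \<le> length ys" if "1 \<le> i" for i
    using part_pos_iff[OF assms(1), of i] part_pos_iff[OF assms(2), of i] eq[OF that] that by simp
  then show len: "length xs = length ys"
    by (metis One_nat_def Suc_leI le_antisym le_refl length_greater_0_conv list.size(3) neq0_conv not_less_zero zero_le)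
  fix i assume "i < length xs"
  then show "xs ! i = ys ! i" using eq[of "Suc i"] len by (simp add: part_def)
qed

lemma finite_part_ge: "1 \<le> j \<Longrightarrow> finite {i. j \<le> part xs i}"
  by (rule finite_subset[of _ "{..length xs}"]) (auto simp: part_def split: if_splits)

text \<open>For fixed j the rows of length at least j form an initial segment, hence the one
  determined by their number.\<close>

lemma part_le_iff_col:
  assumes "xs \<in> partitions" "1 \<le> i" "1 \<le> j"
  shows "j \<le> part xs i \<longleftrightarrow> i \<le> col xs j"
proof -
  define S where "S = {i. j \<le> part xs i}"
  have fin: "finite S" unfolding S_def by (rule finite_part_ge[OF assms(3)])
  have S1: "1 \<le> k" if "k \<in> S" for k
    using that assms(3) by (cases k) (auto simp: S_def)
  have down: "k' \<in> S" if "k \<in> S" "1 \<le> k'" "k' \<le> k" for k k'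
    using part_antimono[OF assms(1) that(2,3)] that(1) by (auto simp: S_def)
  have "S = {1..card S}"
  proof (cases "S = {}")
    case False
    have "S = {1..Max S}"
    proof
      show "S \<subseteq> {1..Max S}" using S1 fin by auto
      show "{1..Max S} \<subseteq> S" using down Max_in[OF fin False] by auto
    qed
    then show ?thesis by (metis card_atLeastAtMost diff_Suc_1)
  qed simp
  then have "i \<in> S \<longleftrightarrow> i \<le> card S" using assms(2) by (metis atLeastAtMost_iff)
  then show ?thesis by (simp add: S_def col_def)
qed

lemma part_map_upt: "1 \<le> j \<Longrightarrow> part (map f [1..<Suc n]) j = (if j \<le> n then f j else 0)"
  by (simp add: part_def del: upt_Suc One_nat_def)

lemma part_conjugate:
  assumes xs: "xs \<in> partitions" and j: "1 \<le> j"
  shows "part (conjugate xs) j = col xs j"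
proof (cases "j \<le> part xs 1")
  case True
  then show ?thesis using j by (simp only: conjugate_def part_map_upt col_def if_True)
next
  case False
  then have "{i. j \<le> part xs i} = {}"
  proof -
    have "\<not> j \<le> part xs i" for i
    proof (cases "i = 0")
      case True then show ?thesis using j by simp
    next
      case False
      then show ?thesis using part_antimono[OF xs, of 1 i] \<open>\<not> j \<le> part xs 1\<close> by auto
    qed
    then show ?thesis by auto
  qed
  then show ?thesis using False j by (simp only: conjugate_def part_map_upt col_def if_False card.empty)
qed

text \<open>The equivalence makes r decreasing and c 1 the number of its nonzero values. A partition
  can thus be given by its rows and columns at once.\<close>

lemma partition_of_profile:
  fixes r c :: "nat \<Rightarrow> nat"
  assumes prof: "\<And>i j. 1 \<le> i \<Longrightarrow> 1 \<le> j \<Longrightarrow> j \<le> r i \<longleftrightarrow> i \<le> c j"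
  defines "xs \<equiv> map r [1..<Suc (c 1)]"
  shows "xs \<in> partitions" "1 \<le> i \<Longrightarrow> part xs i = r i" "1 \<le> j \<Longrightarrow> col xs j = c j"
proof -
  have anti: "r i' \<le> r i" if "1 \<le> i" "i \<le> i'" for i i'
  proof (cases "r i' = 0")
    case False
    then have "i' \<le> c (r i')" using prof[of i' "r i'"] that by auto
    then show ?thesis using prof[of i "r i'"] that False by auto
  qed simp
  have nth: "xs ! k = r (Suc k)" if "k < c 1" for k
    using that by (simp add: xs_def del: upt_Suc)
  have len: "length xs = c 1" by (simp add: xs_def)
  have "0 \<notin> set xs"
  proof
    assume "0 \<in> set xs"
    then obtain i where "1 \<le> i" "i \<le> c 1" "r i = 0" by (auto simp: xs_def simp del: upt_Suc)
    then show False using prof[of i 1] by auto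
  qed
  moreover have "sorted_wrt (\<ge>) xs"
    unfolding sorted_wrt_iff_nth_less using nth len anti by auto
  ultimately show p: "xs \<in> partitions" by (simp add: partitions_def)
  show part: "part xs i = r i" if "1 \<le> i" for i
  proof (cases "i \<le> c 1")
    case True
    then show ?thesis using that nth[of "i - 1"] len by (simp add: part_def)
  next
    case False
    then have "r i = 0" using prof[of i 1] that by auto
    then show ?thesis using False len by (simp add: part_def)
  qed
  show "col xs j = c j" if j: "1 \<le> j"
  proof -
    have "i \<le> col xs j \<longleftrightarrow> i \<le> c j" if "1 \<le> i" for i
      using part_le_iff_col[OF p that j] prof[OF that j] part[OF that] by simp
    then show ?thesis by (metis One_nat_def Suc_leI le_antisym le_refl neq0_conv zero_le)
  qed
qed

lemma conjugate_partition:
  assumes xs: "xs \<in> partitions"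
  shows "conjugate xs \<in> partitions"
proof -
  have "conjugate xs = map (col xs) [1..<Suc (part xs 1)]"
    by (simp add: conjugate_def col_def)
  moreover have "map (col xs) [1..<Suc (part xs 1)] \<in> partitions"
    by (rule partition_of_profile(1)[of "col xs" "part xs"]) (use part_le_iff_col[OF xs] in auto)
  ultimately show ?thesis by simp
qed

lemma col_conjugate:
  assumes xs: "xs \<in> partitions" and i: "1 \<le> i"
  shows "col (conjugate xs) i = part xs i"
proof -
  have "j \<le> col (conjugate xs) i \<longleftrightarrow> j \<le> part xs i" if j: "1 \<le> j" for j
    using part_le_iff_col[OF conjugate_partition[OF xs] j i] part_conjugate[OF xs j] part_le_iff_col[OF xs i j] by simp
  then show ?thesis by (metis One_nat_def Suc_leI le_antisym le_refl neq0_conv zero_le)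
qed

lemma conjugate_conjugate: "xs \<in> partitions \<Longrightarrow> conjugate (conjugate xs) = xs"
  by (rule partition_eqI) (simp_all add: conjugate_partition part_conjugate col_conjugate)

lemma durfee_iff:
  assumes xs: "xs \<in> partitions" and i: "1 \<le> i"
  shows "i \<le> durfee xs \<longleftrightarrow> i \<le> part xs i"
proof -
  define S where "S = {s. 1 \<le> s \<and> s \<le> part xs s}"
  have fin: "finite S"
    by (rule finite_subset[OF _ finite_part_ge[of 1 xs]]) (auto simp: S_def)
  have dur: "durfee xs = Max (insert 0 S)" by (simp add: durfee_def S_def)
  show ?thesis
  proof
    assume "i \<le> durfee xs"
    then have "durfee xs \<in> S" using Max_in[of "insert 0 S"] fin i by (auto simp: dur)
    then show "i \<le> part xs i"
      using part_antimono[OF xs i \<open>i \<le> durfee xs\<close>] \<open>i \<le> durfee xs\<close> by (auto simp: S_def)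
  next
    assume "i \<le> part xs i"
    then show "i \<le> durfee xs" unfolding dur using fin i by (intro Max_ge) (auto simp: S_def)
  qed
qed

lemma nat_eqI_ge1: "(\<And>i. 1 \<le> i \<Longrightarrow> i \<le> a \<longleftrightarrow> i \<le> b) \<Longrightarrow> a = b" for a b :: nat
  by (metis One_nat_def Suc_leI le_antisym le_refl neq0_conv zero_le)

lemma durfee_conjugate:
  assumes xs: "xs \<in> partitions"
  shows "durfee (conjugate xs) = durfee xs"
proof (rule nat_eqI_ge1)
  fix i :: nat assume "1 \<le> i"
  then show "i \<le> durfee (conjugate xs) \<longleftrightarrow> i \<le> durfee xs"
    using xs by (simp add: durfee_iff conjugate_partition part_conjugate part_le_iff_col)
qed

lemma DD'_iff:
  "xs \<in> DD' \<longleftrightarrow> xs \<in> partitions \<and> (\<forall>i\<in>{1..durfee xs}. col xs i = part xs i + 1)"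
proof
  assume "xs \<in> DD'"
  then obtain ys where ys: "ys \<in> partitions" "xs = conjugate ys"
      "\<And>i. i \<in> {1..durfee ys} \<Longrightarrow> part ys i = part (conjugate ys) i + 1"
    by (auto simp: DD'_def DD_def)
  then show "xs \<in> partitions \<and> (\<forall>i\<in>{1..durfee xs}. col xs i = part xs i + 1)"
    by (auto simp: conjugate_partition durfee_conjugate col_conjugate)
next
  assume a: "xs \<in> partitions \<and> (\<forall>i\<in>{1..durfee xs}. col xs i = part xs i + 1)"
  then have "conjugate xs \<in> DD"
    by (auto simp: DD_def conjugate_partition durfee_conjugate part_conjugate col_conjugate conjugate_conjugate)
  then show "xs \<in> DD'" using a conjugate_conjugate unfolding DD'_def by (metis image_eqI)
qed

section \<open>Diagonal hooks and the hook lengths they determine\<close>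

definition diag_part :: "nat list \<Rightarrow> nat \<Rightarrow> nat" where
  "diag_part xs i = part xs i + 1 - i"

text \<open>For a partition in DD' the leg of a diagonal box exceeds its arm by one, so its hook
  length is exactly twice \<open>diag_part\<close>.\<close>

definition diag_set :: "nat list \<Rightarrow> nat set" where
  "diag_set xs = diag_part xs ` {1..durfee xs}"

locale dd_partition =
  fixes xs :: "nat list"
  assumes dd: "xs \<in> DD'"
begin

abbreviation "r \<equiv> part xs"
abbreviation "c \<equiv> col xs"
abbreviation "d \<equiv> durfee xs"
abbreviation "M \<equiv> diag_part xs"
abbreviation "A \<equiv> diag_set xs"

lemma xs: "xs \<in> partitions" using dd DD'_iff by blast

lemma c_eq: "1 \<le> i \<Longrightarrow> i \<le> d \<Longrightarrow> c i = r i + 1"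
  using dd unfolding DD'_iff by auto

lemma r_ge: "1 \<le> i \<Longrightarrow> i \<le> d \<Longrightarrow> d \<le> r i"
  using durfee_iff[OF xs, of d] part_antimono[OF xs, of i d] by (cases "d = 0") auto

lemma r_small: "d < i \<Longrightarrow> r i < i"
  using durfee_iff[OF xs, of i] by auto

lemma rc: "1 \<le> i \<Longrightarrow> 1 \<le> j \<Longrightarrow> j \<le> r i \<longleftrightarrow> i \<le> c j"
  by (rule part_le_iff_col[OF xs])

lemma c_small: "d < j \<Longrightarrow> c j \<le> d"
  using rc[of "Suc d" j] r_small[of "Suc d"] by (cases "Suc d \<le> c j") auto

lemma M_eq: "1 \<le> i \<Longrightarrow> i \<le> d \<Longrightarrow> M i + i = r i + 1"
  using r_ge[of i] by (simp add: diag_part_def)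

lemma M_pos: "1 \<le> i \<Longrightarrow> i \<le> d \<Longrightarrow> 1 \<le> M i"
  using r_ge[of i] by (simp add: diag_part_def)

lemma M_less: "1 \<le> i \<Longrightarrow> i < i' \<Longrightarrow> i' \<le> d \<Longrightarrow> M i' < M i"
  using M_eq[of i] M_eq[of i'] part_antimono[OF xs, of i i'] by linarith

lemma inj_M: "inj_on M {1..d}"
  by (rule linorder_inj_onI) (use M_less in \<open>force dest: less_imp_neq\<close>)+

lemma finite_A: "finite A" by (simp add: diag_set_def)

lemma card_A: "card A = d"
  unfolding diag_set_def by (subst card_image[OF inj_M]) simp

lemma prod_A: "(\<Prod>m\<in>A. f m) = (\<Prod>i=1..d. f (M i))" for f :: "nat \<Rightarrow> 'b::comm_monoid_mult"
  by (simp only: diag_set_def prod.reindex[OF inj_M] o_def)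

lemma sum_A: "(\<Sum>m\<in>A. f m) = (\<Sum>i=1..d. f (M i))" for f :: "nat \<Rightarrow> 'b::comm_monoid_add"
  by (simp only: diag_set_def sum.reindex[OF inj_M] o_def)

lemma A_below:
  assumes "1 \<le> i" "i \<le> d"
  shows "{m\<in>A. m < M i} = M ` {i+1..d}"
proof
  show "{m\<in>A. m < M i} \<subseteq> M ` {i+1..d}"
  proof
    fix m assume "m \<in> {m\<in>A. m < M i}"
    then obtain k where k: "k \<in> {1..d}" "m = M k" "M k < M i" by (auto simp: diag_set_def)
    have "i < k"
    proof (rule ccontr)
      assume "\<not> i < k"
      then have "k < i \<or> k = i" by auto
      then show False using M_less[of k i] k assms by auto
    qed
    then show "m \<in> M ` {i+1..d}" using k by auto
  qed
  show "M ` {i+1..d} \<subseteq> {m\<in>A. m < M i}"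
    using M_less assms by (auto simp: diag_set_def)
qed

lemma card_A_below: "1 \<le> i \<Longrightarrow> i \<le> d \<Longrightarrow> card {m\<in>A. m < M i} = d - i"
  unfolding A_below by (subst card_image) (auto intro: inj_on_subset[OF inj_M])

lemma A_pos: "m \<in> A \<Longrightarrow> 1 \<le> m"
  using M_pos by (auto simp: diag_set_def)

text \<open>To the right of the Durfee square the box (i, j) has hook M i - (j - c j), so these
  numbers index the boxes. They avoid A because j <= r k and k <= c j are equivalent, and a count of
  r i - d elements on both sides gives equality.\<close>

lemma right_holes:
  assumes i: "1 \<le> i" "i \<le> d"
  shows "bij_betw (\<lambda>j. j - c j) {d+1..r i} ({1..<M i} - A)"
proof -
  have anti: "c j' \<le> c j" if "1 \<le> j" "j \<le> j'" for j j'
  proof (cases "c j' = 0")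
    case False
    then show ?thesis using rc[of "c j'" j'] rc[of "c j'" j] that by auto
  qed simp
  have le: "c j < j" if "d < j" for j using c_small[OF that] that by simp
  have inj: "inj_on (\<lambda>j. j - c j) {d+1..r i}"
  proof (rule linorder_inj_onI)
    fix j j' assume a: "j < j'" "j \<in> {d+1..r i}" "j' \<in> {d+1..r i}"
    then have "c j' \<le> c j" "c j < j" using anti[of j j'] le[of j] by auto
    then show "j - c j \<noteq> j' - c j'" using a by linarith
  qed auto
  have sub: "(\<lambda>j. j - c j) ` {d+1..r i} \<subseteq> {1..<M i} - A"
  proof
    fix t assume "t \<in> (\<lambda>j. j - c j) ` {d+1..r i}"
    then obtain j where "j \<in> {d+1..r i}" and tj: "t = j - c j" by (elim imageE)
    then have j: "d < j" "j \<le> r i" "t = j - c j" by auto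
    have t: "t + c j = j" using le[OF j(1)] j by simp
    have ic: "i \<le> c j" using rc[of i j] i j by auto
    have "t \<notin> A"
    proof
      assume "t \<in> A"
      then obtain k where k: "1 \<le> k" "k \<le> d" "t = M k" by (auto simp: diag_set_def)
      have Mk: "t + k = r k + 1" using M_eq[OF k(1,2)] k by simp
      show False
      proof (cases "j \<le> r k")
        case True
        then have "k \<le> c j" using rc[of k j] k j by auto
        then show False using t Mk True by linarith
      next
        case False
        then have "c j < k" using rc[of k j] k j by auto
        then show False using t Mk False by linarith
      qed
    qed
    moreover have "1 \<le> t" using t le[OF j(1)] by linarith
    moreover have "t < M i" using t ic j M_eq[OF i] by linarith
    ultimately show "t \<in> {1..<M i} - A" by auto
  qed
  have "card ({1..<M i} - A) = (M i - 1) - (d - i)"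
  proof -
    have "{1..<M i} - A = {1..<M i} - {m\<in>A. m < M i}" by auto
    moreover have "{m\<in>A. m < M i} \<subseteq> {1..<M i}" using A_pos by auto
    ultimately show ?thesis using finite_A card_A_below[OF i] by (simp add: card_Diff_subset)
  qed
  also have "\<dots> = r i - d" using M_eq[OF i] i r_ge[OF i] by linarith
  finally have "card ((\<lambda>j. j - c j) ` {d+1..r i}) = card ({1..<M i} - A)"
    using card_image[OF inj] by simp
  then have "(\<lambda>j. j - c j) ` {d+1..r i} = {1..<M i} - A"
    by (intro card_subset_eq sub) auto
  then show ?thesis using inj by (simp add: bij_betw_def)
qed

text \<open>The analogue of \<open>right_holes\<close> below the Durfee square. Here 0 is a possible
  value, since r i < i allows r i = i - 1; this matches the column length c j = r j + 1.\<close>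

lemma lower_holes:
  assumes j: "1 \<le> j" "j \<le> d"
  shows "bij_betw (\<lambda>i. i - 1 - r i) {d+1..c j} ({..<M j} - A)"
proof -
  have inj: "inj_on (\<lambda>i. i - 1 - r i) {d+1..c j}"
  proof (rule linorder_inj_onI)
    fix i i' assume a: "i < i'" "i \<in> {d+1..c j}" "i' \<in> {d+1..c j}"
    then have "r i' \<le> r i" "r i < i" using part_antimono[OF xs, of i i'] r_small[of i] by auto
    then show "i - 1 - r i \<noteq> i' - 1 - r i'" using a by linarith
  qed auto
  have sub: "(\<lambda>i. i - 1 - r i) ` {d+1..c j} \<subseteq> {..<M j} - A"
  proof
    fix t assume "t \<in> (\<lambda>i. i - 1 - r i) ` {d+1..c j}"
    then obtain i where "i \<in> {d+1..c j}" and ti: "t = i - 1 - r i" by (elim imageE)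
    then have i: "d < i" "i \<le> c j" "t = i - 1 - r i" by auto
    have t: "t + 1 + r i = i" using r_small[OF i(1)] i by simp
    have jr: "j \<le> r i" using rc[of i j] i j by auto
    have "t \<notin> A"
    proof
      assume "t \<in> A"
      then obtain k where k: "1 \<le> k" "k \<le> d" "t = M k" by (auto simp: diag_set_def)
      have Mk: "t + k = c k" using M_eq[OF k(1,2)] k c_eq by simp
      show False
      proof (cases "i \<le> c k")
        case True
        then have "k \<le> r i" using rc[of i k] k i by auto
        then show False using t Mk True by linarith
      next
        case False
        then have "r i < k" using rc[of i k] k i by auto
        then show False using t Mk False by linarith
      qed
    qed
    moreover have "t < M j" using t jr i M_eq[OF j] c_eq[OF j] by linarith
    ultimately show "t \<in> {..<M j} - A" by auto
  qed
  have "card ({..<M j} - A) = M j - (d - j)"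
  proof -
    have "{..<M j} - A = {..<M j} - {m\<in>A. m < M j}" by auto
    moreover have "{m\<in>A. m < M j} \<subseteq> {..<M j}" by auto
    ultimately show ?thesis using finite_A card_A_below[OF j] by (simp add: card_Diff_subset)
  qed
  also have "\<dots> = c j - d" using M_eq[OF j] c_eq[OF j] j r_ge[OF j] by linarith
  finally have "card ((\<lambda>i. i - 1 - r i) ` {d+1..c j}) = card ({..<M j} - A)"
    using card_image[OF inj] by simp
  then have "(\<lambda>i. i - 1 - r i) ` {d+1..c j} = {..<M j} - A"
    by (intro card_subset_eq sub) auto
  then show ?thesis using inj by (simp add: bij_betw_def)
qed

lemma hook_eq: "1 \<le> j \<Longrightarrow> hook xs (i, j) = (r i - j) + (c j - i) + 1"
  by (simp add: hook_def part_conjugate[OF xs])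

lemma boxes_split:
  "boxes xs = (SIGMA i:{1..d}. {i..r i}) \<union> (\<lambda>(j, i). (i, j)) ` (SIGMA j:{1..d}. {j+1..c j})"
    (is "_ = ?U \<union> ?L")
proof
  show "boxes xs \<subseteq> ?U \<union> ?L"
  proof
    fix s assume "s \<in> boxes xs"
    then obtain i j where s: "s = (i, j)" "1 \<le> i" "1 \<le> j" "j \<le> r i" by (auto simp: boxes_def)
    show "s \<in> ?U \<union> ?L"
    proof (cases "i \<le> j")
      case True
      then have "i \<le> d" using durfee_iff[OF xs, of i] s by auto
      then show ?thesis using True s by auto
    next
      case False
      then have "j \<le> r j" using part_antimono[OF xs, of j i] s by auto
      then have "j \<le> d" using durfee_iff[OF xs, of j] s by auto
      then show ?thesis using False s rc[of i j] by (auto simp: image_iff)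
    qed
  qed
  show "?U \<union> ?L \<subseteq> boxes xs"
    using rc by (fastforce simp: boxes_def)
qed

text \<open>In row i the diagonal box has hook 2 M i, the boxes further right in the Durfee square
  have M i + M k, and the holes index the others; columns below the diagonal are treated alike. A
  pair m' < m collects its two boxes of hook m + m', one on each side of the diagonal.\<close>

lemma boxes_prod:
  fixes G G' :: "nat \<Rightarrow> 'b::comm_monoid_mult"
  shows "(\<Prod>s\<in>boxes xs. case s of (i, j) \<Rightarrow> if i > j then G' (hook xs s) else G (hook xs s)) =
     (\<Prod>m\<in>A. G (2 * m) * (\<Prod>t\<in>{1..<m}-A. G (m - t)) * (\<Prod>t\<in>{..<m}-A. G' (m - t))
        * (\<Prod>m'\<in>{m'\<in>A. m' < m}. G (m + m') * G' (m + m')))"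
proof -
  let ?f = "\<lambda>s. case s of (i, j) \<Rightarrow> if i > j then G' (hook xs s) else G (hook xs s)"
  let ?U = "SIGMA i:{1..d}. {i..r i}"
  let ?L' = "SIGMA j:{1..d}. {j+1..c j}"
  let ?L = "(\<lambda>(j, i). (i, j)) ` ?L'"
  have "prod ?f (boxes xs) = prod ?f ?U * prod ?f ?L"
    unfolding boxes_split by (rule prod.union_disjoint) auto
  also have "prod ?f ?U = (\<Prod>i=1..d. \<Prod>j\<in>{i..r i}. G (hook xs (i, j)))"
    by (subst prod.Sigma) (auto intro!: prod.cong)
  also have "prod ?f ?L = (\<Prod>(j, i)\<in>?L'. G' (hook xs (i, j)))"
    by (subst prod.reindex) (auto simp: inj_on_def intro!: prod.cong)
  also have "\<dots> = (\<Prod>j=1..d. \<Prod>i\<in>{j+1..c j}. G' (hook xs (i, j)))"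
    by (subst prod.Sigma) auto
  also have "(\<Prod>i=1..d. \<Prod>j\<in>{i..r i}. G (hook xs (i, j))) =
     (\<Prod>i=1..d. G (2 * M i) * (\<Prod>k\<in>{i+1..d}. G (M i + M k)) * (\<Prod>t\<in>{1..<M i}-A. G (M i - t)))"
  proof (rule prod.cong[OF refl])
    fix i assume "i \<in> {1..d}"
    then have i: "1 \<le> i" "i \<le> d" by auto
    have "{i..r i} = insert i {i+1..d} \<union> {d+1..r i}" using i r_ge[OF i] by auto
    then have "(\<Prod>j\<in>{i..r i}. G (hook xs (i, j))) = (\<Prod>j\<in>insert i {i+1..d} \<union> {d+1..r i}. G (hook xs (i, j)))"
      by (rule arg_cong)
    also have "\<dots> = (\<Prod>j\<in>insert i {i+1..d}. G (hook xs (i, j))) * (\<Prod>j\<in>{d+1..r i}. G (hook xs (i, j)))"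
      by (rule prod.union_disjoint) (use i in auto)
    also have "(\<Prod>j\<in>insert i {i+1..d}. G (hook xs (i, j))) = (\<Prod>j\<in>insert i {i+1..d}. G (M i + M j))"
    proof (rule prod.cong[OF refl])
      fix j assume "j \<in> insert i {i+1..d}"
      then have j: "1 \<le> j" "j \<le> d" using i by auto
      have "hook xs (i, j) = M i + M j"
        unfolding hook_eq[OF j(1)] using M_eq[OF i] M_eq[OF j] c_eq[OF j] r_ge[OF i] r_ge[OF j] i j by linarith
      then show "G (hook xs (i, j)) = G (M i + M j)" by simp
    qed
    also have "\<dots> = G (2 * M i) * (\<Prod>k\<in>{i+1..d}. G (M i + M k))" by (simp add: mult_2)
    also have "(\<Prod>j\<in>{d+1..r i}. G (hook xs (i, j))) = (\<Prod>j\<in>{d+1..r i}. G (M i - (j - c j)))"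
    proof (rule prod.cong[OF refl])
      fix j assume j: "j \<in> {d+1..r i}"
      then have "c j \<le> d" "i \<le> c j" using c_small[of j] rc[of i j] i by auto
      then have "hook xs (i, j) = M i - (j - c j)"
        using j M_eq[OF i] by (subst hook_eq) auto
      then show "G (hook xs (i, j)) = G (M i - (j - c j))" by simp
    qed
    also have "\<dots> = (\<Prod>t\<in>{1..<M i}-A. G (M i - t))"
      by (rule prod.reindex_bij_betw[OF right_holes[OF i], of "\<lambda>t. G (M i - t)"])
    finally show "(\<Prod>j\<in>{i..r i}. G (hook xs (i, j))) =
      G (2 * M i) * (\<Prod>k\<in>{i+1..d}. G (M i + M k)) * (\<Prod>t\<in>{1..<M i}-A. G (M i - t))" .
  qed
  also have "(\<Prod>j=1..d. \<Prod>i\<in>{j+1..c j}. G' (hook xs (i, j))) =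
     (\<Prod>j=1..d. (\<Prod>k\<in>{j+1..d}. G' (M j + M k)) * (\<Prod>t\<in>{..<M j}-A. G' (M j - t)))"
  proof (rule prod.cong[OF refl])
    fix j assume "j \<in> {1..d}"
    then have j: "1 \<le> j" "j \<le> d" by auto
    have "{j+1..c j} = {j+1..d} \<union> {d+1..c j}" using j r_ge[OF j] c_eq[OF j] by auto
    then have "(\<Prod>i\<in>{j+1..c j}. G' (hook xs (i, j))) = (\<Prod>i\<in>{j+1..d} \<union> {d+1..c j}. G' (hook xs (i, j)))"
      by (rule arg_cong)
    also have "\<dots> = (\<Prod>i\<in>{j+1..d}. G' (hook xs (i, j))) * (\<Prod>i\<in>{d+1..c j}. G' (hook xs (i, j)))"
      by (rule prod.union_disjoint) auto
    also have "(\<Prod>i\<in>{j+1..d}. G' (hook xs (i, j))) = (\<Prod>k\<in>{j+1..d}. G' (M j + M k))"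
    proof (rule prod.cong[OF refl])
      fix i assume "i \<in> {j+1..d}"
      then have i: "1 \<le> i" "i \<le> d" "j < i" using j by auto
      have "hook xs (i, j) = M j + M i"
        unfolding hook_eq[OF j(1)] using M_eq[OF i(1,2)] M_eq[OF j] c_eq[OF j] r_ge[OF i(1,2)] r_ge[OF j] i j by linarith
      then show "G' (hook xs (i, j)) = G' (M j + M i)" by simp
    qed
    also have "(\<Prod>i\<in>{d+1..c j}. G' (hook xs (i, j))) = (\<Prod>i\<in>{d+1..c j}. G' (M j - (i - 1 - r i)))"
    proof (rule prod.cong[OF refl])
      fix i assume i: "i \<in> {d+1..c j}"
      then have "r i < i" "j \<le> r i" using r_small[of i] rc[of i j] j by auto
      then have "hook xs (i, j) = M j - (i - 1 - r i)"
        unfolding hook_eq[OF j(1)] using i M_eq[OF j] c_eq[OF j] by auto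
      then show "G' (hook xs (i, j)) = G' (M j - (i - 1 - r i))" by simp
    qed
    also have "\<dots> = (\<Prod>t\<in>{..<M j}-A. G' (M j - t))"
      by (rule prod.reindex_bij_betw[OF lower_holes[OF j], of "\<lambda>t. G' (M j - t)"])
    finally show "(\<Prod>i\<in>{j+1..c j}. G' (hook xs (i, j))) =
      (\<Prod>k\<in>{j+1..d}. G' (M j + M k)) * (\<Prod>t\<in>{..<M j}-A. G' (M j - t))" .
  qed
  also have "(\<Prod>i=1..d. G (2 * M i) * (\<Prod>k\<in>{i+1..d}. G (M i + M k)) * (\<Prod>t\<in>{1..<M i}-A. G (M i - t))) *
     (\<Prod>j=1..d. (\<Prod>k\<in>{j+1..d}. G' (M j + M k)) * (\<Prod>t\<in>{..<M j}-A. G' (M j - t))) =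
     (\<Prod>i=1..d. G (2 * M i) * (\<Prod>t\<in>{1..<M i}-A. G (M i - t)) * (\<Prod>t\<in>{..<M i}-A. G' (M i - t))
        * (\<Prod>k\<in>{i+1..d}. G (M i + M k) * G' (M i + M k)))"
    unfolding prod.distrib[symmetric] by (rule prod.cong[OF refl]) (simp add: prod.distrib mult_ac)
  also have "\<dots> = (\<Prod>i=1..d. G (2 * M i) * (\<Prod>t\<in>{1..<M i}-A. G (M i - t)) * (\<Prod>t\<in>{..<M i}-A. G' (M i - t))
        * (\<Prod>m'\<in>{m'\<in>A. m' < M i}. G (M i + m') * G' (M i + m')))"
  proof (rule prod.cong[OF refl])
    fix i assume "i \<in> {1..d}"
    then have i: "1 \<le> i" "i \<le> d" by auto
    have "inj_on M {i+1..d}" by (rule inj_on_subset[OF inj_M]) auto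
    then have "(\<Prod>m'\<in>{m'\<in>A. m' < M i}. G (M i + m') * G' (M i + m')) = (\<Prod>k\<in>{i+1..d}. G (M i + M k) * G' (M i + M k))"
      unfolding A_below[OF i] by (simp add: prod.reindex)
    then show "G (2 * M i) * (\<Prod>t\<in>{1..<M i}-A. G (M i - t)) * (\<Prod>t\<in>{..<M i}-A. G' (M i - t))
        * (\<Prod>k\<in>{i+1..d}. G (M i + M k) * G' (M i + M k)) =
      G (2 * M i) * (\<Prod>t\<in>{1..<M i}-A. G (M i - t)) * (\<Prod>t\<in>{..<M i}-A. G' (M i - t))
        * (\<Prod>m'\<in>{m'\<in>A. m' < M i}. G (M i + m') * G' (M i + m'))" by simp
  qed
  also have "\<dots> = (\<Prod>m\<in>A. G (2 * m) * (\<Prod>t\<in>{1..<m}-A. G (m - t)) * (\<Prod>t\<in>{..<m}-A. G' (m - t))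
        * (\<Prod>m'\<in>{m'\<in>A. m' < m}. G (m + m') * G' (m + m')))"
    by (rule prod_A[symmetric])
  finally show ?thesis .
qed

lemma diagonal_prod:
  fixes G :: "nat \<Rightarrow> 'b::comm_monoid_mult"
  shows "(\<Prod>s\<in>diagonal xs. G (hook xs s div 2)) = (\<Prod>m\<in>A. G m)"
proof -
  have "diagonal xs = (\<lambda>i. (i, i)) ` {1..d}"
    using durfee_iff[OF xs] by (auto simp: diagonal_def boxes_def)
  then have "(\<Prod>s\<in>diagonal xs. G (hook xs s div 2)) = (\<Prod>i=1..d. G (hook xs (i, i) div 2))"
    by (simp add: prod.reindex inj_on_def)
  also have "\<dots> = (\<Prod>i=1..d. G (M i))"
  proof (rule prod.cong[OF refl])
    fix i assume "i \<in> {1..d}"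
    then have i: "1 \<le> i" "i \<le> d" by auto
    have "hook xs (i, i) = 2 * M i"
      unfolding hook_eq[OF i(1)] using M_eq[OF i] c_eq[OF i] r_ge[OF i] i by linarith
    then show "G (hook xs (i, i) div 2) = G (M i)" by simp
  qed
  also have "\<dots> = (\<Prod>m\<in>A. G m)"
    by (rule prod_A[symmetric])
  finally show ?thesis .
qed

lemma sum_list_eq: "sum_list xs = 2 * \<Sum>A"
proof -
  have "sum_list xs = (\<Sum>i=1..length xs. r i)"
  proof -
    have "sum_list xs = (\<Sum>k<length xs. xs ! k)" by (simp add: sum_list_sum_nth atLeast0LessThan)
    also have "\<dots> = (\<Sum>i=1..length xs. r i)"
      by (rule sum.reindex_bij_witness[where i = "\<lambda>i. i - 1" and j = Suc]) (auto simp: part_def)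
    finally show ?thesis .
  qed
  also have "\<dots> = card (SIGMA i:{1..length xs}. {1..r i})" by simp
  also have "(SIGMA i:{1..length xs}. {1..r i}) = boxes xs"
    by (auto simp: boxes_def part_def split: if_splits)
  also have "card (boxes xs) = (\<Sum>i=1..d. r i + 1 - i) + (\<Sum>j=1..d. c j - j)"
  proof -
    have "inj_on (\<lambda>(j, i). (i, j)) (SIGMA j:{1..d}. {j+1..c j})" by (auto simp: inj_on_def)
    then have l: "card ((\<lambda>(j, i). (i, j)) ` (SIGMA j:{1..d}. {j+1..c j})) = (\<Sum>j=1..d. c j - j)"
      by (simp add: card_image)
    have u: "card (SIGMA i:{1..d}. {i..r i}) = (\<Sum>i=1..d. r i + 1 - i)" by simp
    show ?thesis unfolding boxes_split l[symmetric] u[symmetric]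
      by (rule card_Un_disjoint) auto
  qed
  also have "(\<Sum>j=1..d. c j - j) = (\<Sum>i=1..d. r i + 1 - i)"
    by (rule sum.cong) (auto simp: c_eq)
  also have "(\<Sum>i=1..d. r i + 1 - i) = \<Sum>A"
    unfolding sum_A by (simp only: diag_part_def)
  finally show ?thesis by simp
qed

lemma rank_M:
  assumes "1 \<le> i" "i \<le> d"
  shows "card {m\<in>A. M i < m} = i - 1"
proof -
  have "{m\<in>A. M i < m} = M ` {1..<i}"
  proof
    show "{m\<in>A. M i < m} \<subseteq> M ` {1..<i}"
    proof
      fix m assume "m \<in> {m\<in>A. M i < m}"
      then obtain k where k: "k \<in> {1..d}" "m = M k" "M i < M k" by (auto simp: diag_set_def)
      have "k < i"
      proof (rule ccontr)
        assume "\<not> k < i"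
        then have "i < k \<or> k = i" by auto
        then show False using M_less[of i k] k assms by auto
      qed
      then show "m \<in> M ` {1..<i}" using k by auto
    qed
    show "M ` {1..<i} \<subseteq> {m\<in>A. M i < m}"
      using M_less assms by (auto simp: diag_set_def)
  qed
  moreover have "inj_on M {1..<i}" by (rule inj_on_subset[OF inj_M]) (use assms in auto)
  ultimately show ?thesis using card_image[of M "{1..<i}"] by simp
qed

end

text \<open>The size of the set is the Durfee number and \<open>diag_part xs i\<close> is its i-th
  largest element, which fixes the first rows and, by the condition of DD', the first columns. These
  columns determine all later rows.\<close>

lemma diag_set_inject:
  assumes "xs \<in> DD'" "ys \<in> DD'" and eq: "diag_set xs = diag_set ys"
  shows "xs = ys"
proof -
  interpret X: dd_partition xs by standard fact
  interpret Y: dd_partition ys by standard fact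
  have d: "durfee xs = durfee ys" using X.card_A Y.card_A eq by simp
  have M: "diag_part xs i = diag_part ys i" if i: "1 \<le> i" "i \<le> durfee xs" for i
  proof -
    have "diag_part xs i \<in> diag_set ys" using i unfolding eq[symmetric] by (auto simp: diag_set_def)
    then obtain k where k: "1 \<le> k" "k \<le> durfee ys" "diag_part xs i = diag_part ys k" by (auto simp: diag_set_def)
    have "i - 1 = k - 1" using X.rank_M[OF i] Y.rank_M[OF k(1,2)] k(3) eq by simp
    then show ?thesis using i k by (metis le_add_diff_inverse)
  qed
  have small: "part xs i = part ys i" if i: "1 \<le> i" "i \<le> durfee xs" for i
    using X.M_eq[OF i] Y.M_eq[of i] i M[OF i] d by simp
  show ?thesis
  proof (rule partition_eqI[OF X.xs Y.xs])
    fix i :: nat assume i: "1 \<le> i"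
    show "part xs i = part ys i"
    proof (cases "i \<le> durfee xs")
      case True then show ?thesis using small i by simp
    next
      case False
      have char: "j \<le> part zs i \<longleftrightarrow> j \<le> durfee zs \<and> i \<le> part zs j + 1"
        if zs: "zs \<in> DD'" and j: "1 \<le> j" and di: "durfee zs < i" for zs j
      proof -
        interpret Z: dd_partition zs by standard fact
        show ?thesis
        proof
          assume a: "j \<le> part zs i"
          then have "j < i" using Z.r_small[OF di] by simp
          then have "j \<le> part zs j" using part_antimono[OF Z.xs j, of i] a by simp
          then have "j \<le> durfee zs" using durfee_iff[OF Z.xs j] by simp
          then show "j \<le> durfee zs \<and> i \<le> part zs j + 1" using Z.rc[OF i j] Z.c_eq[OF j] a by simp
        next
          assume "j \<le> durfee zs \<and> i \<le> part zs j + 1"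
          then show "j \<le> part zs i" using Z.rc[OF i j] Z.c_eq[OF j] by simp
        qed
      qed
      show ?thesis
      proof (rule nat_eqI_ge1)
        fix j :: nat assume j: "1 \<le> j"
        show "j \<le> part xs i \<longleftrightarrow> j \<le> part ys i"
          using char[OF assms(1) j] char[OF assms(2) j] small[OF j] False d by auto
      qed
    qed
  qed
qed

lemma initial_segment_card:
  assumes anti: "\<And>i i'. 1 \<le> i \<Longrightarrow> i \<le> i' \<Longrightarrow> i' \<le> d \<Longrightarrow> R i' \<Longrightarrow> R i" and i: "1 \<le> i" "i \<le> d"
  shows "i \<le> card {k\<in>{1..d}. R k} \<longleftrightarrow> R i"
proof
  assume "R i"
  then have "{1..i} \<subseteq> {k\<in>{1..d}. R k}" using anti i by fastforce
  then have "card {1..i} \<le> card {k\<in>{1..d}. R k}" by (intro card_mono) auto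
  then show "i \<le> card {k\<in>{1..d}. R k}" by simp
next
  assume a: "i \<le> card {k\<in>{1..d}. R k}"
  show "R i"
  proof (rule ccontr)
    assume "\<not> R i"
    then have "k < i" if "k \<in> {1..d}" "R k" for k
      using anti[of i k] that i by (cases "k < i") auto
    then have "{k\<in>{1..d}. R k} \<subseteq> {1..<i}" by auto
    then have "card {k\<in>{1..d}. R k} \<le> card {1..<i}" by (intro card_mono) auto
    then show False using a i by simp
  qed
qed

text \<open>The elements m i in decreasing order prescribe the first d rows m i + i - 1 and columns
  m j + j. Later rows and columns are forced to count the earlier columns and rows that reach them,
  and \<open>partition_of_profile\<close> turns the two functions into a partition.\<close>

lemma diag_set_surj:
  assumes A: "finite A" "0 \<notin> A"
  obtains xs where "xs \<in> DD'" "diag_set xs = A"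
proof -
  define d where "d = card A"
  define e where "e = sorted_list_of_set A"
  \<comment> \<open>The list e increases, so m i is the i-th largest element of A.\<close>
  define m where "m i = e ! (d - i)" for i
  have e: "set e = A" "length e = d" "sorted_wrt (<) e"
    using A by (auto simp: e_def d_def)
  have mless: "m i' < m i" if "1 \<le> i" "i < i'" "i' \<le> d" for i i'
    unfolding m_def using sorted_wrt_nth_less[OF e(3), of "d - i'" "d - i"] that e(2) by auto
  have mA: "m ` {1..d} = A"
  proof
    show "m ` {1..d} \<subseteq> A" using e by (auto simp: m_def intro!: nth_mem)
    show "A \<subseteq> m ` {1..d}"
    proof
      fix a assume "a \<in> A"
      then obtain k where "k < d" "a = e ! k" using e by (metis in_set_conv_nth)
      then have "a = m (d - k)" "d - k \<in> {1..d}" by (auto simp: m_def)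
      then show "a \<in> m ` {1..d}" by blast
    qed
  qed
  have mpos: "1 \<le> m i" if "1 \<le> i" "i \<le> d" for i
  proof -
    have "m i \<in> A" using mA that by auto
    then show ?thesis using A(2) by (cases "m i") auto
  qed
  have mdec: "m i' + i' \<le> m i + i" if "1 \<le> i" "i \<le> i'" "i' \<le> d" for i i'
    using that(2,3)
  proof (induction i' rule: dec_induct)
    case (step k)
    then show ?case using mless[of k "Suc k"] that(1) by simp
  qed simp
  \<comment> \<open>Each of the first d rows has length at least d, so the square of size d fits
    into the diagram.\<close>
  have mlow: "d + 1 \<le> m i + i" if "1 \<le> i" "i \<le> d" for i
    using mdec[of i d] mpos[of d] that by simp
  define r where "r i = (if i \<le> d then m i + i - 1 else card {j\<in>{1..d}. i \<le> m j + j})" for i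
  define c where "c j = (if j \<le> d then m j + j else card {i\<in>{1..d}. j \<le> m i + i - 1})" for j
  have cle: "card {j\<in>{1..d}. R j} \<le> d" for R
  proof -
    have "card {j\<in>{1..d}. R j} \<le> card {1..d}" by (rule card_mono) auto
    then show ?thesis by simp
  qed
  have prof: "j \<le> r i \<longleftrightarrow> i \<le> c j" if i: "1 \<le> i" and j: "1 \<le> j" for i j
  proof (cases "i \<le> d")
    case iT: True
    show ?thesis
    proof (cases "j \<le> d")
      case True
      then show ?thesis using iT mlow[OF i] mlow[OF j] by (simp add: r_def c_def)
    next
      case False
      have "i \<le> card {i\<in>{1..d}. j \<le> m i + i - 1} \<longleftrightarrow> j \<le> m i + i - 1"
      proof (rule initial_segment_card[OF _ i iT])
        fix k k' assume "1 \<le> k" "k \<le> k'" "k' \<le> d" "j \<le> m k' + k' - 1"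
        then show "j \<le> m k + k - 1" using mdec[of k k'] by linarith
      qed
      then show ?thesis using iT False by (simp add: r_def c_def)
    qed
  next
    case iF: False
    show ?thesis
    proof (cases "j \<le> d")
      case True
      have "j \<le> card {j\<in>{1..d}. i \<le> m j + j} \<longleftrightarrow> i \<le> m j + j"
      proof (rule initial_segment_card[OF _ j True])
        fix k k' assume "1 \<le> k" "k \<le> k'" "k' \<le> d" "i \<le> m k' + k'"
        then show "i \<le> m k + k" using mdec[of k k'] by linarith
      qed
      then show ?thesis using iF True by (simp add: r_def c_def)
    next
      case False
      then show ?thesis using iF cle[of "\<lambda>j. i \<le> m j + j"] cle[of "\<lambda>i. j \<le> m i + i - 1"]
        by (simp add: r_def c_def)
    qed
  qed
  define xs where "xs = map r [1..<Suc (c 1)]"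
  have xs: "xs \<in> partitions" and rxs: "\<And>i. 1 \<le> i \<Longrightarrow> part xs i = r i" and cxs: "\<And>j. 1 \<le> j \<Longrightarrow> col xs j = c j"
    unfolding xs_def using partition_of_profile[of r c, OF prof] by auto
  have dur: "durfee xs = d"
  proof (rule nat_eqI_ge1)
    fix i :: nat assume i: "1 \<le> i"
    have "i \<le> r i \<longleftrightarrow> i \<le> d"
      using mpos[OF i] cle[of "\<lambda>j. i \<le> m j + j"] by (auto simp: r_def)
    then show "i \<le> durfee xs \<longleftrightarrow> i \<le> d" using durfee_iff[OF xs i] rxs[OF i] by simp
  qed
  have "xs \<in> DD'"
    unfolding DD'_iff dur using xs rxs cxs mpos by (auto simp: r_def c_def)
  moreover have "diag_set xs = A"
  proof -
    have "diag_part xs i = m i" if "i \<in> {1..d}" for i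
      using that rxs[of i] mpos[of i] by (simp add: diag_part_def r_def)
    then have "diag_set xs = m ` {1..d}" unfolding diag_set_def dur by (rule image_cong[OF refl])
    then show ?thesis using mA by simp
  qed
  ultimately show ?thesis using that by blast
qed

lemma sum_DD'_reindex:
  fixes f :: "nat list \<Rightarrow> 'b::comm_monoid_add"
  assumes "\<And>xs. xs \<in> DD' \<Longrightarrow> f xs = g (diag_set xs)"
  shows "(\<Sum>xs | xs \<in> DD' \<and> sum_list xs = 2 * n. f xs) = (\<Sum>A | A \<subseteq> {1..n} \<and> \<Sum>A = n. g A)"
proof -
  have "bij_betw diag_set {xs. xs \<in> DD' \<and> sum_list xs = 2 * n} {A. A \<subseteq> {1..n} \<and> \<Sum>A = n}"
    unfolding bij_betw_def
  proof
    show "inj_on diag_set {xs. xs \<in> DD' \<and> sum_list xs = 2 * n}"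
      using diag_set_inject by (auto simp: inj_on_def)
    show "diag_set ` {xs. xs \<in> DD' \<and> sum_list xs = 2 * n} = {A. A \<subseteq> {1..n} \<and> \<Sum>A = n}"
    proof
      show "diag_set ` {xs. xs \<in> DD' \<and> sum_list xs = 2 * n} \<subseteq> {A. A \<subseteq> {1..n} \<and> \<Sum>A = n}"
      proof
        fix A assume "A \<in> diag_set ` {xs. xs \<in> DD' \<and> sum_list xs = 2 * n}"
        then obtain xs where xs: "xs \<in> DD'" "sum_list xs = 2 * n" "A = diag_set xs" by auto
        interpret X: dd_partition xs by standard fact
        have s: "\<Sum>A = n" using X.sum_list_eq xs by simp
        have "a \<le> n" if "a \<in> A" for a
          using member_le_sum[of a A id] that X.finite_A xs(3) s by simp
        then show "A \<in> {A. A \<subseteq> {1..n} \<and> \<Sum>A = n}" using s X.A_pos xs(3) by auto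
      qed
      show "{A. A \<subseteq> {1..n} \<and> \<Sum>A = n} \<subseteq> diag_set ` {xs. xs \<in> DD' \<and> sum_list xs = 2 * n}"
      proof
        fix A assume A: "A \<in> {A. A \<subseteq> {1..n} \<and> \<Sum>A = n}"
        then have "finite A" "0 \<notin> A" using finite_subset by auto
        then obtain xs where xs: "xs \<in> DD'" "diag_set xs = A" using diag_set_surj by blast
        interpret X: dd_partition xs by standard fact
        have "sum_list xs = 2 * n" using X.sum_list_eq xs A by simp
        then show "A \<in> diag_set ` {xs. xs \<in> DD' \<and> sum_list xs = 2 * n}" using xs by auto
      qed
    qed
  qed
  then have "(\<Sum>xs | xs \<in> DD' \<and> sum_list xs = 2 * n. g (diag_set xs)) = (\<Sum>A | A \<subseteq> {1..n} \<and> \<Sum>A = n. g A)"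
    by (rule sum.reindex_bij_betw)
  moreover have "(\<Sum>xs | xs \<in> DD' \<and> sum_list xs = 2 * n. f xs) = (\<Sum>xs | xs \<in> DD' \<and> sum_list xs = 2 * n. g (diag_set xs))"
    by (rule sum.cong) (auto simp: assms)
  ultimately show ?thesis by simp
qed


section \<open>Comparison of the two sides\<close>

context qparam
begin

definition coeff_sum :: "nat \<Rightarrow> 'a" where
  "coeff_sum m = (\<Sum>A | A \<subseteq> {1..m} \<and> \<Sum>A = m. strict_weight A)"

lemma state_sum_nth:
  assumes "j \<le> n" "n \<le> N"
  shows "fps_nth (state_sum n (wt N)) j = wt N (conf {}) * coeff_sum j"
proof -
  have "fps_nth (state_sum n (wt N)) j = (\<Sum>A\<in>Pow {1..n}. if \<Sum>A = j then wt N (conf A) else 0)"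
    unfolding state_sum_def fps_sum_nth by (rule sum.cong) (auto simp: fps_X_power_iff)
  also have "\<dots> = (\<Sum>A | A \<subseteq> {1..j} \<and> \<Sum>A = j. wt N (conf A))"
  proof (rule sum.mono_neutral_cong_right)
    show "{A. A \<subseteq> {1..j} \<and> \<Sum>A = j} \<subseteq> Pow {1..n}" using assms by fastforce
    show "\<forall>A\<in>Pow {1..n} - {A. A \<subseteq> {1..j} \<and> \<Sum>A = j}. (if \<Sum>A = j then wt N (conf A) else 0) = 0"
    proof
      fix A assume A: "A \<in> Pow {1..n} - {A. A \<subseteq> {1..j} \<and> \<Sum>A = j}"
      show "(if \<Sum>A = j then wt N (conf A) else 0) = 0"
      proof (cases "\<Sum>A = j")
        case True
        have "finite A" using A finite_subset by auto
        then have "a \<le> j" if "a \<in> A" for a using member_le_sum[of a A id] that True by simp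
        then show ?thesis using A True by auto
      qed simp
    qed
  qed auto
  also have "\<dots> = (\<Sum>A | A \<subseteq> {1..j} \<and> \<Sum>A = j. wt N (conf {}) * strict_weight A)"
  proof (rule sum.cong[OF refl])
    fix A assume "A \<in> {A. A \<subseteq> {1..j} \<and> \<Sum>A = j}"
    then have "A \<subseteq> {1..N}" using assms by auto
    then show "wt N (conf A) = wt N (conf {}) * strict_weight A" by (rule wt_conf)
  qed
  finally show ?thesis by (simp add: coeff_sum_def sum_distrib_left)
qed

text \<open>Every m uses its own truncation N = 3 m. The weight of the ground state is the only
  quantity depending on N; it is nonzero and cancels, so the relations for all m form one
  recursion.\<close>

lemma coeff_sum_recursion:
  "of_nat m * coeff_sum m = (\<Sum>i=1..m. fps_nth (log_series log_coeff) i * coeff_sum (m - i))"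
proof -
  define w0 where "w0 = wt (3 * m) (conf {})"
  have w0: "w0 \<noteq> 0"
    unfolding w0_def by (rule wt_nonzero[OF inj_on_conf]) (simp add: conf_def)
  have f: "fps_nth (state_sum m (wt (3 * m))) j = w0 * coeff_sum j" if "j \<le> m" for j
    unfolding w0_def by (rule state_sum_nth[OF that]) simp
  have l0: "fps_nth (log_series log_coeff) 0 = 0" by (simp add: log_series_def)
  have "of_nat m * (w0 * coeff_sum m) = fps_nth (fps_X * fps_deriv (state_sum m (wt (3 * m)))) m"
    unfolding fps_nth_X_deriv f[OF order_refl] ..
  also have "\<dots> = fps_nth (log_series log_coeff * state_sum m (wt (3 * m))) m"
    using state_sum_log_derivative[of "3 * m" m] unfolding fps_cong_def by blast
  also have "\<dots> = (\<Sum>i=0..m. fps_nth (log_series log_coeff) i * fps_nth (state_sum m (wt (3 * m))) (m - i))"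
    by (rule fps_mult_nth)
  also have "\<dots> = (\<Sum>i=1..m. fps_nth (log_series log_coeff) i * fps_nth (state_sum m (wt (3 * m))) (m - i))"
    using l0 by (subst sum.atLeast_Suc_atMost) auto
  also have "\<dots> = (\<Sum>i=1..m. fps_nth (log_series log_coeff) i * (w0 * coeff_sum (m - i)))"
    by (rule sum.cong) (auto simp: f)
  also have "\<dots> = w0 * (\<Sum>i=1..m. fps_nth (log_series log_coeff) i * coeff_sum (m - i))"
    by (simp add: sum_distrib_left mult_ac)
  finally show ?thesis using w0 by simp
qed

text \<open>With s H the part of \<open>eig k\<close> other than its parity term,
  \<open>log_coeff k\<close> equals - s H + (eig (2 k) - H^2) / 2. The first summand matches the
  factors of the product with exponent 1, the second those with exponent ceiling (r / 2).\<close>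

lemma log_coeff_eq:
  assumes k: "0 < k"
  defines "a \<equiv> u ^ k" and "x \<equiv> q ^ k" and "s \<equiv> (-1) ^ k"
  shows "log_coeff k = (s * a - s / a) * (x / (1 - x))
     + (1 + x - a^2 * x - 1 / a^2) * (x / ((1 - x^2) * (1 - x))) - s / a"
proof -
  have a0: "a \<noteq> 0" using u_nonzero by (simp add: a_def)
  have x1: "1 - x \<noteq> 0" using q_power[OF k] by (simp add: x_def)
  have x2: "1 - x^2 \<noteq> 0" using q_power[of "k * 2"] k by (simp add: x_def power_mult[symmetric])
  have xx: "1 - x^2 = (1 - x) * (1 + x)" by (simp add: power2_eq_square algebra_simps)
  have x3: "1 + x \<noteq> 0" using x2 xx by auto
  define b where "b = 1 / a"
  have ab: "a * b = 1" using a0 by (simp add: b_def)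
  define H where "H = (b - a * x) / (1 - x)"
  \<comment> \<open>The parity terms of \<open>eig\<close> and of \<open>log_coeff\<close> are
    complementary and add up to 1 for every k.\<close>
  have e1: "eig k + (if even k then 1 else 0) = 1 + s * H"
    by (simp add: eig_def H_def a_def[symmetric] x_def[symmetric] s_def[symmetric] b_def power_inverse[symmetric] power_one_over inverse_eq_divide)
  have e2: "eig (2 * k) = (b^2 - a^2 * x^2) / (1 - x^2)"
    by (simp add: eig_def a_def x_def b_def power_mult[symmetric] power_inverse power_divide inverse_eq_divide mult.commute)
  have s2: "s * s = 1" by (simp add: s_def flip: power_add)
  have h1: "- (s * H) = (s * a - s * b) * (x / (1 - x)) - s * b"
    using x1 by (simp add: H_def field_simps)
  have h2: "(b^2 - a^2 * x^2) / (1 - x^2) - H^2 = 2 * ((1 + x - a^2 * x - b^2) * (x / ((1 - x^2) * (1 - x))))"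
  proof -
    have H2: "H^2 = (b^2 - 2 * x + a^2 * x^2) / (1 - x)^2"
    proof -
      have "(b - a * x)^2 = b^2 - 2 * (a * b) * x + a^2 * x^2" by (simp add: power2_eq_square algebra_simps)
      then show ?thesis by (simp add: H_def power_divide ab)
    qed
    have "(b^2 - a^2 * x^2) * (1 - x) - (b^2 - 2 * x + a^2 * x^2) * (1 + x) = 2 * ((1 + x - a^2 * x - b^2) * x)"
      by (simp add: power2_eq_square algebra_simps)
    moreover have "P / ((1 - x) * (1 + x)) - P' / (1 - x)^2 = (P * (1 - x) - P' * (1 + x)) / ((1 - x) * (1 + x) * (1 - x))" for P P'
    proof -
      have "P / (y * z) - P' / y^2 = (P * y - P' * z) / (y * z * y)" if "y \<noteq> 0" "z \<noteq> 0" for y z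
        using that by (simp add: field_simps power2_eq_square)
      then show ?thesis using x1 x3 by blast
    qed
    ultimately show ?thesis unfolding H2 xx by simp
  qed
  have "log_coeff k = ((b^2 - a^2 * x^2) / (1 - x^2) + 1 - (1 + s * H)^2) / 2"
    unfolding log_coeff_def e1 e2 ..
  also have "(1 + s * H)^2 = 1 + 2 * (s * H) + H^2"
  proof -
    have "(1 + s * H)^2 = 1 + 2 * (s * H) + (s * s) * H^2" by (simp add: power2_eq_square algebra_simps)
    then show ?thesis by (simp add: s2)
  qed
  also have "((b^2 - a^2 * x^2) / (1 - x^2) + 1 - (1 + 2 * (s * H) + H^2)) / 2 =
     - (s * H) + ((b^2 - a^2 * x^2) / (1 - x^2) - H^2) / 2" by (simp add: field_simps)
  also have "\<dots> = (s * a - s * b) * (x / (1 - x)) - s * b + (1 + x - a^2 * x - b^2) * (x / ((1 - x^2) * (1 - x)))"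
    unfolding h1 h2 by simp
  finally show ?thesis by (simp add: b_def power_divide)
qed

end

section \<open>Specialisation to Laurent series in q over the rational functions in u\<close>

lemma u_nonzero_ratfun: "u \<noteq> 0"
  by (simp add: u_def)

lemma u_square_ratfun: "u^2 \<noteq> 1"
proof
  assume "u^2 = 1"
  then have "to_fract ([:0, 1:] * [:0, 1:] :: rat poly) = to_fract 1"
    by (simp only: u_def power2_eq_square to_fract_mult to_fract_1)
  then have "([:0, 1:] * [:0, 1:] :: rat poly) = 1" by (simp only: to_fract_eq_iff)
  then have "coeff ([:0, 1:] * [:0, 1:] :: rat poly) 0 = coeff 1 0" by (simp only:)
  then show False by simp
qed

text \<open>Positions are negative, so powers of q with negative exponents are needed.\<close>

interpretation fls: qparam "fls_X :: ratfun fls" "fls_const u"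
proof
  show "(fls_X :: ratfun fls) \<noteq> 0" by simp
  show "fls_const u \<noteq> 0" using u_nonzero_ratfun by simp
  fix k :: nat assume k: "0 < k"
  show "(fls_X :: ratfun fls) ^ k \<noteq> 1"
  proof
    assume "(fls_X :: ratfun fls) ^ k = 1"
    then have "fps_to_fls (fps_X ^ k :: ratfun fps) = fps_to_fls 1" by (simp add: fps_to_fls_power)
    then have "(fps_X ^ k :: ratfun fps) = 1" by (simp only: fps_to_fls_eq_iff)
    then have "fps_nth (fps_X ^ k :: ratfun fps) 0 = fps_nth 1 0" by (simp only:)
    then show False using k by (cases k) auto
  qed
next
  fix i :: int
  have const: "(fls_const u)^2 = fps_to_fls (fps_const (u^2))" by (simp add: fls_const_power)
  show "(fls_const u)^2 * fls_X powi i \<noteq> 1"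
  proof
    assume a: "(fls_const u)^2 * fls_X powi i = 1"
    show False
    \<comment> \<open>After multiplication by a power of q when i is negative, both cases compare
      constant coefficients of power series.\<close>
    proof (cases "0 \<le> i")
      case True
      then obtain n where i: "i = int n" using zero_le_imp_eq_int by blast
      have "fps_to_fls (fps_const (u^2) * fps_X ^ n) = fps_to_fls 1"
        using a unfolding const i by (simp add: fls_times_fps_to_fls fps_to_fls_power)
      then have "fps_const (u^2) * fps_X ^ n = 1" by (simp only: fps_to_fls_eq_iff)
      then have "fps_nth (fps_const (u^2) * fps_X ^ n) 0 = fps_nth 1 0" by (simp only:)
      then show False using u_square_ratfun by (cases n) auto
    next
      case False
      then obtain n where i: "i = - int n" "0 < n" by (metis neg_int_cases not_le)
      have "fps_to_fls (fps_const (u^2)) * inverse (fls_X ^ n) = 1"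
        using a unfolding const i by (simp add: power_int_minus)
      moreover have "fps_to_fls (fps_const (u^2)) = fps_to_fls (fps_const (u^2)) * inverse (fls_X ^ n) * fls_X ^ n"
        by (simp only: mult.assoc left_inverse[OF power_not_zero[OF fls_X_nonzero]] mult_1_right)
      ultimately have "fps_to_fls (fps_const (u^2)) = fls_X ^ n" by (simp only: mult_1_left)
      then have "fps_to_fls (fps_const (u^2)) = fps_to_fls (fps_X ^ n)" by (simp add: fps_to_fls_power)
      then have "fps_const (u^2) = fps_X ^ n" by (simp only: fps_to_fls_eq_iff)
      then have "fps_nth (fps_const (u^2)) 0 = fps_nth (fps_X ^ n) 0" by (simp only:)
      then show False using i u_nonzero_ratfun by simp
    qed
  qed
qed

lemma fps_to_fls_prod: "fps_to_fls (\<Prod>i\<in>I. f i) = (\<Prod>i\<in>I. fps_to_fls (f i))" for f :: "'i \<Rightarrow> 'a::comm_ring_1 fps"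
  by (induction I rule: infinite_finite_induct) (auto simp: fls_times_fps_to_fls)

lemma fps_to_fls_sum: "fps_to_fls (\<Sum>i\<in>I. f i) = (\<Sum>i\<in>I. fps_to_fls (f i))" for f :: "'i \<Rightarrow> 'a::comm_ring_1 fps"
  by (induction I rule: infinite_finite_induct) auto

lemma fps_to_fls_divide: "fps_nth g 0 \<noteq> 0 \<Longrightarrow> fps_to_fls (f / g) = fps_to_fls f / fps_to_fls g" for f g :: "'a::field fps"
  by (subst fls_divide_fps_to_fls) (auto simp: subdegree_eq_0_iff)

text \<open>Hook lengths are positive, so all denominators have constant term 1 and division
  commutes with the embedding. The prefactor u^(-d) supplies one inverse of u per element of the
  diagonal set, which turns 1 + u^(-1) q^m into u + q^m.\<close>

lemma weight_to_fls:
  assumes "xs \<in> DD'"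
  shows "fps_to_fls (weight xs) = fls.strict_weight (diag_set xs)"
proof -
  interpret X: dd_partition xs by standard fact
  have u0: "fls_const u \<noteq> 0" using u_nonzero_ratfun by simp
  have hook: "0 < hook xs s" for s by (simp add: hook_def split: prod.split)
  have "fps_to_fls (\<Prod>s\<in>boxes xs. (1 - fps_const (u powi (- 2 * eps s)) * q ^ hook xs s) / (1 - q ^ hook xs s)) =
    (\<Prod>s\<in>boxes xs. case s of (i, j) \<Rightarrow> if i > j then fls.gd (hook xs s) else fls.gu (hook xs s))"
    unfolding fps_to_fls_prod
  proof (rule prod.cong[OF refl])
    fix s :: "nat \<times> nat"
    obtain i j where s: "s = (i, j)" by (cases s)
    define h where "h = hook xs (i, j)"
    have h: "0 < h" using hook by (simp add: h_def)
    have "fps_to_fls ((1 - fps_const (u powi (- 2 * eps (i, j))) * q ^ h) / (1 - q ^ h)) =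
      (1 - fls_const (u powi (- 2 * eps (i, j))) * fls_X ^ h) / (1 - fls_X ^ h)"
      using h by (subst fps_to_fls_divide) (auto simp: q_def fls_times_fps_to_fls fps_to_fls_power)
    moreover have "fls_const (u powi (- 2 * eps (i, j))) = (if i > j then (fls_const u)^2 else inverse ((fls_const u)^2))"
      by (auto simp: eps_def fls_const_power power_int_minus fls_inverse_const[symmetric])
    ultimately have "fps_to_fls ((1 - fps_const (u powi (- 2 * eps (i, j))) * q ^ h) / (1 - q ^ h)) =
      (if i > j then fls.gd h else fls.gu h)"
      by (simp add: fls.gd_def fls.gu_def divide_inverse mult.commute)
    then show "fps_to_fls ((1 - fps_const (u powi (- 2 * eps s)) * q ^ hook xs s) / (1 - q ^ hook xs s)) =
      (case s of (i, j) \<Rightarrow> if i > j then fls.gd (hook xs s) else fls.gu (hook xs s))"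
      unfolding s h_def prod.case .
  qed
  also have "\<dots> = (\<Prod>m\<in>diag_set xs. fls.gu (2 * m) * (\<Prod>t\<in>{1..<m}-diag_set xs. fls.gu (m - t)) * (\<Prod>t\<in>{..<m}-diag_set xs. fls.gd (m - t))
        * (\<Prod>m'\<in>{m'\<in>diag_set xs. m' < m}. fls.gu (m + m') * fls.gd (m + m')))"
    by (rule X.boxes_prod)
  finally have 1: "fps_to_fls (\<Prod>s\<in>boxes xs. (1 - fps_const (u powi (- 2 * eps s)) * q ^ hook xs s) / (1 - q ^ hook xs s)) = \<dots>" .
  have "(\<Prod>s\<in>diagonal xs. (1 + fps_const u * q ^ (hook xs s div 2)) / (1 + fps_const (inverse u) * q ^ (hook xs s div 2))) =
      (\<Prod>m\<in>diag_set xs. (1 + fps_const u * q ^ m) / (1 + fps_const (inverse u) * q ^ m))"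
    by (rule X.diagonal_prod)
  then have "fps_to_fls (\<Prod>s\<in>diagonal xs. (1 + fps_const u * q ^ (hook xs s div 2)) / (1 + fps_const (inverse u) * q ^ (hook xs s div 2))) =
      (\<Prod>m\<in>diag_set xs. fps_to_fls ((1 + fps_const u * q ^ m) / (1 + fps_const (inverse u) * q ^ m)))"
    by (simp only: fps_to_fls_prod)
  also have "\<dots> = (\<Prod>m\<in>diag_set xs. (1 + fls_const u * fls_X ^ m) / (1 + inverse (fls_const u) * fls_X ^ m))"
  proof (rule prod.cong[OF refl])
    fix m assume "m \<in> diag_set xs"
    then have "0 < m" using X.A_pos by fastforce
    then show "fps_to_fls ((1 + fps_const u * q ^ m) / (1 + fps_const (inverse u) * q ^ m)) =
       (1 + fls_const u * fls_X ^ m) / (1 + inverse (fls_const u) * fls_X ^ m)"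
      by (subst fps_to_fls_divide) (auto simp: q_def fls_times_fps_to_fls fps_to_fls_power fls_inverse_const[symmetric])
  qed
  finally have 2: "fps_to_fls (\<Prod>s\<in>diagonal xs. (1 + fps_const u * q ^ (hook xs s div 2)) / (1 + fps_const (inverse u) * q ^ (hook xs s div 2))) = \<dots>" .
  have 3: "fps_to_fls (fps_const (u powi (- int (durfee xs)))) = (\<Prod>m\<in>diag_set xs. inverse (fls_const u))"
    by (simp add: X.card_A power_int_minus fls_inverse_const[symmetric] fls_const_power power_inverse)
  have c: "(1 + fls_const u * fls_X ^ m) / (fls_const u + fls_X ^ m) =
      inverse (fls_const u) * ((1 + fls_const u * fls_X ^ m) / (1 + inverse (fls_const u) * fls_X ^ m))" for m
  proof -
    have "fls_const u + fls_X ^ m = fls_const u * (1 + inverse (fls_const u) * fls_X ^ m)"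
      using u0 by (simp add: distrib_left mult.assoc[symmetric])
    then show ?thesis by (simp add: divide_inverse mult_ac)
  qed
  show ?thesis
    unfolding weight_def fls_times_fps_to_fls 1 2 3 fls.strict_weight_def c prod.distrib[symmetric]
    by (rule prod.cong[OF refl]) (simp only: mult_ac)
qed

lemma outer_log_to_fls:
  assumes k: "0 < k"
  shows "fps_to_fls (outer_log k) = fls.log_coeff k"
proof -
  define a where "a = fls_const u ^ k"
  define x where "x = (fls_X :: ratfun fls) ^ k"
  define s where "s = (-1 :: ratfun fls) ^ k"
  have x1: "1 - x \<noteq> 0" using fls.q_power[OF k] by (simp add: x_def)
  have x2: "1 - x^2 \<noteq> 0" using fls.q_power[of "k * 2"] k by (simp add: x_def power_mult[symmetric])
  have X: "fps_to_fls (fps_X ^ k) = x" by (simp add: x_def fps_to_fls_power)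
  have X2: "fps_to_fls (fps_X ^ (2 * k)) = x^2"
    by (simp add: x_def fps_to_fls_power power_mult[symmetric] mult.commute)
  have r1: "fps_to_fls (ray (\<lambda>r. 1) k) = x / (1 - x)"
  proof -
    have "(1 - x) * fps_to_fls (ray (\<lambda>r. 1) k) = x"
      using arg_cong[OF ray_one[OF k, where 'a = ratfun], of fps_to_fls] by (simp only: fls_times_fps_to_fls fps_to_fls_minus fps_one_to_fls X)
    then show ?thesis using x1 by (simp add: eq_divide_eq mult.commute)
  qed
  have r2: "fps_to_fls (ray half_weight k) = x / ((1 - x^2) * (1 - x))"
  proof -
    have "(1 - x^2) * ((1 - x) * fps_to_fls (ray half_weight k)) = x"
      using arg_cong[OF ray_half[OF k, where 'a = ratfun], of fps_to_fls]
      by (simp only: fls_times_fps_to_fls fps_to_fls_minus fps_one_to_fls X X2 half_weight_def[abs_def])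
    then show ?thesis using x1 x2 by (simp add: eq_divide_eq mult_ac)
  qed
  have c1: "fps_to_fls (fps_const ((- u) ^ k)) = s * a"
    by (cases "even k") (simp_all add: s_def a_def fls_const_power)
  have c2: "fps_to_fls (fps_const ((- inverse u) ^ k)) = s / a"
    by (cases "even k") (simp_all add: s_def a_def fls_const_power fls_inverse_const[symmetric] power_inverse divide_inverse)
  have c3: "fps_to_fls (fps_const ((u^2) ^ k)) = a^2"
    by (simp add: a_def fls_const_power power_mult[symmetric] mult.commute)
  have "(u powi (- 2)) ^ k = inverse ((u^2) ^ k)" by (simp add: power_int_minus power_inverse)
  then have c4: "fps_to_fls (fps_const ((u powi (- 2)) ^ k)) = 1 / a^2"
    using c3 by (simp only: fps_const_to_fls fls_inverse_const[symmetric]) (simp only: inverse_eq_divide)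
  have "fps_to_fls (outer_log k) = (s * a - s / a) * (x / (1 - x)) + (1 + x - a^2 * x - 1 / a^2) * (x / ((1 - x^2) * (1 - x))) - s / a"
    unfolding outer_log_def inner_log_def fps_to_fls_minus fps_to_fls_plus fls_times_fps_to_fls fps_one_to_fls r1 r2 c1 c2 c3 c4 X ..
  then show ?thesis unfolding fls.log_coeff_eq[OF k] a_def x_def s_def .
qed

lemma log_series_to_fls:
  "fps_to_fls (fps_nth (log_series outer_log) j) = fps_nth (log_series fls.log_coeff) j"
proof -
  have "fps_to_fls (fps_nth (log_series outer_log) j) = (\<Sum>k\<in>{k\<in>{1..j}. k dvd j}. fps_to_fls (outer_log k) * of_nat (j div k))"
    by (simp add: log_series_def fps_to_fls_sum fls_times_fps_to_fls fps_to_fls_of_nat)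
  also have "\<dots> = (\<Sum>k\<in>{k\<in>{1..j}. k dvd j}. fls.log_coeff k * of_nat (j div k))"
    by (rule sum.cong) (auto simp: outer_log_to_fls)
  finally show ?thesis by (simp add: log_series_def)
qed

theorem theorem6p7:
  shows "(\<forall>m\<ge>1. fprod_converges (inner_factor m)) \<and> fprod_converges outer_factor
         \<and> DD'_series = fprod outer_factor"
proof (intro conjI allI impI)
  fix m :: nat assume "1 \<le> m"
  then show "fprod_converges (inner_factor m)" using fprod_inner_log_deriv[of m] by simp
next
  show "fprod_converges outer_factor" using outer_product_log_deriv by blast
next
  have P: "has_log_deriv (fprod outer_factor) (log_series outer_log)" using outer_product_log_deriv by blast
  have l0: "fps_nth (log_series outer_log) 0 = 0" by (simp add: log_series_def)
  show "DD'_series = fprod outer_factor"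
  proof (rule fps_ext)
    fix n
    have "fps_to_fls (fps_nth DD'_series n) = (\<Sum>xs | xs \<in> DD' \<and> sum_list xs = 2 * n. fps_to_fls (weight xs))"
      by (simp add: DD'_series_def fps_to_fls_sum)
    also have "\<dots> = fls.coeff_sum n"
      unfolding fls.coeff_sum_def by (rule sum_DD'_reindex) (rule weight_to_fls)
    \<comment> \<open>Both sequences of coefficients start with 1 and satisfy the recursion
      belonging to the same logarithmic derivative.\<close>
    also have "\<dots> = fps_to_fls (fps_nth (fprod outer_factor) n)"
    proof (rule has_log_deriv_unique_nth[where n = n and e = "\<lambda>i. fps_nth (log_series fls.log_coeff) i"])
      show "fls.coeff_sum 0 = fps_to_fls (fps_nth (fprod outer_factor) 0)"
      proof -
        have "{A::nat set. A \<subseteq> {1..0} \<and> \<Sum>A = 0} = {{}}" by auto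
        then have "fls.coeff_sum 0 = 1" by (simp add: fls.coeff_sum_def fls.strict_weight_def)
        then show ?thesis using P by (simp add: has_log_deriv_def)
      qed
      fix j
      show "of_nat j * fls.coeff_sum j = (\<Sum>i=1..j. fps_nth (log_series fls.log_coeff) i * fls.coeff_sum (j - i))"
        by (rule fls.coeff_sum_recursion)
      have "of_nat j * fps_to_fls (fps_nth (fprod outer_factor) j) = fps_to_fls (of_nat j * fps_nth (fprod outer_factor) j)"
        by (simp add: fls_times_fps_to_fls fps_to_fls_of_nat)
      also have "\<dots> = (\<Sum>i=1..j. fps_to_fls (fps_nth (log_series outer_log) i) * fps_to_fls (fps_nth (fprod outer_factor) (j - i)))"
        unfolding has_log_deriv_nth[OF P l0] by (simp add: fps_to_fls_sum fls_times_fps_to_fls)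
      finally show "of_nat j * fps_to_fls (fps_nth (fprod outer_factor) j) =
        (\<Sum>i=1..j. fps_nth (log_series fls.log_coeff) i * fps_to_fls (fps_nth (fprod outer_factor) (j - i)))"
        unfolding log_series_to_fls .
    qed simp
    finally show "fps_nth DD'_series n = fps_nth (fprod outer_factor) n" by simp
  qed
qed

end
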